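(* Let $\mathsf H$ be a quaternionic Hilbert space and let $\imath\in\mathbb S$. Let $T\in\mathfrak B(\mathsf H)$ be a normal operator. Then there exists an iqPVM $\mathcal P=(P,\mathcal L)$ over $\mathbb C_\imath^+$ in $\mathsf H$, with $\mathrm{supp}(P)$ bounded, such that $$T=\int_{\mathbb C_\imath^+}\mathit{id}\,d\mathcal P, \qquad ( * )$$ where $\mathit{id}:\mathbb C_\imath^+\hookrightarrow\mathbb H$ is the inclusion map. The qPVM $P$ is uniquely determined by $T$ on the whole $\mathscr B(\mathbb C_\imath^+)$, while for each $q\in\mathbb C_\imath$ the operator $L_q:=\mathcal L(q)$ is uniquely determined by $T$ on $\mathrm{Ker}(T-T^* )^\perp$ (that is, any two such iqPVMs satisfying $( * )$ have the same qPVM, and their left scalar multiplications by $q\in\mathbb C_\imath$ agree on $\mathrm{Ker}(T-T^* )^\perp$). Moreover, with $P$ this unique qPVM: (1) A left scalar multiplication $\mathcal L:q\mapsto L_q$ of $\mathsf H$ defines an iqPVM $\mathcal P=(P,\mathcal L)$ satisfying $( * )$ if and only if the following three conditions hold: $L_\imath T=TL_\imath$; $L_\jmath T=T^*L_\jmath$ for some $\jmath\in\mathbb S$ with $\imath\jmath=-\jmath\imath$; $-L_\imath(T-T^* )$ is a positive operator. (2) $\mathrm{supp}(P)=\sigma_S(T)\cap\mathbb C_\imath^+$. A point $q\in\mathbb C_\imath^+$ belongs to $\sigma_{pS}(T)$ if and only if $P(\{q\})\neq0$. A point $q\in\mathbb C_\imath^+$ belongs to $\sigma_{cS}(T)$ if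 and only if $P(\{q\})=0$ and $P(U)\ne0$ for every open neighborhood $U$ of $q$ in $\mathbb C_\imath^+$. Finally, $\sigma_{rS}(T)=\emptyset$.
   Context: $\mathbb H$ denotes the quaternions, $\mathbb S=\{q\in\mathbb H: q^2=-1\}$ the imaginary units. For $\imath\in\mathbb S$: $\mathbb C_\imath=\{\alpha+\imath\beta:\alpha,\beta\in\mathbb R\}$ and $\mathbb C_\imath^+=\{\alpha+\imath\beta:\alpha,\beta\in\mathbb R,\ \beta\ge0\}$, with Euclidean topology and Borel $\sigma$-algebra $\mathscr B(\mathbb C_\imath^+)$. A quaternionic Hilbert space $\mathsf H$ is a non-zero right $\mathbb H$-module with an additive $\mathbb H$-valued product satisfying $\langle u|vp+wq\rangle=\langle u|v\rangle p+\langle u|w\rangle q$, $\langle u|v\rangle=\overline{\langle v|u\rangle}$, $\langle u|u\rangle\ge0$, such that $\|u\|=\sqrt{\langle u|u\rangle}$ is a complete norm. Operators are right $\mathbb H$-linear; $\mathfrak B(\mathsf H)$ is the set of bounded operators $\mathsf H\to\mathsf H$; $T^*$ is the adjoint; $T$ is normal if $TT^*=T^*T$, and positive if $\langle u|Tu\rangle\in[0,\infty)$ for all $u$ in its domain. Left scalar multiplication: given a Hilbert (orthonormal, total) basis $N$ of $\mathsf H$, the left scalar multiplication induced by $N$ is the map $\mathcal L:\mathbb H\to\mathfrak B(\mathsf H)$, $\mathcal L(q)=L_q$, $L_qu=\sum_{z\in N}zq\langle z|u\rangle$. A left scalar multiplication is a map arising this way from some Hilbert basis. qPVM over $\mathbb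 C_\imath^+$ in $\mathsf H$: a map $P:\mathscr B(\mathbb C_\imath^+)\to\mathfrak B(\mathsf H)$ with $P(E)\ge0$ for all $E$, $P(\mathbb C_\imath^+)=I$, $P(E)P(E')=P(E\cap E')$, and $\sum_nP(E_n)u=P(\bigcup_nE_n)u$ for all $u\in\mathsf H$ and all countable families of pairwise disjoint Borel sets. $\mathrm{supp}(P)$ is the complement of the union of all open $O\subset\mathbb C_\imath^+$ with $P(O)=0$. An iqPVM is a pair $\mathcal P=(P,\mathcal L)$ with $P$ a qPVM and $\mathcal L:q\mapsto L_q$ a left scalar multiplication with $P(E)L_q=L_qP(E)$ for all $E$, $q$. Integral: for a simple function $s=\sum_\ell S_\ell\chi_{E_\ell}$ ($S_\ell\in\mathbb H$, $E_\ell$ disjoint Borel), $\int s\,d\mathcal P=\sum_\ell L_{S_\ell}P(E_\ell)$; for bounded Borel $\varphi:\mathbb C_\imath^+\to\mathbb H$, $\int\varphi\,d\mathcal P$ is the norm limit of $\int s_n\,d\mathcal P$ for simple $s_n\to\varphi$ uniformly. If $\psi$ is a function whose restriction to $\mathrm{supp}(P)$ is bounded and Borel, $\int_{\mathbb C_\imath^+}\psi\,d\mathcal P$ is the integral of $\chi_{\mathrm{supp}(P)}\psi$. Spherical spectrum: for $q\in\mathbb H$, $\Delta_q(T)=T^2-T(2\mathrm{Re}(q))+I|q|^2$. $q$ lies in the spherical resolvent set iff $\mathrm{Ker}\,\Delta_q(T)=\{0\}$, $\mathrm{Ran}\,\Delta_q(T)$ is dense and $\Delta_q(T)^{-1}:\mathrm{Ran}\,\Delta_q(T)\to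 D(T^2)$ is bounded; $\sigma_S(T)$ is its complement in $\mathbb H$. $\sigma_{pS}(T)$: $\mathrm{Ker}\,\Delta_q(T)\ne\{0\}$; $\sigma_{rS}(T)$: $\mathrm{Ker}\,\Delta_q(T)=\{0\}$ and $\mathrm{Ran}\,\Delta_q(T)$ not dense; $\sigma_{cS}(T)$: $\mathrm{Ker}\,\Delta_q(T)=\{0\}$, $\mathrm{Ran}\,\Delta_q(T)$ dense, $\Delta_q(T)^{-1}$ not bounded. *)

theory Defs
  imports "HOL-Analysis.Analysis"
begin

section \<open>Quaternions\<close>

datatype quat = Quat (qRe: real) (qIm1: real) (qIm2: real) (qIm3: real)

lemma quat_eq_iff:
  "p = q \<longleftrightarrow> qRe p = qRe q \<and> qIm1 p = qIm1 q \<and> qIm2 p = qIm2 q \<and> qIm3 p = qIm3 q"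
  by (cases p; cases q) auto

instantiation quat :: real_vector
begin

definition "0 = Quat 0 0 0 0"
definition "p + q = Quat (qRe p + qRe q) (qIm1 p + qIm1 q) (qIm2 p + qIm2 q) (qIm3 p + qIm3 q)"
definition "p - q = Quat (qRe p - qRe q) (qIm1 p - qIm1 q) (qIm2 p - qIm2 q) (qIm3 p - qIm3 q)"
definition "- q = Quat (- qRe q) (- qIm1 q) (- qIm2 q) (- qIm3 q)"
definition "r *\<^sub>R q = Quat (r * qRe q) (r * qIm1 q) (r * qIm2 q) (r * qIm3 q)"

instance
  by standard
    (auto simp: quat_eq_iff zero_quat_def plus_quat_def minus_quat_def uminus_quat_def
      scaleR_quat_def algebra_simps)

end

lemma quat_sel_simps [simp]:
  "qRe 0 = 0" "qIm1 0 = 0" "qIm2 0 = 0" "qIm3 0 = 0"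
  "qRe (p + q) = qRe p + qRe q" "qIm1 (p + q) = qIm1 p + qIm1 q"
  "qIm2 (p + q) = qIm2 p + qIm2 q" "qIm3 (p + q) = qIm3 p + qIm3 q"
  "qRe (p - q) = qRe p - qRe q" "qIm1 (p - q) = qIm1 p - qIm1 q"
  "qIm2 (p - q) = qIm2 p - qIm2 q" "qIm3 (p - q) = qIm3 p - qIm3 q"
  "qRe (- q) = - qRe q" "qIm1 (- q) = - qIm1 q" "qIm2 (- q) = - qIm2 q" "qIm3 (- q) = - qIm3 q"
  "qRe (r *\<^sub>R q) = r * qRe q" "qIm1 (r *\<^sub>R q) = r * qIm1 q"
  "qIm2 (r *\<^sub>R q) = r * qIm2 q" "qIm3 (r *\<^sub>R q) = r * qIm3 q"
  by (simp_all add: zero_quat_def plus_quat_def minus_quat_def uminus_quat_def scaleR_quat_def)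

instantiation quat :: real_algebra_1
begin

definition "1 = Quat 1 0 0 0"
definition "p * q = Quat
  (qRe p * qRe q - qIm1 p * qIm1 q - qIm2 p * qIm2 q - qIm3 p * qIm3 q)
  (qRe p * qIm1 q + qIm1 p * qRe q + qIm2 p * qIm3 q - qIm3 p * qIm2 q)
  (qRe p * qIm2 q - qIm1 p * qIm3 q + qIm2 p * qRe q + qIm3 p * qIm1 q)
  (qRe p * qIm3 q + qIm1 p * qIm2 q - qIm2 p * qIm1 q + qIm3 p * qRe q)"

instance
  by standard (auto simp: quat_eq_iff one_quat_def times_quat_def algebra_simps)

end

lemma quat_sel_mult [simp]:
  "qRe 1 = 1" "qIm1 1 = 0" "qIm2 1 = 0" "qIm3 1 = 0"
  "qRe (p * q) = qRe p * qRe q - qIm1 p * qIm1 q - qIm2 p * qIm2 q - qIm3 p * qIm3 q"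
  "qIm1 (p * q) = qRe p * qIm1 q + qIm1 p * qRe q + qIm2 p * qIm3 q - qIm3 p * qIm2 q"
  "qIm2 (p * q) = qRe p * qIm2 q - qIm1 p * qIm3 q + qIm2 p * qRe q + qIm3 p * qIm1 q"
  "qIm3 (p * q) = qRe p * qIm3 q + qIm1 p * qIm2 q - qIm2 p * qIm1 q + qIm3 p * qRe q"
  by (simp_all add: one_quat_def times_quat_def)

lemma quat_sel_of_real [simp]:
  "qRe (of_real r) = r" "qIm1 (of_real r) = 0" "qIm2 (of_real r) = 0" "qIm3 (of_real r) = 0"
  by (simp_all add: of_real_def)

definition qcnj :: "quat \<Rightarrow> quat" where
  "qcnj q = Quat (qRe q) (- qIm1 q) (- qIm2 q) (- qIm3 q)"

lemma quat_sel_cnj [simp]: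
  "qRe (qcnj q) = qRe q" "qIm1 (qcnj q) = - qIm1 q"
  "qIm2 (qcnj q) = - qIm2 q" "qIm3 (qcnj q) = - qIm3 q"
  by (simp_all add: qcnj_def)

instantiation quat :: real_inner
begin

definition "inner p q = qRe p * qRe q + qIm1 p * qIm1 q + qIm2 p * qIm2 q + qIm3 p * qIm3 q"
definition "norm (q :: quat) = sqrt (inner q q)"
definition "sgn (q :: quat) = q /\<^sub>R norm q"
definition "dist p (q :: quat) = norm (p - q)"
definition [code del]: "(uniformity :: (quat \<times> quat) filter) =
  (INF e\<in>{0 <..}. principal {(x, y). dist x y < e})"
definition [code del]: "open (U :: quat set) \<longleftrightarrow>
  (\<forall>x\<in>U. eventually (\<lambda>(x', y). x' = x \<longrightarrow> y \<in> U) uniformity)"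

instance
proof
  fix p q r :: quat and c :: real
  show "0 \<le> inner p p" by (simp add: inner_quat_def)
  show "inner p p = 0 \<longleftrightarrow> p = 0"
    by (auto simp: inner_quat_def quat_eq_iff add_nonneg_eq_0_iff)
qed (simp_all add: inner_quat_def norm_quat_def sgn_quat_def dist_quat_def
      uniformity_quat_def open_quat_def algebra_simps)

end

instantiation quat :: "{real_normed_div_algebra, euclidean_space}"
begin

definition "inverse q = qcnj q /\<^sub>R inner q q"
definition "p div q = p * inverse (q :: quat)"
definition "Basis = {Quat 1 0 0 0, Quat 0 1 0 0, Quat 0 0 1 0, Quat 0 0 0 1}"

instance
proof
  fix p q :: quat
  show "p \<noteq> 0 \<Longrightarrow> inverse p * p = 1" "p \<noteq> 0 \<Longrightarrow> p * inverse p = 1"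
  proof -
    assume "p \<noteq> 0"
    then have "inner p p \<noteq> 0" by simp
    then show "inverse p * p = 1" "p * inverse p = 1"
      by (simp_all add: quat_eq_iff inverse_quat_def divide_simps)
        (simp_all add: inner_quat_def algebra_simps)
  qed
  show "p div q = p * inverse q" by (simp add: divide_quat_def)
  show "inverse (0 :: quat) = 0" by (simp add: inverse_quat_def quat_eq_iff)
  show "norm (p * q) = norm p * norm q"
    unfolding norm_quat_def real_sqrt_mult [symmetric]
    by (simp add: inner_quat_def algebra_simps)
next
  fix q :: quat
  show "(\<forall>u\<in>Basis. inner q u = 0) \<longleftrightarrow> q = 0"
    unfolding Basis_quat_def by (simp add: inner_quat_def) (auto simp: quat_eq_iff)
qed (auto simp: Basis_quat_def inner_quat_def)

end

definition imag_units :: "quat set" where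
  "imag_units = {q. q\<^sup>2 = -1}"

definition cplane :: "quat \<Rightarrow> quat set" where
  "cplane \<iota> = {of_real \<alpha> + \<iota> * of_real \<beta> | \<alpha> \<beta>. True}"

definition half_plane :: "quat \<Rightarrow> quat set" where
  "half_plane \<iota> = {of_real \<alpha> + \<iota> * of_real \<beta> | \<alpha> \<beta>. \<beta> \<ge> 0}"


section \<open>Quaternionic Hilbert spaces\<close>

text \<open>
  Underneath the right quaternionic structure lies the real Hilbert space with real scalar product
  the real part of the quaternionic one; \<open>norm_qinner\<close> and \<open>qinner_self\<close> below show that the norm of
  the class is the one induced by the quaternionic product, and that this product is positive.
\<close>

class quat_hilbert = real_inner + complete_space +
  fixes qscale :: "'a \<Rightarrow> quat \<Rightarrow> 'a"  (infixl "*\<^sub>H" 75)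
    and qinner :: "'a \<Rightarrow> 'a \<Rightarrow> quat"
  assumes qscale_add_left: "(u + v) *\<^sub>H p = u *\<^sub>H p + v *\<^sub>H p"
    and qscale_add_right: "u *\<^sub>H (p + q) = u *\<^sub>H p + u *\<^sub>H q"
    and qscale_assoc: "(u *\<^sub>H p) *\<^sub>H q = u *\<^sub>H (p * q)"
    and qscale_one: "u *\<^sub>H 1 = u"
    and scaleR_conv_qscale: "r *\<^sub>R u = u *\<^sub>H of_real r"
    and qinner_right: "qinner u (v *\<^sub>H p + w *\<^sub>H q) = qinner u v * p + qinner u w * q"
    and qinner_commute: "qinner u v = qcnj (qinner v u)"
    and inner_conv_qinner: "inner u v = qRe (qinner u v)"
    and ex_nonzero: "\<exists>u. u \<noteq> 0"

lemma norm_qinner: "norm u = sqrt (qRe (qinner u u))" for u :: "'h :: quat_hilbert"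
  by (simp add: norm_eq_sqrt_inner inner_conv_qinner)

lemma qinner_self: "qinner u u = of_real ((norm u)\<^sup>2)" for u :: "'h :: quat_hilbert"
proof -
  have "qinner u u = qcnj (qinner u u)" by (rule qinner_commute)
  moreover have "qRe (qinner u u) = (norm u)\<^sup>2"
    by (simp add: power2_norm_eq_inner inner_conv_qinner)
  ultimately show ?thesis by (simp add: quat_eq_iff del: of_real_power)
qed

instantiation quat :: quat_hilbert
begin

definition "u *\<^sub>H q = u * (q :: quat)"
definition "qinner u v = qcnj u * v"

instance
proof
  show "\<exists>u :: quat. u \<noteq> 0" by (intro exI [of _ 1]) simp
qed (simp_all add: qscale_quat_def qinner_quat_def quat_eq_iff inner_quat_def algebra_simps)

end

definition bounded_op :: "('h::quat_hilbert \<Rightarrow> 'h) \<Rightarrow> bool" where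
  "bounded_op T \<longleftrightarrow> bounded_linear T \<and> (\<forall>u q. T (u *\<^sub>H q) = T u *\<^sub>H q)"

definition adj :: "('h::quat_hilbert \<Rightarrow> 'h) \<Rightarrow> 'h \<Rightarrow> 'h" where
  "adj T = (THE S. \<forall>u v. qinner (S u) v = qinner u (T v))"

definition normal_op :: "('h::quat_hilbert \<Rightarrow> 'h) \<Rightarrow> bool" where
  "normal_op T \<longleftrightarrow> T \<circ> adj T = adj T \<circ> T"

definition positive_op :: "('h::quat_hilbert \<Rightarrow> 'h) \<Rightarrow> bool" where
  "positive_op T \<longleftrightarrow> (\<forall>u. qinner u (T u) \<in> of_real ` {0..})"

definition ker :: "('h::quat_hilbert \<Rightarrow> 'h) \<Rightarrow> 'h set" where
  "ker T = {u. T u = 0}"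

definition ortho_compl :: "'h::quat_hilbert set \<Rightarrow> 'h set" where
  "ortho_compl S = {u. \<forall>v\<in>S. qinner v u = 0}"


section \<open>Left scalar multiplications\<close>

definition hilbert_basis :: "'h::quat_hilbert set \<Rightarrow> bool" where
  "hilbert_basis N \<longleftrightarrow>
     (\<forall>z\<in>N. \<forall>w\<in>N. qinner z w = (if z = w then 1 else 0)) \<and>
     closure {\<Sum>z\<in>F. z *\<^sub>H c z | F c. finite F \<and> F \<subseteq> N} = UNIV"

definition left_mult_of :: "'h::quat_hilbert set \<Rightarrow> quat \<Rightarrow> 'h \<Rightarrow> 'h" where
  "left_mult_of N q u = (\<Sum>\<^sub>\<infinity>z\<in>N. z *\<^sub>H q *\<^sub>H qinner z u)"

definition left_scalar_mult :: "(quat \<Rightarrow> 'h::quat_hilbert \<Rightarrow> 'h) \<Rightarrow> bool" where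
  "left_scalar_mult L \<longleftrightarrow> (\<exists>N. hilbert_basis N \<and> L = left_mult_of N)"


section \<open>Projection-valued measures on the half plane\<close>

abbreviation half_plane_borel :: "quat \<Rightarrow> quat measure" where
  "half_plane_borel \<iota> \<equiv> restrict_space borel (half_plane \<iota>)"

text \<open>
  Set functions are total on \<^typ>\<open>quat set\<close>; only their values on the Borel subsets of the half plane
  are meaningful.
\<close>

definition qPVM :: "quat \<Rightarrow> (quat set \<Rightarrow> 'h::quat_hilbert \<Rightarrow> 'h) \<Rightarrow> bool" where
  "qPVM \<iota> P \<longleftrightarrow>
     (\<forall>E\<in>sets (half_plane_borel \<iota>). bounded_op (P E) \<and> positive_op (P E)) \<and>
     P (half_plane \<iota>) = id \<and>
     (\<forall>E\<in>sets (half_plane_borel \<iota>). \<forall>E'\<in>sets (half_plane_borel \<iota>).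
        P E \<circ> P E' = P (E \<inter> E')) \<and>
     (\<forall>E :: nat \<Rightarrow> quat set.
        range E \<subseteq> sets (half_plane_borel \<iota>) \<and> disjoint_family E \<longrightarrow>
        (\<forall>u. (\<lambda>n. P (E n) u) sums P (\<Union>n. E n) u))"

definition qsupp :: "quat \<Rightarrow> (quat set \<Rightarrow> 'h::quat_hilbert \<Rightarrow> 'h) \<Rightarrow> quat set" where
  "qsupp \<iota> P = half_plane \<iota> -
     \<Union>{U. openin (top_of_set (half_plane \<iota>)) U \<and> P U = (\<lambda>u. 0)}"

definition iqPVM ::
  "quat \<Rightarrow> (quat set \<Rightarrow> 'h::quat_hilbert \<Rightarrow> 'h) \<Rightarrow> (quat \<Rightarrow> 'h \<Rightarrow> 'h) \<Rightarrow> bool" where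
  "iqPVM \<iota> P L \<longleftrightarrow> qPVM \<iota> P \<and> left_scalar_mult L \<and>
     (\<forall>E\<in>sets (half_plane_borel \<iota>). \<forall>q. P E \<circ> L q = L q \<circ> P E)"

text \<open>
  The integral of a simple function is written in canonical form, with one summand for each value
  attained on the half plane; its level sets are the disjoint sets of the decomposition.
\<close>

definition simple_qint ::
  "quat \<Rightarrow> (quat set \<Rightarrow> 'h::quat_hilbert \<Rightarrow> 'h) \<Rightarrow> (quat \<Rightarrow> 'h \<Rightarrow> 'h) \<Rightarrow> (quat \<Rightarrow> quat) \<Rightarrow> 'h \<Rightarrow> 'h"
where
  "simple_qint \<iota> P L s u =
     (\<Sum>y\<in>s ` half_plane \<iota>. L y (P (s -` {y} \<inter> half_plane \<iota>) u))"

text \<open>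
  \<open>has_bounded_qint \<iota> P L \<phi> A\<close>: the operator \<open>A\<close> is the norm limit of integrals of simple functions
  converging uniformly to \<open>\<phi>\<close>. Requiring \<open>A\<close> to be bounded matters, since \<^const>\<open>onorm\<close> is
  meaningful on bounded operators only. A uniform limit of simple functions is automatically a
  bounded Borel function.
\<close>

definition has_bounded_qint ::
  "quat \<Rightarrow> (quat set \<Rightarrow> 'h::quat_hilbert \<Rightarrow> 'h) \<Rightarrow> (quat \<Rightarrow> 'h \<Rightarrow> 'h) \<Rightarrow> (quat \<Rightarrow> quat) \<Rightarrow> ('h \<Rightarrow> 'h) \<Rightarrow> bool"
where
  "has_bounded_qint \<iota> P L \<phi> A \<longleftrightarrow> bounded_op A \<and>
     (\<exists>s. (\<forall>n. simple_function (half_plane_borel \<iota>) (s n)) \<and>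
          uniform_limit (half_plane \<iota>) s \<phi> sequentially \<and>
          (\<lambda>n. onorm (\<lambda>u. simple_qint \<iota> P L (s n) u - A u)) \<longlonglongrightarrow> 0)"

text \<open>
  The integrand of \<open>qint\<close> only has to be bounded and Borel on the support of the measure; outside of
  it, it is replaced by zero.
\<close>

definition qint ::
  "quat \<Rightarrow> (quat set \<Rightarrow> 'h::quat_hilbert \<Rightarrow> 'h) \<Rightarrow> (quat \<Rightarrow> 'h \<Rightarrow> 'h) \<Rightarrow> (quat \<Rightarrow> quat) \<Rightarrow> 'h \<Rightarrow> 'h"
where
  "qint \<iota> P L \<psi> =
     (THE A. has_bounded_qint \<iota> P L (\<lambda>x. if x \<in> qsupp \<iota> P then \<psi> x else 0) A)"


section \<open>Spherical spectrum of an everywhere defined operator\<close>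

definition Delta :: "quat \<Rightarrow> ('h::quat_hilbert \<Rightarrow> 'h) \<Rightarrow> 'h \<Rightarrow> 'h" where
  "Delta q T u = T (T u) - T (u *\<^sub>H of_real (2 * qRe q)) + u *\<^sub>H of_real ((norm q)\<^sup>2)"

definition has_bounded_inverse :: "('h::quat_hilbert \<Rightarrow> 'h) \<Rightarrow> bool" where
  "has_bounded_inverse D \<longleftrightarrow> (\<exists>K. \<forall>v\<in>range D. norm (inv D v) \<le> K * norm v)"

definition spherical_resolvent :: "('h::quat_hilbert \<Rightarrow> 'h) \<Rightarrow> quat set" where
  "spherical_resolvent T =
     {q. ker (Delta q T) = {0} \<and> closure (range (Delta q T)) = UNIV \<and> has_bounded_inverse (Delta q T)}"

definition spherical_spectrum :: "('h::quat_hilbert \<Rightarrow> 'h) \<Rightarrow> quat set" where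
  "spherical_spectrum T = - spherical_resolvent T"

definition point_spectrum :: "('h::quat_hilbert \<Rightarrow> 'h) \<Rightarrow> quat set" where
  "point_spectrum T = {q. ker (Delta q T) \<noteq> {0}}"

definition residual_spectrum :: "('h::quat_hilbert \<Rightarrow> 'h) \<Rightarrow> quat set" where
  "residual_spectrum T =
     {q. ker (Delta q T) = {0} \<and> closure (range (Delta q T)) \<noteq> UNIV}"

definition continuous_spectrum :: "('h::quat_hilbert \<Rightarrow> 'h) \<Rightarrow> quat set" where
  "continuous_spectrum T =
     {q. ker (Delta q T) = {0} \<and> closure (range (Delta q T)) = UNIV \<and>
         \<not> has_bounded_inverse (Delta q T)}"

end

theory Submission
  imports Defs
begin

text \<open>
  Uniqueness and the description of the spectrum come from the calculus \<open>\<phi> \<mapsto> \<integral> \<phi> d\<P>\<close>, which is a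
  *-homomorphism on bounded Borel functions with values in the quaternions: \<open>\<Delta>\<^sub>q(T)\<close> is the integral
  of \<open>(z - q)(z - q\<^sup>*)\<close>, and \<open>L\<^sub>\<kappa> T = T\<^sup>* L\<^sub>\<kappa>\<close> reflects \<open>\<kappa> z = z\<^sup>* \<kappa>\<close>. If \<open>X\<close> intertwines two integrals
  \<open>F, F'\<close> of a real function \<open>f\<close>, comparing the growth of \<open>F\<^sup>n\<close> on \<open>f \<le> a\<close> with that of \<open>F'\<^sup>n\<close> on
  \<open>f \<ge> b > a\<close> shows that \<open>X\<close> intertwines the measures; with \<open>X\<close> the identity this is uniqueness.

  For existence write \<open>T = A + B\<close> with \<open>A\<close> self-adjoint and \<open>B\<close> anti-self-adjoint, and let \<open>C\<close> be the
  positive square root of \<open>-B\<^sup>2\<close>. By Zorn's lemma there is a total real subspace, invariant under \<open>A\<close>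
  and \<open>C\<close>, on which the scalar product is real and \<open>B x = (C x) \<iota>\<close>; an orthonormal basis of it induces
  a left multiplication commuting with \<open>A\<close> and \<open>C\<close> and satisfying \<open>B = L\<^sub>\<iota> C\<close>. The binary digits of
  \<open>A\<close> and \<open>C\<close> (after rescaling) are commuting projections. For each vector they determine a measure on
  binary sequences, realized on an interval, and by a monotone class argument these measures come from
  a projection-valued measure; its image under the map from digits to points of the half plane is \<open>P\<close>.
\<close>

section \<open>Real Hilbert spaces\<close>

text \<open>The integral involves \<open>L\<close>, whereas \<open>P\<close> is determined by
  \<open>T\<close> alone. They are reconciled by the fact that \<open>L\<close> acts on real numbers
  as ordinary scalars, so that integrals of real functions depend on \<open>P\<close> only. Hence
  \<open>T\<close> is studied through its real part and the square of its imaginary part, both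
  expressible by \<open>T\<close> and \<open>adj T\<close>; the imaginary part itself requires
  \<open>L \<iota>\<close> and enters as the positive root of that square. On the kernel of
  \<open>T - adj T\<close> nothing singles out a left multiplication, so existence involves a
  choice, which is the reason for Zorn's lemma.

  Most of the operator theory takes place in the underlying real Hilbert space. Quaternionic
  linearity is recovered from double commutants: right multiplications commute with every
  quaternionic operator, hence with everything in the double commutant of such operators. Binary
  digits take the place of a calculus of continuous functions: each digit projects onto the part of
  an operator above 1/2, and the doubled remainder is again an operator between 0 and 1.\<close>

instance quat_hilbert \<subseteq> banach ..

abbreviation comm :: "('a \<Rightarrow> 'a) \<Rightarrow> ('a \<Rightarrow> 'a) \<Rightarrow> bool" where
  "comm X Y \<equiv> (\<forall>u. X (Y u) = Y (X u))"

definition selfadj :: "('a::real_inner \<Rightarrow> 'a) \<Rightarrow> bool" where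
  "selfadj X \<longleftrightarrow> bounded_linear X \<and> (\<forall>u v. inner (X u) v = inner u (X v))"

definition is_proj :: "('a::real_inner \<Rightarrow> 'a) \<Rightarrow> bool" where
  "is_proj Q \<longleftrightarrow> selfadj Q \<and> (\<forall>u. Q (Q u) = Q u)"

text \<open>Membership in the double commutant of \<open>G\<close>. The test operators
  \<open>X\<close> are merely real linear, so right multiplications by quaternions are among
  them.\<close>

definition bicomm :: "('a::real_inner \<Rightarrow> 'a) set \<Rightarrow> ('a \<Rightarrow> 'a) \<Rightarrow> bool" where
  "bicomm G Y \<longleftrightarrow> bounded_linear Y \<and> (\<forall>X. bounded_linear X \<and> (\<forall>A\<in>G. comm X A) \<longrightarrow> comm X Y)"

lemma selfadjI: "bounded_linear X \<Longrightarrow> (\<And>u v. inner (X u) v = inner u (X v)) \<Longrightarrow> selfadj X"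
  by (simp add: selfadj_def)

lemma selfadj_bl: "selfadj X \<Longrightarrow> bounded_linear X"
  by (simp add: selfadj_def)

lemma selfadj_inner: "selfadj X \<Longrightarrow> inner (X u) v = inner u (X v)"
  by (simp add: selfadj_def)

lemma is_proj_selfadj: "is_proj Q \<Longrightarrow> selfadj Q"
  by (simp add: is_proj_def)

lemma is_proj_bl: "is_proj Q \<Longrightarrow> bounded_linear Q"
  by (simp add: is_proj_def selfadj_def)

lemma is_proj_idem: "is_proj Q \<Longrightarrow> Q (Q u) = Q u"
  by (simp add: is_proj_def)

lemma is_proj_inner_self: "is_proj Q \<Longrightarrow> inner u (Q u) = (norm (Q u))\<^sup>2"
  by (metis is_proj_def power2_norm_eq_inner selfadj_inner)

lemma is_proj_norm_le: "is_proj Q \<Longrightarrow> norm (Q u) \<le> norm u"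
proof -
  assume Q: "is_proj Q"
  have "(norm (Q u))\<^sup>2 \<le> norm u * norm (Q u)"
    using is_proj_inner_self[OF Q, of u] norm_cauchy_schwarz[of u "Q u"] by simp
  then show ?thesis
    by (cases "norm (Q u) = 0") (auto simp: power2_eq_square)
qed

lemma is_proj_compl: "is_proj Q \<Longrightarrow> is_proj (\<lambda>u. u - Q u)"
  unfolding is_proj_def selfadj_def
  by (auto simp: bounded_linear_sub bounded_linear_ident inner_diff_left inner_diff_right
      bounded_linear.linear linear_diff)

lemma is_proj_comp:
  assumes "is_proj Q" "is_proj R" "comm Q R"
  shows "is_proj (\<lambda>u. Q (R u))"
  using assms unfolding is_proj_def selfadj_def
  by (auto intro: bounded_linear_compose)

lemma selfadj_add: "selfadj X \<Longrightarrow> selfadj Y \<Longrightarrow> selfadj (\<lambda>u. X u + Y u)"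
  by (auto simp: selfadj_def bounded_linear_add inner_add_left inner_add_right)

lemma selfadj_diff: "selfadj X \<Longrightarrow> selfadj Y \<Longrightarrow> selfadj (\<lambda>u. X u - Y u)"
  by (auto simp: selfadj_def bounded_linear_sub inner_diff_left inner_diff_right)

lemma selfadj_scaleR: "selfadj X \<Longrightarrow> selfadj (\<lambda>u. c *\<^sub>R X u)"
  by (auto simp: selfadj_def bounded_linear_const_scaleR)

lemma selfadj_id: "selfadj (\<lambda>u. u)"
  by (auto simp: selfadj_def bounded_linear_ident)

lemma selfadj_comp: "selfadj X \<Longrightarrow> selfadj Y \<Longrightarrow> comm X Y \<Longrightarrow> selfadj (\<lambda>u. X (Y u))"
  by (auto simp: selfadj_def intro: bounded_linear_compose)

text \<open>Polarization. Self-adjointness is essential over the reals, where every skew operator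
  has zero form.\<close>

lemma selfadj_form_zero:
  assumes X: "selfadj X" and 0: "\<And>u. inner u (X u) = 0"
  shows "X u = 0"
proof -
  have "inner (u + v) (X (u + v)) = inner u (X u) + inner v (X v) + 2 * inner (X u) v" for u v
    using X
    by (simp add: selfadj_def bounded_linear.linear linear_add inner_add_left inner_add_right inner_commute)
  then have "inner (X u) v = 0" for v using 0 by simp
  from this[of "X u"] show ?thesis by simp
qed

lemma selfadj_form_eq:
  assumes X: "selfadj X" "selfadj Y" and 0: "\<And>u. inner u (X u) = inner u (Y u)"
  shows "X u = Y u"
  using selfadj_form_zero[OF selfadj_diff[OF X]] 0 by (simp add: inner_diff_right)

section \<open>Closure properties of double commutants\<close>

lemma bicomm_bl: "bicomm G Y \<Longrightarrow> bounded_linear Y"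
  by (simp add: bicomm_def)

lemma bicommD: "bicomm G Y \<Longrightarrow> bounded_linear X \<Longrightarrow> (\<And>A. A \<in> G \<Longrightarrow> comm X A) \<Longrightarrow> comm X Y"
  by (simp add: bicomm_def)

lemma bicomm_base: "A \<in> G \<Longrightarrow> bounded_linear A \<Longrightarrow> bicomm G A"
  by (simp add: bicomm_def)

lemma bicomm_add: "bicomm G X \<Longrightarrow> bicomm G Y \<Longrightarrow> bicomm G (\<lambda>u. X u + Y u)"
  by (auto simp: bicomm_def bounded_linear_add bounded_linear.linear linear_add)

lemma bicomm_diff: "bicomm G X \<Longrightarrow> bicomm G Y \<Longrightarrow> bicomm G (\<lambda>u. X u - Y u)"
  by (auto simp: bicomm_def bounded_linear_sub bounded_linear.linear linear_diff)

lemma bicomm_scaleR: "bicomm G X \<Longrightarrow> bicomm G (\<lambda>u. c *\<^sub>R X u)"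
  by (auto simp: bicomm_def bounded_linear_const_scaleR bounded_linear.linear linear_scale)

lemma bicomm_comp: "bicomm G X \<Longrightarrow> bicomm G Y \<Longrightarrow> bicomm G (\<lambda>u. X (Y u))"
  by (auto simp: bicomm_def intro: bounded_linear_compose)

lemma bicomm_id: "bicomm G (\<lambda>u. u)"
  by (auto simp: bicomm_def)

lemma bicomm_zero: "bicomm G (\<lambda>u. 0)"
  by (auto simp: bicomm_def bounded_linear.linear linear_0)

lemma bicomm_trans: "bicomm G Y \<Longrightarrow> (\<And>A. A \<in> G \<Longrightarrow> bicomm G' A) \<Longrightarrow> bicomm G' Y"
  unfolding bicomm_def by blast

lemma bicomm_mono: "bicomm G Y \<Longrightarrow> G \<subseteq> G' \<Longrightarrow> bicomm G' Y"
  by (auto simp: bicomm_def)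

subsection \<open>Orthogonal projection and Riesz representation\<close>

lemma parallelogram_law:
  "(norm (x + y))\<^sup>2 + (norm (x - y))\<^sup>2 = 2 * (norm x)\<^sup>2 + 2 * (norm (y::'a::real_inner))\<^sup>2"
  by (simp add: power2_norm_eq_inner inner_add_left inner_add_right inner_diff_left inner_diff_right
      inner_commute)

lemma orthogonal_projection:
  fixes M :: "'a::{real_inner,banach} set"
  assumes M: "subspace M" "closed M"
  obtains m where "m \<in> M" "\<And>x. x \<in> M \<Longrightarrow> inner (u - m) x = 0"
proof -
  define d where "d = Inf ((\<lambda>m. (norm (u - m))\<^sup>2) ` M)"
  have 0: "0 \<in> M" using M(1) by (rule subspace_0)
  have bdd: "bdd_below ((\<lambda>m. (norm (u - m))\<^sup>2) ` M)" by (intro bdd_belowI[of _ 0]) auto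
  have d_le: "d \<le> (norm (u - m))\<^sup>2" if "m \<in> M" for m
    unfolding d_def using that bdd by (auto intro: cInf_lower)
  have "\<exists>m\<in>M. (norm (u - m))\<^sup>2 < d + 1 / Suc n" for n
  proof -
    have "Inf ((\<lambda>m. (norm (u - m))\<^sup>2) ` M) < d + 1 / Suc n" by (simp add: d_def)
    then show ?thesis using cInf_lessD[of "(\<lambda>m. (norm (u - m))\<^sup>2) ` M"] 0 by blast
  qed
  then obtain x where x: "\<And>n. x n \<in> M" "\<And>n. (norm (u - x n))\<^sup>2 < d + 1 / Suc n" by metis
  \<comment> \<open>Parallelogram law: the midpoint of \<open>x n\<close> and \<open>x k\<close>
    lies in \<open>M\<close>, so its squared distance from \<open>u\<close> is at least
    \<open>d\<close>, which leaves little room for \<open>x n - x k\<close>.\<close>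
  have dist: "(norm (x n - x k))\<^sup>2 \<le> 2 / Suc n + 2 / Suc k" for n k
  proof -
    have mid: "(1/2) *\<^sub>R (x n + x k) \<in> M"
      using M(1) x by (intro subspace_scale subspace_add) auto
    have "(norm ((u - x n) + (u - x k)))\<^sup>2 = 4 * (norm (u - (1/2) *\<^sub>R (x n + x k)))\<^sup>2"
    proof -
      have "(u - x n) + (u - x k) = 2 *\<^sub>R (u - (1/2) *\<^sub>R (x n + x k))"
        by (simp add: scaleR_2 algebra_simps)
      then show ?thesis by (simp add: power_mult_distrib)
    qed
    moreover have "(norm ((u - x n) - (u - x k)))\<^sup>2 = (norm (x n - x k))\<^sup>2"
      by (simp add: norm_minus_commute)
    ultimately show ?thesis
      using parallelogram_law[of "u - x n" "u - x k"] d_le[OF mid] x(2)[of n] x(2)[of k] by linarith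
  qed
  have "Cauchy x"
  proof (rule metric_CauchyI)
    fix e :: real assume e: "0 < e"
    obtain N :: nat where N: "4 / e\<^sup>2 < N" using reals_Archimedean2 by blast
    have Npos: "0 < real N" using e N by (smt (verit) divide_pos_pos zero_less_power)
    have "dist (x n) (x k) < e" if "N \<le> n" "N \<le> k" for n k
    proof -
      have "2 / real (Suc n) < 2 / real N" "2 / real (Suc k) < 2 / real N"
        using that Npos by (auto intro!: divide_strict_left_mono)
      moreover have "4 / real N < e\<^sup>2"
        using N e Npos by (simp add: field_simps)
      ultimately have "(norm (x n - x k))\<^sup>2 < e\<^sup>2" using dist[of n k] by simp
      then show ?thesis using e by (simp add: dist_norm power_less_imp_less_base)
    qed
    then show "\<exists>M. \<forall>m\<ge>M. \<forall>n\<ge>M. dist (x m) (x n) < e" by blast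
  qed
  then obtain m where m: "x \<longlonglongrightarrow> m" using Cauchy_convergent convergent_def by blast
  have mM: "m \<in> M" using M(2) x(1) m closed_sequentially by blast
  have "(\<lambda>n. (norm (u - x n))\<^sup>2) \<longlonglongrightarrow> (norm (u - m))\<^sup>2" by (intro tendsto_intros m)
  moreover have "(\<lambda>n. d + 1 / Suc n) \<longlonglongrightarrow> d + 0"
    by (intro tendsto_intros LIMSEQ_Suc[OF lim_1_over_n])
  ultimately have md: "(norm (u - m))\<^sup>2 \<le> d"
    using x(2) by (metis (mono_tags, lifting) LIMSEQ_le add.right_neutral less_imp_le)
  have "inner (u - m) y = 0" if y: "y \<in> M" for y
  proof (rule ccontr)
    assume a: "inner (u - m) y \<noteq> 0"
    then have y0: "y \<noteq> 0" by auto
    \<comment> \<open>The minimizer of the squared distance from \<open>u\<close> along the line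
      through \<open>m\<close> in direction \<open>y\<close>; a nonzero \<open>t\<close> would
      improve on \<open>m\<close>.\<close>
    define t where "t = inner (u - m) y / inner y y"
    have "m + t *\<^sub>R y \<in> M" using M(1) mM y by (intro subspace_add subspace_scale)
    then have "(norm (u - m))\<^sup>2 \<le> (norm (u - (m + t *\<^sub>R y)))\<^sup>2" using d_le[of "m + t *\<^sub>R y"] md by linarith
    also have "u - (m + t *\<^sub>R y) = (u - m) - t *\<^sub>R y" by simp
    also have "(norm ((u - m) - t *\<^sub>R y))\<^sup>2 = (norm (u - m))\<^sup>2 - 2 * t * inner (u - m) y + t\<^sup>2 * inner y y"
      unfolding power2_norm_eq_inner inner_diff_left[of "u - m" "t *\<^sub>R y"] inner_diff_right[of _ "u - m"]
      by (simp add: inner_commute power2_eq_square)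
    finally have "2 * t * inner (u - m) y \<le> t\<^sup>2 * inner y y" by simp
    moreover have "t \<noteq> 0" using y0 a by (simp add: t_def)
    moreover have "t * inner (u - m) y = t\<^sup>2 * inner y y"
      using y0 by (simp add: t_def power2_eq_square)
    moreover have "t\<^sup>2 * inner y y > 0" using \<open>t \<noteq> 0\<close> y0 by simp
    ultimately show False by linarith
  qed
  with mM that show ?thesis by blast
qed

lemma closure_subspace:
  fixes M :: "'a::real_normed_vector set"
  assumes M: "subspace M"
  shows "subspace (closure M)"
proof (rule subspaceI)
  show "0 \<in> closure M" using subspace_0[OF M] closure_subset by blast
next
  fix x y assume "x \<in> closure M" "y \<in> closure M"
  then obtain f g where "\<And>n. f n \<in> M" "f \<longlonglongrightarrow> x" "\<And>n. g n \<in> M" "g \<longlonglongrightarrow> y"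
    unfolding closure_sequential by metis
  then have "\<And>n. f n + g n \<in> M" "(\<lambda>n. f n + g n) \<longlonglongrightarrow> x + y"
    by (auto intro: subspace_add[OF M] tendsto_add)
  then show "x + y \<in> closure M" unfolding closure_sequential by (intro exI[of _ "\<lambda>n. f n + g n"]) simp
next
  fix x and c :: real assume "x \<in> closure M"
  then obtain f where "\<And>n. f n \<in> M" "f \<longlonglongrightarrow> x"
    unfolding closure_sequential by metis
  then have "\<And>n. c *\<^sub>R f n \<in> M" "(\<lambda>n. c *\<^sub>R f n) \<longlonglongrightarrow> c *\<^sub>R x"
    by (auto intro: subspace_scale[OF M] tendsto_intros)
  then show "c *\<^sub>R x \<in> closure M" unfolding closure_sequential by (intro exI[of _ "\<lambda>n. c *\<^sub>R f n"]) simp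
qed

text \<open>The difference between a vector and its projection onto the closure is orthogonal to
  \<open>M\<close>, hence zero.\<close>

lemma dense_subspaceI:
  fixes M :: "'a::{real_inner,banach} set"
  assumes "subspace M" "\<And>u. (\<And>x. x \<in> M \<Longrightarrow> inner u x = 0) \<Longrightarrow> u = 0"
  shows "closure M = UNIV"
proof -
  have "u \<in> closure M" for u
  proof -
    obtain m where m: "m \<in> closure M" "\<And>x. x \<in> closure M \<Longrightarrow> inner (u - m) x = 0"
      using orthogonal_projection[OF closure_subspace[OF assms(1)] closed_closure] by metis
    then have "u - m = 0" using assms(2) closure_subset by blast
    with m show ?thesis by simp
  qed
  then show ?thesis by blast
qed

lemma riesz_representation:
  fixes f :: "'a::{real_inner,banach} \<Rightarrow> real"
  assumes f: "bounded_linear f"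
  obtains w where "\<And>v. f v = inner w v"
proof (cases "\<forall>v. f v = 0")
  case True
  then show ?thesis using that[of 0] by simp
next
  case False
  then obtain v where v: "f v \<noteq> 0" by blast
  interpret f: bounded_linear f by fact
  let ?K = "{x. f x = 0}"
  have "subspace ?K" by (auto simp: subspace_def f.add f.scaleR f.zero)
  moreover have "closed ?K"
    by (intro closed_Collect_eq continuous_intros f.continuous_on)
  ultimately obtain m where m: "f m = 0" "\<And>x. f x = 0 \<Longrightarrow> inner (v - m) x = 0"
    using orthogonal_projection[of ?K v] by auto
  \<comment> \<open>\<open>z\<close> is orthogonal to the kernel of \<open>f\<close>, and every
    \<open>x\<close> differs from a multiple of \<open>z\<close> by an element of that
    kernel.\<close>
  define z where "z = v - m"
  have fz: "f z \<noteq> 0" using v m by (simp add: z_def f.diff)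
  then have zz: "inner z z \<noteq> 0" by auto
  have "f x = inner ((f z / inner z z) *\<^sub>R z) x" for x
  proof -
    have "f (x - (f x / f z) *\<^sub>R z) = 0" using fz by (simp add: f.diff f.scaleR)
    then have "inner z (x - (f x / f z) *\<^sub>R z) = 0" using m z_def by simp
    then show ?thesis using fz zz by (simp add: inner_diff_right field_simps)
  qed
  then show ?thesis by (rule that)
qed

lemma bounded_linear_of_norm_le:
  assumes "\<And>u v. X (u + v) = X u + X v" "\<And>r u. X (r *\<^sub>R u) = r *\<^sub>R X u" "\<And>u. norm (X u) \<le> c * norm u"
  shows "bounded_linear X"
  using assms by (intro bounded_linear_intro[where K = c]) (auto simp: mult.commute)

lemma adjoint_exists:
  fixes X :: "'a::{real_inner,banach} \<Rightarrow> 'a"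
  assumes X: "bounded_linear X"
  obtains Y where "bounded_linear Y" "\<And>u v. inner (Y u) v = inner u (X v)"
proof -
  interpret X: bounded_linear X by fact
  have "\<exists>w. \<forall>v. inner u (X v) = inner w v" for u
  proof -
    have "bounded_linear (\<lambda>v. inner u (X v))"
      by (rule bounded_linear_compose[OF bounded_linear_inner_right X])
    then show ?thesis using riesz_representation by metis
  qed
  then obtain Y where Y: "\<And>u v. inner u (X v) = inner (Y u) v" by metis
  obtain K where K: "K > 0" "\<And>v. norm (X v) \<le> norm v * K" using X.pos_bounded by blast
  have "bounded_linear Y"
  proof (rule bounded_linear_of_norm_le[where c = K])
    fix u v :: 'a and r :: real
    show "Y (u + v) = Y u + Y v"
      by (rule vector_eq_rdot[THEN iffD1]) (simp add: Y[symmetric] inner_add_left)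
    show "Y (r *\<^sub>R u) = r *\<^sub>R Y u"
      by (rule vector_eq_rdot[THEN iffD1]) (simp add: Y[symmetric])
    have "(norm (Y u))\<^sup>2 = inner u (X (Y u))" by (simp add: Y power2_norm_eq_inner)
    also have "\<dots> \<le> norm u * (norm (Y u) * K)"
      using norm_cauchy_schwarz[of u "X (Y u)"] K(2)[of "Y u"]
      by (meson mult_left_mono norm_ge_zero order_trans)
    finally show "norm (Y u) \<le> K * norm u"
      by (cases "Y u = 0") (use K in \<open>auto simp: power2_eq_square ac_simps\<close>)
  qed
  with Y that show ?thesis by metis
qed

subsection \<open>Square roots and spectral projections\<close>

text \<open>Polynomials in \<open>K\<close> with nonnegative coefficients, \<open>c\<close> being the sum of the coefficients.
  If \<open>K\<close> is a contraction, \<open>c\<close> bounds the norm, so the square root iteration for operators converges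
  because the one for numbers does.\<close>

inductive pospoly :: "('a::real_normed_vector \<Rightarrow>\<^sub>L 'a) \<Rightarrow> real \<Rightarrow> ('a \<Rightarrow>\<^sub>L 'a) \<Rightarrow> bool" for K where
  one: "pospoly K 1 id_blinfun"
| step: "pospoly K c X \<Longrightarrow> pospoly K c (K o\<^sub>L X)"
| plus: "pospoly K c X \<Longrightarrow> pospoly K d Y \<Longrightarrow> pospoly K (c + d) (X + Y)"
| scale: "pospoly K c X \<Longrightarrow> r \<ge> 0 \<Longrightarrow> pospoly K (r * c) (r *\<^sub>R X)"

lemma pospoly_zero: "pospoly K 0 0"
  using pospoly.scale[OF pospoly.one, of 0 K] by simp

lemma pospoly_mult:
  assumes "pospoly K c X" "pospoly K d Y"
  shows "pospoly K (c * d) (X o\<^sub>L Y)"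
  using assms(1)
proof induction
  case one
  then show ?case using assms(2)
    by (metis blinfun_apply_blinfun_compose blinfun_eqI id_blinfun.rep_eq lambda_one)
next
  case (step c X)
  have "(K o\<^sub>L X) o\<^sub>L Y = K o\<^sub>L (X o\<^sub>L Y)" by (rule blinfun_eqI) simp
  then show ?case using step.IH pospoly.step by metis
next
  case (plus c X d' X')
  have "(X + X') o\<^sub>L Y = (X o\<^sub>L Y) + (X' o\<^sub>L Y)"
    by (rule bounded_bilinear.add_left[OF bounded_bilinear_blinfun_compose])
  then show ?case using pospoly.plus[OF plus.IH] by (simp add: distrib_right)
next
  case (scale c X r)
  have "(r *\<^sub>R X) o\<^sub>L Y = r *\<^sub>R (X o\<^sub>L Y)"
    by (rule bounded_bilinear.scaleR_left[OF bounded_bilinear_blinfun_compose])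
  then show ?case using pospoly.scale[OF scale.IH scale.hyps(2)] by (simp add: mult.assoc)
qed

lemma pospoly_norm:
  assumes "pospoly K c X" "norm K \<le> 1"
  shows "norm X \<le> c"
  using assms(1)
proof induction
  case one
  show ?case by (simp add: norm_blinfun_id_le)
next
  case (step c X)
  have "norm (K o\<^sub>L X) \<le> norm K * norm X" by (rule norm_blinfun_compose)
  also have "\<dots> \<le> 1 * norm X" by (intro mult_right_mono assms(2)) simp
  finally show ?case using step.IH by simp
next
  case (plus c X d Y)
  then show ?case by (meson add_mono norm_triangle_le)
next
  case (scale c X r)
  then show ?case by (simp add: mult_left_mono)
qed

lemma pospoly_comm:
  assumes "pospoly K c X" "bounded_linear W" "\<And>u. W (K u) = K (W u)"
  shows "W (X u) = X (W u)"
  using assms(1)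
proof (induction arbitrary: u)
  interpret W: bounded_linear W by fact
  case (plus c X d Y)
  then show ?case by (simp add: blinfun.add_left W.add)
next
  interpret W: bounded_linear W by fact
  case (scale c X r)
  then show ?case by (simp add: blinfun.scaleR_left W.scaleR)
qed (simp_all add: assms(3))

lemma pospoly_selfadj:
  assumes "pospoly K c X" "\<And>u v. inner (K u) v = inner u (K v)"
  shows "inner (X u) v = inner u (X v)"
  using assms(1)
proof (induction arbitrary: u v)
  case (step c X)
  have "K (X v) = X (K v)" for v
    using pospoly_comm[OF step.hyps blinfun.bounded_linear_right] by simp
  then show ?case using step.IH assms(2) by simp
qed (simp_all add: blinfun.add_left blinfun.scaleR_left inner_add_left inner_add_right)

text \<open>A fixed point \<open>Y\<close> satisfies \<open>2 Y = K + Y\<^sup>2\<close>, that is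
  \<open>(1 - Y)\<^sup>2 = 1 - K\<close>. With \<open>K = 1 - S\<close> it yields the root
  \<open>1 - Y\<close> of \<open>S\<close>.\<close>

primrec sqrt_it :: "('a::real_normed_vector \<Rightarrow>\<^sub>L 'a) \<Rightarrow> nat \<Rightarrow> 'a \<Rightarrow>\<^sub>L 'a" where
  "sqrt_it K 0 = 0"
| "sqrt_it K (Suc n) = (1/2) *\<^sub>R (K + (sqrt_it K n o\<^sub>L sqrt_it K n))"

text \<open>The same recursion at the number 1 in place of \<open>K\<close>; its increments majorize
  those of the operators.\<close>

primrec sqrt_val :: "nat \<Rightarrow> real" where
  "sqrt_val 0 = 0"
| "sqrt_val (Suc n) = (1/2) * (1 + sqrt_val n * sqrt_val n)"

lemma pospoly_K: "pospoly K 1 K"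
proof -
  have "K o\<^sub>L id_blinfun = K" by (rule blinfun_eqI) simp
  then show ?thesis using pospoly.step[OF pospoly.one, of K] by simp
qed

lemma pospoly_sqrt_it: "pospoly K (sqrt_val n) (sqrt_it K n)"
proof (induction n)
  case 0
  show ?case by (simp add: pospoly_zero)
next
  case (Suc n)
  show ?case unfolding sqrt_val.simps sqrt_it.simps
    by (intro pospoly.scale pospoly.plus pospoly_mult pospoly_K Suc) simp
qed

text \<open>Successive increments satisfy a difference of squares: half of the previous increment
  times the sum of the two previous iterates. Both factors have nonnegative coefficients, and the
  factorization is legitimate since polynomials in \<open>K\<close> commute.\<close>

lemma pospoly_sqrt_it_diff: "pospoly K (sqrt_val (Suc n) - sqrt_val n) (sqrt_it K (Suc n) - sqrt_it K n)"
proof (induction n)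
  case 0
  show ?case using pospoly.scale[OF pospoly_K, of "1/2" K]
    by (simp add: bounded_bilinear.zero_left[OF bounded_bilinear_blinfun_compose])
next
  case (Suc n)
  let ?X = "sqrt_it K n" and ?Y = "sqrt_it K (Suc n)" and ?x = "sqrt_val n" and ?y = "sqrt_val (Suc n)"
  have cm: "?X (?Y u) = ?Y (?X u)" for u
    by (rule pospoly_comm[OF pospoly_sqrt_it blinfun.bounded_linear_right])
      (rule pospoly_comm[OF pospoly_sqrt_it blinfun.bounded_linear_right, symmetric], simp)
  have "pospoly K ((1/2) * ((?y - ?x) * (?y + ?x))) ((1/2) *\<^sub>R ((?Y - ?X) o\<^sub>L (?Y + ?X)))"
    by (intro pospoly.scale pospoly_mult Suc pospoly.plus pospoly_sqrt_it) simp
  moreover have "(1/2) * ((?y - ?x) * (?y + ?x)) = sqrt_val (Suc (Suc n)) - ?y"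
    by (simp add: algebra_simps)
  moreover have "(1/2) *\<^sub>R ((?Y - ?X) o\<^sub>L (?Y + ?X)) = sqrt_it K (Suc (Suc n)) - ?Y"
  proof (rule blinfun_eqI)
    fix u
    have "sqrt_it K (Suc (Suc n)) u - ?Y u = (1/2) *\<^sub>R (K u + ?Y (?Y u)) - (1/2) *\<^sub>R (K u + ?X (?X u))"
      by (simp add: blinfun.bilinear_simps)
    also have "\<dots> = (1/2) *\<^sub>R (?Y (?Y u) - ?X (?X u))"
      by (simp add: scaleR_add_right scaleR_diff_right)
    also have "\<dots> = ((1/2) *\<^sub>R ((?Y - ?X) o\<^sub>L (?Y + ?X))) u"
      using cm[of u] by (simp add: blinfun.bilinear_simps del: sqrt_it.simps)
    finally show "((1/2) *\<^sub>R ((?Y - ?X) o\<^sub>L (?Y + ?X))) u = (sqrt_it K (Suc (Suc n)) - ?Y) u"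
      by (simp add: blinfun.diff_left)
  qed
  ultimately show ?case by metis
qed

lemma sqrt_val_bounds: "0 \<le> sqrt_val n \<and> sqrt_val n \<le> 1"
proof (induction n)
  case (Suc n)
  then have "sqrt_val n * sqrt_val n \<le> 1 * 1" by (intro mult_mono) auto
  with Suc show ?case by simp
qed simp

lemma sqrt_val_convergent: "convergent sqrt_val"
proof -
  have "sqrt_val n \<le> sqrt_val (Suc n)" for n
    using sum_squares_ge_zero[of "1 - sqrt_val n" 0] by (simp add: algebra_simps)
  then have "incseq sqrt_val" by (rule incseq_SucI)
  then show ?thesis
    using sqrt_val_bounds by (metis convergent_def incseq_convergent)
qed

lemma sqrt_it_diff_norm:
  assumes "norm K \<le> 1" "m \<le> n"
  shows "norm (sqrt_it K n - sqrt_it K m) \<le> sqrt_val n - sqrt_val m"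
  using assms(2)
proof (induction n rule: dec_induct)
  case (step n)
  have "norm (sqrt_it K (Suc n) - sqrt_it K n) \<le> sqrt_val (Suc n) - sqrt_val n"
    by (rule pospoly_norm[OF pospoly_sqrt_it_diff assms(1)])
  with step.IH show ?case
    using norm_triangle_ineq[of "sqrt_it K (Suc n) - sqrt_it K n" "sqrt_it K n - sqrt_it K m"] by simp
qed simp

lemma sqrt_it_convergent:
  fixes K :: "'a::banach \<Rightarrow>\<^sub>L 'a"
  assumes K: "norm K \<le> 1"
  shows "convergent (sqrt_it K)"
proof -
  have "Cauchy sqrt_val" using sqrt_val_convergent by (rule convergent_Cauchy)
  have "Cauchy (sqrt_it K)"
  proof (rule metric_CauchyI)
    fix e :: real assume "0 < e"
    then obtain N where N: "\<And>m n. m \<ge> N \<Longrightarrow> n \<ge> N \<Longrightarrow> dist (sqrt_val m) (sqrt_val n) < e"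
      using \<open>Cauchy sqrt_val\<close> by (metis metric_CauchyD)
    have "dist (sqrt_it K m) (sqrt_it K n) < e" if "m \<ge> N" "n \<ge> N" for m n
    proof (cases "m \<le> n")
      case True
      then show ?thesis using sqrt_it_diff_norm[OF K True] N[OF that]
        by (simp add: dist_norm norm_minus_commute)
    next
      case False
      then show ?thesis using sqrt_it_diff_norm[OF K, of n m] N[OF that]
        by (simp add: dist_norm norm_minus_commute)
    qed
    then show "\<exists>M. \<forall>m\<ge>M. \<forall>n\<ge>M. dist (sqrt_it K m) (sqrt_it K n) < e" by blast
  qed
  then show ?thesis by (rule Cauchy_convergent)
qed

text \<open>Polarization expresses \<open>4 * inner (S u) v\<close> by forms at \<open>u + v\<close>
  and \<open>u - v\<close>. Taking \<open>v\<close> parallel to \<open>S u\<close> and as long as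
  \<open>u\<close> makes the left side \<open>4 * norm u * norm (S u)\<close>, while the
  parallelogram law bounds the right side by \<open>4 * (norm u)\<^sup>2\<close>.\<close>

lemma selfadj_norm_le:
  assumes S: "selfadj S" and le: "\<And>u. \<bar>inner u (S u)\<bar> \<le> (norm u)\<^sup>2"
  shows "norm (S u) \<le> norm u"
proof (cases "S u = 0 \<or> u = 0")
  case False
  interpret S: bounded_linear S using S by (rule selfadj_bl)
  define a where "a = norm u"
  define b where "b = norm (S u)"
  have ab: "a > 0" "b > 0" using False by (auto simp: a_def b_def)
  define v where "v = (a / b) *\<^sub>R S u"
  have nv: "norm v = a" using ab by (simp add: v_def b_def[symmetric] a_def[symmetric])
  have "4 * inner (S u) v = inner (u + v) (S (u + v)) - inner (u - v) (S (u - v))"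
    using selfadj_inner[OF S]
    by (simp add: S.add S.diff inner_add_left inner_add_right inner_diff_left inner_diff_right inner_commute)
  also have "\<dots> \<le> (norm (u + v))\<^sup>2 + (norm (u - v))\<^sup>2"
    using le[of "u + v"] le[of "u - v"] by linarith
  also have "\<dots> = 4 * a\<^sup>2" using nv by (simp add: parallelogram_law a_def)
  finally have "inner (S u) v \<le> a\<^sup>2" by simp
  moreover have "inner (S u) v = a * b"
    using ab by (simp add: v_def power2_norm_eq_inner[symmetric] b_def[symmetric] power2_eq_square)
  ultimately have "a * b \<le> a * a" by (simp add: power2_eq_square)
  then show ?thesis using ab by (simp add: a_def b_def)
qed (auto simp: bounded_linear.linear linear_0 selfadj_bl[OF S])

text \<open>The bounds on the form make \<open>1 - S\<close> a contraction, so the iteration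
  converges in norm to some \<open>Y\<close> with \<open>norm Y \<le> 1\<close>. The root is
  \<open>1 - Y\<close>, nonnegative by this norm bound, and \<open>Y\<close> commutes with whatever
  commutes with \<open>S\<close> because each iterate does.\<close>

lemma contraction_sqrt:
  fixes S :: "'a::{real_inner,banach} \<Rightarrow> 'a"
  assumes S: "selfadj S" and ge: "\<And>u. inner u (S u) \<ge> 0" and le: "\<And>u. inner u (S u) \<le> (norm u)\<^sup>2"
  obtains C where "selfadj C" "\<And>u. inner u (C u) \<ge> 0" "\<And>u. C (C u) = S u" "bicomm {S} C"
proof -
  let ?K = "\<lambda>u. u - S u"
  have K: "selfadj ?K" by (intro selfadj_diff selfadj_id S)
  have nK: "norm (?K u) \<le> norm u" for u
    using ge le by (intro selfadj_norm_le[OF K]) (simp add: inner_diff_right power2_norm_eq_inner abs_le_iff)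
  define K' where "K' = Blinfun ?K"
  have K': "K' u = ?K u" for u
    unfolding K'_def by (simp add: bounded_linear_Blinfun_apply selfadj_bl[OF K])
  have nK': "norm K' \<le> 1" by (rule norm_blinfun_bound) (use nK K' in auto)
  obtain Y where Y: "sqrt_it K' \<longlonglongrightarrow> Y" using sqrt_it_convergent[OF nK'] by (auto simp: convergent_def)
  have "(\<lambda>n. sqrt_it K' (Suc n)) \<longlonglongrightarrow> (1/2) *\<^sub>R (K' + (Y o\<^sub>L Y))"
    by (simp, intro tendsto_intros bounded_bilinear.tendsto[OF bounded_bilinear_blinfun_compose] Y)
  then have eq: "Y = (1/2) *\<^sub>R (K' + (Y o\<^sub>L Y))"
    using LIMSEQ_unique LIMSEQ_Suc[OF Y] by blast
  have Yu: "2 *\<^sub>R Y u = u - S u + Y (Y u)" for u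
  proof -
    have "Y u = ((1/2) *\<^sub>R (K' + (Y o\<^sub>L Y))) u" using eq by simp
    then have "2 *\<^sub>R Y u = 2 *\<^sub>R ((1/2) *\<^sub>R (K' + (Y o\<^sub>L Y))) u" by simp
    then show ?thesis by (simp add: blinfun.add_left blinfun.scaleR_left K')
  qed
  have lim: "(\<lambda>n. sqrt_it K' n u) \<longlonglongrightarrow> Y u" for u
    by (rule blinfun.tendsto[OF Y tendsto_const])
  have Ysa: "inner (Y u) v = inner u (Y v)" for u v
  proof (rule LIMSEQ_unique)
    show "(\<lambda>n. inner (sqrt_it K' n u) v) \<longlonglongrightarrow> inner (Y u) v" by (intro tendsto_intros lim)
    have "inner (sqrt_it K' n u) v = inner u (sqrt_it K' n v)" for n
      by (rule pospoly_selfadj[OF pospoly_sqrt_it]) (simp add: K' selfadj_inner[OF K])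
    then show "(\<lambda>n. inner (sqrt_it K' n u) v) \<longlonglongrightarrow> inner u (Y v)" by (simp, intro tendsto_intros lim)
  qed
  have "norm Y \<le> 1"
    by (rule Lim_norm_ubound[OF sequentially_bot Y])
      (meson always_eventually pospoly_norm[OF pospoly_sqrt_it nK'] sqrt_val_bounds order_trans)
  then have nY: "norm (Y u) \<le> norm u" for u
    using norm_blinfun[of Y u] by (smt (verit) mult_left_le_one_le norm_ge_zero)
  let ?C = "\<lambda>u. u - Y u"
  show ?thesis
  proof (rule that[of ?C])
    show "selfadj ?C"
      by (intro selfadj_diff selfadj_id selfadjI blinfun.bounded_linear_right Ysa)
    show "inner u (?C u) \<ge> 0" for u
      using norm_cauchy_schwarz[of u "Y u"] nY[of u] mult_left_mono[OF nY[of u], of "norm u"]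
      by (simp add: inner_diff_right power2_norm_eq_inner[symmetric] power2_eq_square)
    show "?C (?C u) = S u" for u
      using Yu[of u] by (simp add: blinfun.bilinear_simps scaleR_2 algebra_simps)
    have "W (Y u) = Y (W u)" if W: "bounded_linear W" "comm W S" for W u
    proof (rule LIMSEQ_unique)
      interpret W: bounded_linear W by fact
      show "(\<lambda>n. W (sqrt_it K' n u)) \<longlonglongrightarrow> W (Y u)" by (intro W.tendsto lim)
      have "W (sqrt_it K' n u) = sqrt_it K' n (W u)" for n
        by (rule pospoly_comm[OF pospoly_sqrt_it W(1)]) (simp add: K' W.diff W(2))
      then show "(\<lambda>n. W (sqrt_it K' n u)) \<longlonglongrightarrow> Y (W u)" by (simp add: lim)
    qed
    then have "bicomm {S} Y"
      by (simp add: bicomm_def blinfun.bounded_linear_right)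
    then show "bicomm {S} ?C" by (intro bicomm_diff bicomm_id)
  qed
qed

lemma positive_sqrt:
  fixes S :: "'a::{real_inner,banach} \<Rightarrow> 'a"
  assumes S: "selfadj S" and ge: "\<And>u. inner u (S u) \<ge> 0"
  obtains C where "selfadj C" "\<And>u. inner u (C u) \<ge> 0" "\<And>u. C (C u) = S u" "bicomm {S} C"
proof -
  interpret S: bounded_linear S using S by (rule selfadj_bl)
  obtain k where k: "k > 0" "\<And>u. norm (S u) \<le> norm u * k" using S.pos_bounded by blast
  let ?S = "\<lambda>u. (1/k) *\<^sub>R S u"
  have "inner u (?S u) \<le> (norm u)\<^sup>2" for u
  proof -
    have "inner u (S u) \<le> norm u * (norm u * k)"
      using norm_cauchy_schwarz[of u "S u"] k(2)[of u] by (meson mult_left_mono norm_ge_zero order_trans)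
    then show ?thesis using k by (simp add: power2_eq_square field_simps)
  qed
  then obtain C where C: "selfadj C" "\<And>u. inner u (C u) \<ge> 0" "\<And>u. C (C u) = ?S u" "bicomm {?S} C"
    using contraction_sqrt[of ?S] S ge k selfadj_scaleR[OF S, of "1/k"] by auto
  interpret C: bounded_linear C using C(1) by (rule selfadj_bl)
  show ?thesis
  proof (rule that[of "\<lambda>u. sqrt k *\<^sub>R C u"])
    show "selfadj (\<lambda>u. sqrt k *\<^sub>R C u)" by (intro selfadj_scaleR C)
    show "inner u (sqrt k *\<^sub>R C u) \<ge> 0" for u using C(2)[of u] k by simp
    show "sqrt k *\<^sub>R C (sqrt k *\<^sub>R C u) = S u" for u
      using k C(3)[of u] by (simp add: C.scaleR)
    have "bicomm {S} ?S" by (intro bicomm_scaleR bicomm_base S.bounded_linear_axioms) simp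
    then have "bicomm {S} C" using C(4) bicomm_trans by blast
    then show "bicomm {S} (\<lambda>u. sqrt k *\<^sub>R C u)" by (rule bicomm_scaleR)
  qed
qed

text \<open>For \<open>D = X - Y\<close> commutation gives \<open>D (X + Y) = 0\<close>. Hence the
  two nonnegative forms of \<open>X\<close> and \<open>Y\<close> at \<open>D u\<close> add up to
  zero, so both vanish and \<open>D\<^sup>3 = 0\<close>; a self-adjoint nilpotent operator is
  zero.\<close>

lemma positive_sqrt_unique:
  assumes X: "selfadj X" "\<And>u. inner u (X u) \<ge> 0" and Y: "selfadj Y" "\<And>u. inner u (Y u) \<ge> 0"
    and c: "comm X Y" and sq: "\<And>u. X (X u) = Y (Y u)"
  shows "X u = Y u"
proof -
  interpret X: bounded_linear X using X(1) by (rule selfadj_bl)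
  interpret Y: bounded_linear Y using Y(1) by (rule selfadj_bl)
  define D where "D = (\<lambda>u. X u - Y u)"
  have D: "selfadj D" unfolding D_def by (intro selfadj_diff X Y)
  interpret D: bounded_linear D using D by (rule selfadj_bl)
  have "inner (D u) (X (D u)) + inner (D u) (Y (D u)) = 0" for u
  proof -
    have "inner (D u) (X (D u)) + inner (D u) (Y (D u)) = inner u (D (X (D u) + Y (D u)))"
      by (simp add: selfadj_inner[OF D] D.add inner_add_right)
    also have "D (X (D u) + Y (D u)) = X (X (D u)) - Y (Y (D u))"
      using c by (simp add: D_def X.add Y.add)
    finally show ?thesis by (simp add: sq)
  qed
  then have z: "inner (D u) (X (D u)) = 0" "inner (D u) (Y (D u)) = 0" for u
    using X(2)[of "D u"] Y(2)[of "D u"] by (smt (verit))+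
  have f0: "inner u (D (D (D u))) = 0" for u
  proof -
    have "inner u (D (D (D u))) = inner (D u) (D (D u))" using selfadj_inner[OF D] by simp
    also have "\<dots> = inner (D u) (X (D u)) - inner (D u) (Y (D u))" by (simp add: D_def inner_diff_right)
    finally show ?thesis using z by simp
  qed
  have D2: "selfadj (\<lambda>u. D (D u))" using selfadj_comp[OF D D] by simp
  have D3: "selfadj (\<lambda>u. D (D (D u)))" using selfadj_comp[OF D D2] by simp
  have 3: "D (D (D u)) = 0" for u using selfadj_form_zero[OF D3 f0] .
  have n: "(norm (D u))\<^sup>2 = inner u (D (D u))" for u
    using selfadj_inner[OF D] by (simp add: power2_norm_eq_inner)
  have 2: "D (D u) = 0" for u using n[of "D u"] by (simp add: 3)
  have "D u = 0" using n[of u] by (simp add: 2)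
  then show ?thesis by (simp add: D_def)
qed

lemma closed_subspace_proj:
  fixes M :: "'a::{real_inner,banach} set"
  assumes M: "subspace M" "closed M"
  shows "\<exists>Q. is_proj Q \<and> (\<forall>u. Q u \<in> M) \<and> (\<forall>u. \<forall>x\<in>M. inner (u - Q u) x = 0) \<and> (\<forall>u\<in>M. Q u = u)"
proof -
  have "\<exists>m. m \<in> M \<and> (\<forall>x\<in>M. inner (u - m) x = 0)" for u
    using orthogonal_projection[OF M, of u] by metis
  then obtain Q where Q: "\<And>u. Q u \<in> M" "\<And>u x. x \<in> M \<Longrightarrow> inner (u - Q u) x = 0" by metis
  have uniq: "Q u = m" if "m \<in> M" "\<And>x. x \<in> M \<Longrightarrow> inner (u - m) x = 0" for u m
  proof -
    have "Q u - m \<in> M" using M(1) Q(1) that(1) by (rule subspace_diff)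
    then have "inner (u - m) (Q u - m) = 0" "inner (u - Q u) (Q u - m) = 0" using that(2) Q(2) by auto
    then have "inner (Q u - m) (Q u - m) = 0" by (simp add: inner_diff_left)
    then show ?thesis by simp
  qed
  have 1: "Q u = u" if "u \<in> M" for u using that by (intro uniq) auto
  have sa: "inner (Q u) v = inner u (Q v)" for u v
    using Q(2)[OF Q(1)[of v], of u] Q(2)[OF Q(1)[of u], of v]
    by (simp add: inner_diff_left inner_diff_right inner_commute)
  have "norm (Q u) \<le> 1 * norm u" for u
  proof -
    have "inner (Q u) (Q u) = inner u (Q u)" using Q(2)[OF Q(1)[of u], of u] by (simp add: inner_diff_left)
    then have "norm (Q u) * norm (Q u) \<le> norm u * norm (Q u)"
      using norm_cauchy_schwarz[of u "Q u"] by (simp add: power2_norm_eq_inner[symmetric] power2_eq_square)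
    then show ?thesis by (cases "Q u = 0") auto
  qed
  moreover have "Q (u + v) = Q u + Q v" for u v
  proof (rule uniq)
    show "Q u + Q v \<in> M" by (intro subspace_add[OF M(1)] Q(1))
    show "inner (u + v - (Q u + Q v)) x = 0" if "x \<in> M" for x
      using Q(2)[OF that, of u] Q(2)[OF that, of v] by (simp add: inner_diff_left inner_add_left)
  qed
  moreover have "Q (r *\<^sub>R u) = r *\<^sub>R Q u" for u r
  proof (rule uniq)
    show "r *\<^sub>R Q u \<in> M" by (intro subspace_scale[OF M(1)] Q(1))
    show "inner (r *\<^sub>R u - r *\<^sub>R Q u) x = 0" if "x \<in> M" for x
      using Q(2)[OF that, of u] by (simp add: inner_diff_left)
  qed
  ultimately have "bounded_linear Q" by (intro bounded_linear_of_norm_le)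
  then have "is_proj Q" using sa 1 Q(1) by (simp add: is_proj_def selfadj_def)
  with Q 1 show ?thesis by (intro exI[of _ Q]) simp
qed

text \<open>With \<open>C\<close> the root of \<open>X\<^sup>2\<close>, that is the absolute value
  of \<open>X\<close>, let \<open>Q\<close> project onto the closed range of \<open>C + X\<close>.
  On this range \<open>X = C\<close>; on its orthogonal complement, the kernel of
  \<open>C + X\<close>, \<open>X = - C\<close>.\<close>

lemma sign_projection:
  fixes X :: "'a::{real_inner,banach} \<Rightarrow> 'a"
  assumes X: "selfadj X"
  obtains Q where "is_proj Q" "bicomm {X} Q"
    "\<And>u. inner (Q u) (X (Q u)) \<ge> 0" "\<And>u. inner (u - Q u) (X (u - Q u)) \<le> 0"
proof -
  interpret X: bounded_linear X using X by (rule selfadj_bl)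
  have "selfadj (\<lambda>u. X (X u))" using selfadj_comp[OF X X] by simp
  moreover have "inner u (X (X u)) \<ge> 0" for u using selfadj_inner[OF X, of u "X u"] by (metis inner_ge_zero)
  ultimately obtain C where C: "selfadj C" "\<And>u. inner u (C u) \<ge> 0" "\<And>u. C (C u) = X (X u)"
      "bicomm {\<lambda>u. X (X u)} C"
    using positive_sqrt by metis
  interpret C: bounded_linear C using C(1) by (rule selfadj_bl)
  have bX: "bicomm {X} X" by (intro bicomm_base X.bounded_linear_axioms) simp
  then have bC: "bicomm {X} C" using C(4) bicomm_trans bicomm_comp by blast
  then have cXC: "X (C u) = C (X u)" for u
    using bicommD[OF bC X.bounded_linear_axioms] by blast
  define P where "P = (\<lambda>u. C u + X u)"
  have P: "selfadj P" unfolding P_def by (intro selfadj_add C X)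
  have bP: "bicomm {X} P" unfolding P_def by (intro bicomm_add bC bX)
  let ?M = "closure (range P)"
  interpret P: bounded_linear P using P by (rule selfadj_bl)
  have lP: "linear P" using P by (simp add: selfadj_def bounded_linear.linear)
  have sM: "subspace (range P)" by (rule linear_subspace_image[OF lP subspace_UNIV])
  obtain Q where "is_proj Q \<and> (\<forall>u. Q u \<in> ?M) \<and> (\<forall>u. \<forall>x\<in>?M. inner (u - Q u) x = 0) \<and> (\<forall>u\<in>?M. Q u = u)"
    using closed_subspace_proj[OF closure_subspace[OF sM] closed_closure] ..
  note Q0 = this
  note Q = Q0[THEN conjunct1] Q0[THEN conjunct2, THEN conjunct1, rule_format]
    Q0[THEN conjunct2, THEN conjunct2, THEN conjunct1, rule_format]
    Q0[THEN conjunct2, THEN conjunct2, THEN conjunct2, rule_format]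
  have ker: "P (u - Q u) = 0" for u
  proof -
    have "inner (u - Q u) (P v) = 0" for v
      by (rule Q(3)[OF subsetD[OF closure_subset rangeI]])
    then have "inner (P (u - Q u)) v = 0" for v using selfadj_inner[OF P, of "u - Q u" v] by simp
    from this[of "P (u - Q u)"] show ?thesis by simp
  qed
  have ran: "C w = X w" if "w \<in> ?M" for w
  proof -
    have "closed {w. C w = X w}"
      by (intro closed_Collect_eq C.continuous_on X.continuous_on continuous_on_id)
    moreover have "range P \<subseteq> {w. C w = X w}" using cXC by (auto simp: P_def C.add X.add C(3))
    ultimately have "?M \<subseteq> {w. C w = X w}" by (intro closure_minimal)
    then show ?thesis using that by auto
  qed
  \<comment> \<open>An operator commuting with \<open>X\<close> commutes with \<open>P\<close>, so
    it preserves both the closed range of \<open>P\<close> and its kernel, which are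
    complementary.\<close>
  have "comm W Q" if W: "bounded_linear W" "comm W X" for W
  proof
    interpret W: bounded_linear W by fact
    have WP: "W (P u) = P (W u)" for u using bicommD[OF bP W(1)] W(2) by blast
    have WM: "W w \<in> ?M" if "w \<in> ?M" for w
    proof -
      have "W ` ?M \<subseteq> closure (W ` range P)"
        by (intro image_closure_subset W.continuous_on continuous_on_id closed_closure closure_subset)
      moreover have "W ` range P \<subseteq> range P" using WP by auto
      ultimately have "W ` ?M \<subseteq> ?M" using closure_mono order_trans by metis
      then show ?thesis using that by auto
    qed
    fix u
    have "P (W (u - Q u)) = 0" using WP[of "u - Q u"] ker[of u] by (simp add: W.zero)
    then have "inner (W (u - Q u)) (P v) = 0" for v
      using selfadj_inner[OF P, of "W (u - Q u)" v] by simp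
    then have "range P \<subseteq> {x. inner (W (u - Q u)) x = 0}" by auto
    moreover have "closed {x. inner (W (u - Q u)) x = 0}"
      by (intro closed_Collect_eq continuous_intros)
    ultimately have "?M \<subseteq> {x. inner (W (u - Q u)) x = 0}" by (rule closure_minimal)
    then have "inner (W (u - Q u)) (Q (W (u - Q u))) = 0" using Q(2) by blast
    then have "Q (W (u - Q u)) = 0" using is_proj_inner_self[OF Q(1)] by simp
    moreover have "Q (W (Q u)) = W (Q u)" by (intro Q(4) WM Q(2))
    ultimately show "W (Q u) = Q (W u)"
      using is_proj_bl[OF Q(1)] by (simp add: W.diff bounded_linear.linear linear_diff)
  qed
  then have "bicomm {X} Q" using is_proj_bl[OF Q(1)] by (auto simp: bicomm_def)
  moreover have "inner (Q u) (X (Q u)) \<ge> 0" for u using C(2) ran[OF Q(2)] by metis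
  moreover have "inner (u - Q u) (X (u - Q u)) \<le> 0" for u
  proof -
    have "X (u - Q u) = - C (u - Q u)" using ker[of u] unfolding P_def by (metis add.commute add_eq_0_iff)
    then show ?thesis using C(2)[of "u - Q u"] by simp
  qed
  ultimately show ?thesis using that Q(1) by blast
qed

section \<open>Quaternionic operators and left scalar multiplications\<close>

lemma qcnj_mult [simp]: "qcnj (p * q) = qcnj q * qcnj p"
  by (simp add: quat_eq_iff algebra_simps)

lemma qcnj_add [simp]: "qcnj (p + q) = qcnj p + qcnj q"
  by (simp add: quat_eq_iff)

lemma qcnj_of_real [simp]: "qcnj (of_real r) = of_real r"
  by (simp add: quat_eq_iff)

lemma qcnj_simps [simp]: "qcnj 0 = 0" "qcnj 1 = 1" "qcnj (- q) = - qcnj q"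
  "qcnj (p - q) = qcnj p - qcnj q"
  by (simp_all add: quat_eq_iff)

lemma norm_quat_sq: "(norm q)\<^sup>2 = qRe q * qRe q + qIm1 q * qIm1 q + qIm2 q * qIm2 q + qIm3 q * qIm3 q"
  by (simp add: power2_norm_eq_inner inner_quat_def)

lemma norm_qcnj [simp]: "norm (qcnj q) = norm q"
  by (simp add: norm_quat_def inner_quat_def)

lemma qcnj_mult_self: "qcnj q * q = of_real ((norm q)\<^sup>2)" "q * qcnj q = of_real ((norm q)\<^sup>2)"
  by (simp_all add: quat_eq_iff norm_quat_sq del: of_real_power)

lemma quat_of_real_commute: "of_real r * q = q * (of_real r :: quat)"
  by (simp add: quat_eq_iff)

lemma abs_qRe_le: "\<bar>qRe q\<bar> \<le> norm q"
proof -
  have "(qRe q)\<^sup>2 \<le> (norm q)\<^sup>2" by (simp only: norm_quat_sq) (simp add: power2_eq_square)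
  then show ?thesis by (simp add: abs_le_square_iff[symmetric])
qed

lemma qscale_zero [simp]: "0 *\<^sub>H q = (0::'h::quat_hilbert)" "u *\<^sub>H 0 = (0::'h::quat_hilbert)"
  using qscale_add_left[of 0 0 q] qscale_add_right[of u 0 0] by simp_all

lemma scaleR_qscale: "(r *\<^sub>R u) *\<^sub>H q = r *\<^sub>R (u *\<^sub>H q)" for u :: "'h::quat_hilbert"
  by (simp add: scaleR_conv_qscale qscale_assoc quat_of_real_commute)

lemma qscale_minus: "(- u) *\<^sub>H q = - (u *\<^sub>H q)" "u *\<^sub>H (- q) = - (u *\<^sub>H q)" for u :: "'h::quat_hilbert"
proof -
  show "(- u) *\<^sub>H q = - (u *\<^sub>H q)" using scaleR_qscale[of "-1" u q] by simp
  show "u *\<^sub>H (- q) = - (u *\<^sub>H q)"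
    using qscale_add_right[of u q "- q"] by (simp add: eq_neg_iff_add_eq_0 add.commute)
qed

lemma qscale_diff: "(u - v) *\<^sub>H q = u *\<^sub>H q - v *\<^sub>H q" for u :: "'h::quat_hilbert"
  using qscale_add_left[of u "- v" q] by (simp add: qscale_minus)

lemma qinner_add_right: "qinner u (v + w) = qinner u v + qinner u w" for u :: "'h::quat_hilbert"
  using qinner_right[of u v 1 w 1] by (simp add: qscale_one)

lemma qinner_qscale_right: "qinner u (v *\<^sub>H p) = qinner u v * p" for u :: "'h::quat_hilbert"
  using qinner_right[of u v p v 0] by simp

lemma qinner_qscale_left: "qinner (u *\<^sub>H p) v = qcnj p * qinner u v" for u :: "'h::quat_hilbert"
  by (metis qcnj_mult qinner_commute qinner_qscale_right)

lemma qinner_add_left: "qinner (u + v) w = qinner u w + qinner v w" for u :: "'h::quat_hilbert"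
  by (metis qcnj_add qinner_add_right qinner_commute)

lemma qinner_zero [simp]: "qinner u 0 = 0" "qinner 0 u = 0" for u :: "'h::quat_hilbert"
  using qinner_add_right[of u 0 0] qinner_add_left[of 0 0 u] by simp_all

lemma qinner_scaleR_right: "qinner u (r *\<^sub>R v) = r *\<^sub>R qinner u v" for u :: "'h::quat_hilbert"
  by (simp add: scaleR_conv_qscale[of r v] qinner_qscale_right scaleR_conv_of_real quat_of_real_commute)

lemma qinner_sum_right: "qinner u (\<Sum>x\<in>F. f x) = (\<Sum>x\<in>F. qinner u (f x))" for u :: "'h::quat_hilbert"
  by (induction F rule: infinite_finite_induct) (simp_all add: qinner_add_right)

lemma inner_qscale_left: "inner (u *\<^sub>H p) v = inner u (v *\<^sub>H qcnj p)" for u :: "'h::quat_hilbert"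
  by (simp add: inner_conv_qinner qinner_qscale_left qinner_qscale_right)

lemma norm_qscale: "norm (u *\<^sub>H q) = norm u * norm q" for u :: "'h::quat_hilbert"
proof -
  have "(norm (u *\<^sub>H q))\<^sup>2 = inner u (u *\<^sub>H of_real ((norm q)\<^sup>2))"
    by (simp only: power2_norm_eq_inner[of "u *\<^sub>H q"] inner_qscale_left qscale_assoc qcnj_mult_self)
  also have "\<dots> = (norm u * norm q)\<^sup>2"
    by (simp add: scaleR_conv_qscale[symmetric] power2_norm_eq_inner[symmetric] power_mult_distrib mult.commute
        del: of_real_power)
  finally show ?thesis by (simp add: power2_eq_iff_nonneg)
qed

lemma bounded_linear_qscale: "bounded_linear (\<lambda>u::'h::quat_hilbert. u *\<^sub>H q)"
  by (rule bounded_linear_of_norm_le[where c = "norm q"])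
    (simp_all add: qscale_add_left scaleR_qscale norm_qscale mult.commute)

lemma inner_qscale_right: "inner u (v *\<^sub>H p) = qRe (qinner u v * p)" for u :: "'h::quat_hilbert"
  by (simp add: inner_conv_qinner qinner_qscale_right)

lemma quat_eqI_mult: "(\<And>p. qRe (q * p) = qRe (q' * p)) \<Longrightarrow> q = q'"
proof -
  assume *: "\<And>p. qRe (q * p) = qRe (q' * p)"
  show "q = q'"
    using *[of "Quat 1 0 0 0"] *[of "Quat 0 1 0 0"] *[of "Quat 0 0 1 0"] *[of "Quat 0 0 0 1"]
    by (simp add: quat_eq_iff)
qed

text \<open>The real scalar product, tested on all right multiples, recovers the quaternionic one;
  this is how real adjoints become quaternionic adjoints.\<close>

lemma qinner_eqI:
  fixes u :: "'h::quat_hilbert"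
  assumes "\<And>p. inner u (v *\<^sub>H p) = inner u' (v' *\<^sub>H p)"
  shows "qinner u v = qinner u' v'"
  using assms by (intro quat_eqI_mult) (simp add: inner_qscale_right)

lemma norm_qinner_le: "norm (qinner u v) \<le> norm u * norm v" for u :: "'h::quat_hilbert"
proof -
  have "(norm (qinner u v))\<^sup>2 = inner u (v *\<^sub>H qcnj (qinner u v))"
    by (simp add: inner_qscale_right qcnj_mult_self del: quat_sel_mult of_real_power)
  also have "\<dots> \<le> norm u * (norm v * norm (qinner u v))"
    using norm_cauchy_schwarz[of u "v *\<^sub>H qcnj (qinner u v)"] by (simp add: norm_qscale)
  finally show ?thesis
    by (cases "norm (qinner u v) = 0") (auto simp: power2_eq_square mult.assoc[symmetric])
qed

lemma bounded_linear_qinner: "bounded_linear (qinner (u::'h::quat_hilbert))"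
  by (rule bounded_linear_of_norm_le[where c = "norm u"])
    (simp_all add: qinner_add_right qinner_scaleR_right norm_qinner_le)

section \<open>Bounded quaternionic operators, adjoints and positivity\<close>

lemma bounded_opI: "bounded_linear T \<Longrightarrow> (\<And>u q. T (u *\<^sub>H q) = T u *\<^sub>H q) \<Longrightarrow> bounded_op T"
  by (simp add: bounded_op_def)

lemma bounded_op_bl: "bounded_op T \<Longrightarrow> bounded_linear T"
  by (simp add: bounded_op_def)

lemma bounded_op_qscale: "bounded_op T \<Longrightarrow> T (u *\<^sub>H q) = T u *\<^sub>H q"
  by (simp add: bounded_op_def)

lemma bounded_op_add: "bounded_op X \<Longrightarrow> bounded_op Y \<Longrightarrow> bounded_op (\<lambda>u. X u + Y u)"
  by (simp add: bounded_op_def bounded_linear_add qscale_add_left)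

lemma bounded_op_diff: "bounded_op X \<Longrightarrow> bounded_op Y \<Longrightarrow> bounded_op (\<lambda>u. X u - Y u)"
  by (simp add: bounded_op_def bounded_linear_sub qscale_diff)

lemma bounded_op_scaleR: "bounded_op X \<Longrightarrow> bounded_op (\<lambda>u. r *\<^sub>R X u)"
  by (simp add: bounded_op_def bounded_linear_const_scaleR scaleR_qscale)

lemma bounded_op_comp: "bounded_op X \<Longrightarrow> bounded_op Y \<Longrightarrow> bounded_op (\<lambda>u. X (Y u))"
  by (auto simp: bounded_op_def intro: bounded_linear_compose)

lemma bounded_op_id: "bounded_op (\<lambda>u. u)"
  by (simp add: bounded_op_def)

lemma bounded_op_zero: "bounded_op (\<lambda>u. 0)"
  by (simp add: bounded_op_def)

lemma bounded_op_sum: "(\<And>i. i \<in> I \<Longrightarrow> bounded_op (X i)) \<Longrightarrow> bounded_op (\<lambda>u. \<Sum>i\<in>I. X i u)"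
  by (induction I rule: infinite_finite_induct) (simp_all add: bounded_op_zero bounded_op_add)

text \<open>Right multiplication by \<open>q\<close> commutes with all of \<open>G\<close>, hence
  with \<open>Y\<close>.\<close>

lemma bounded_op_bicomm:
  assumes "bicomm G Y" "\<And>X. X \<in> G \<Longrightarrow> bounded_op X"
  shows "bounded_op Y"
proof (rule bounded_opI)
  show "bounded_linear Y" using assms(1) by (rule bicomm_bl)
  fix u q
  show "Y (u *\<^sub>H q) = Y u *\<^sub>H q"
    using bicommD[OF assms(1) bounded_linear_qscale[of q]] assms(2) by (simp add: bounded_op_qscale)
qed

lemma qinner_adjointI:
  assumes T: "bounded_op T" and S: "\<And>u v. inner (S u) v = inner u (T v)"
  shows "qinner (S u) v = qinner u (T v)"
  by (rule qinner_eqI) (simp add: S bounded_op_qscale[OF T])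

lemma adj_eqI:
  assumes T: "bounded_op T" and S: "\<And>u v. inner (S u) v = inner u (T v)"
  shows "adj T = S"
  unfolding adj_def
proof (rule the_equality)
  show "\<forall>u v. qinner (S u) v = qinner u (T v)" using qinner_adjointI[OF T S] by blast
  fix R assume "\<forall>u v. qinner (R u) v = qinner u (T v)"
  then have "inner (R u) v = inner (S u) v" for u v using S by (simp add: inner_conv_qinner)
  then show "R = S" by (intro ext vector_eq_rdot[THEN iffD1]) simp
qed

text \<open>The real adjoint is quaternionic linear because the adjoint of right multiplication by
  \<open>q\<close> is right multiplication by \<open>qcnj q\<close>.\<close>

lemma adj_properties:
  assumes T: "bounded_op T"
  shows "bounded_op (adj T)" and "inner (adj T u) v = inner u (T v)"
proof -
  obtain S where S: "bounded_linear S" "\<And>u v. inner (S u) v = inner u (T v)"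
    using adjoint_exists[OF bounded_op_bl[OF T]] by metis
  have adj: "adj T = S" by (rule adj_eqI[OF T S(2)])
  have "S (u *\<^sub>H q) = S u *\<^sub>H q" for u q
  proof (rule vector_eq_rdot[THEN iffD1], rule allI)
    fix v
    show "inner (S (u *\<^sub>H q)) v = inner (S u *\<^sub>H q) v"
      by (simp add: S(2) inner_qscale_left bounded_op_qscale[OF T])
  qed
  then show "bounded_op (adj T)" by (simp add: adj S(1) bounded_opI)
  show "inner (adj T u) v = inner u (T v)" by (simp add: adj S(2))
qed

text \<open>As over the complex numbers, a real-valued form forces self-adjointness. Polarizing with
  \<open>v *\<^sub>H p\<close> for imaginary \<open>p\<close> extracts it from the vanishing
  imaginary components.\<close>

lemma positive_op_iff:
  assumes X: "bounded_op X"
  shows "positive_op X \<longleftrightarrow> selfadj X \<and> (\<forall>u. inner u (X u) \<ge> 0)"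
proof
  assume L: "positive_op X"
  then have real: "\<exists>r\<ge>0. qinner u (X u) = of_real r" for u by (auto simp: positive_op_def)
  interpret X: bounded_linear X using X by (rule bounded_op_bl)
  have "inner u (X v) = inner (X u) v" for u v
  proof -
    define a where "a = qinner u (X v)"
    define b where "b = qinner (X u) v"
    have b: "qinner v (X u) = qcnj b" unfolding b_def by (rule qinner_commute)
    have im: "qIm1 (qinner w (X w)) = 0 \<and> qIm2 (qinner w (X w)) = 0 \<and> qIm3 (qinner w (X w)) = 0" for w
      using real[of w] by auto
    have ex: "qinner (u + v *\<^sub>H p) (X (u + v *\<^sub>H p)) = qinner u (X u) + a * p + qcnj p * qcnj b
        + qinner (v *\<^sub>H p) (X (v *\<^sub>H p))" for p
      by (simp add: X.add qinner_add_left qinner_add_right bounded_op_qscale[OF X] a_def b_def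
          qinner_qscale_right qinner_qscale_left qinner_commute[of v "X u"] algebra_simps)
    have "qIm1 (a * p + qcnj p * qcnj b) = 0 \<and> qIm2 (a * p + qcnj p * qcnj b) = 0
        \<and> qIm3 (a * p + qcnj p * qcnj b) = 0" for p
      using im[of "u + v *\<^sub>H p"] im[of u] im[of "v *\<^sub>H p"] unfolding ex
      by (simp only: quat_sel_simps) linarith
    \<comment> \<open>At \<open>p = Quat 0 1 0 0\<close> the first imaginary component is
      \<open>qRe a - qRe b\<close>.\<close>
    from this[of "Quat 0 1 0 0"] this[of "Quat 0 0 1 0"] have "qRe a = qRe b"
      by simp
    then show ?thesis by (simp add: a_def b_def inner_conv_qinner)
  qed
  moreover have "inner u (X u) \<ge> 0" for u using real[of u] by (auto simp: inner_conv_qinner)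
  ultimately show "selfadj X \<and> (\<forall>u. inner u (X u) \<ge> 0)"
    by (simp add: selfadj_def X.bounded_linear_axioms)
next
  assume R: "selfadj X \<and> (\<forall>u. inner u (X u) \<ge> 0)"
  have "qinner u (X u) = of_real (inner u (X u))" for u
  proof -
    have "qinner (X u) u = qinner u (X u)"
      using R by (intro qinner_adjointI[OF X]) (simp add: selfadj_inner)
    then have "qcnj (qinner u (X u)) = qinner u (X u)" using qinner_commute by metis
    then show ?thesis by (simp add: quat_eq_iff inner_conv_qinner)
  qed
  then show "positive_op X" using R unfolding positive_op_def by (metis atLeast_iff imageI)
qed

subsection \<open>Hilbert bases\<close>

locale onb =
  fixes N :: "'h::quat_hilbert set"
  assumes basis: "hilbert_basis N"
begin

lemma ortho: "z \<in> N \<Longrightarrow> w \<in> N \<Longrightarrow> qinner z w = (if z = w then 1 else 0)"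
  using basis by (simp add: hilbert_basis_def)

definition fin_span :: "'h set" where
  "fin_span = {\<Sum>z\<in>F. z *\<^sub>H c z | F c. finite F \<and> F \<subseteq> N}"

lemma closure_fin_span: "closure fin_span = UNIV"
  using basis by (simp add: hilbert_basis_def fin_span_def)

text \<open>Continuity and density of \<open>fin_span\<close>: identities between operators can be
  checked on right multiples of basis vectors.\<close>

lemma bounded_linear_eqI:
  assumes X: "bounded_linear X" and Y: "bounded_linear Y"
    and eq: "\<And>z p. z \<in> N \<Longrightarrow> X (z *\<^sub>H p) = (Y (z *\<^sub>H p) :: 'b::real_normed_vector)"
  shows "X u = Y u"
proof -
  interpret X: bounded_linear X by fact
  interpret Y: bounded_linear Y by fact
  have "closed {u. X u = Y u}"
    by (intro closed_Collect_eq X.continuous_on Y.continuous_on continuous_on_id)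
  moreover have "fin_span \<subseteq> {u. X u = Y u}"
    by (auto simp: fin_span_def X.sum Y.sum eq subset_iff intro!: sum.cong)
  ultimately have "closure fin_span \<subseteq> {u. X u = Y u}" by (rule closure_minimal[rotated])
  then show ?thesis using closure_fin_span by auto
qed

lemma inner_basis:
  assumes "z \<in> N" "w \<in> N"
  shows "inner (z *\<^sub>H a) (w *\<^sub>H b) = (if z = w then inner a b else 0)"
proof -
  have "inner (z *\<^sub>H a) (w *\<^sub>H b) = qRe (qcnj a * (qinner z w * b))"
    by (simp only: inner_conv_qinner[of "z *\<^sub>H a"] qinner_qscale_left qinner_qscale_right mult.assoc)
  then show ?thesis using ortho[OF assms] by (simp add: inner_quat_def)
qed

lemma norm_sum_basis:
  assumes "finite F" "F \<subseteq> N"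
  shows "(norm (\<Sum>z\<in>F. z *\<^sub>H c z))\<^sup>2 = (\<Sum>z\<in>F. (norm (c z))\<^sup>2)"
proof -
  have "(norm (\<Sum>z\<in>F. z *\<^sub>H c z))\<^sup>2 = (\<Sum>z\<in>F. \<Sum>w\<in>F. inner (w *\<^sub>H c w) (z *\<^sub>H c z))"
    by (simp add: power2_norm_eq_inner inner_sum_left inner_sum_right)
  also have "\<dots> = (\<Sum>z\<in>F. \<Sum>w\<in>F. if z = w then inner (c w) (c z) else 0)"
    using assms by (intro sum.cong) (auto simp: inner_basis subset_iff)
  also have "\<dots> = (\<Sum>z\<in>F. (norm (c z))\<^sup>2)"
    using assms(1) by (simp add: power2_norm_eq_inner)
  finally show ?thesis .
qed

lemma bessel:
  assumes "finite F" "F \<subseteq> N"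
  shows "(\<Sum>z\<in>F. (norm (qinner z u))\<^sup>2) \<le> (norm u)\<^sup>2"
proof -
  let ?s = "\<Sum>z\<in>F. z *\<^sub>H qinner z u"
  have "inner u (z *\<^sub>H qinner z u) = (norm (qinner z u))\<^sup>2" for z
  proof -
    have "inner u (z *\<^sub>H qinner z u) = qRe (qcnj (qinner z u) * qinner z u)"
      by (simp only: inner_qscale_right qinner_commute[of u z])
    then show ?thesis by (simp only: qcnj_mult_self quat_sel_of_real)
  qed
  then have "inner u ?s = (\<Sum>z\<in>F. (norm (qinner z u))\<^sup>2)" by (simp add: inner_sum_right)
  moreover have "(norm (u - ?s))\<^sup>2 = (norm u)\<^sup>2 - 2 * inner u ?s + (norm ?s)\<^sup>2"
    by (simp add: power2_norm_eq_inner inner_diff_left inner_diff_right inner_commute)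
  ultimately show ?thesis using norm_sum_basis[OF assms, of "\<lambda>z. qinner z u"]
    by (smt (verit) zero_le_power2)
qed

lemma partial_norm:
  assumes F: "finite F" "F \<subseteq> N"
  shows "norm (\<Sum>z\<in>F. z *\<^sub>H q *\<^sub>H qinner z u) \<le> norm q * norm u"
proof -
  have "(norm (\<Sum>z\<in>F. z *\<^sub>H q *\<^sub>H qinner z u))\<^sup>2 = (\<Sum>z\<in>F. (norm q)\<^sup>2 * (norm (qinner z u))\<^sup>2)"
    using norm_sum_basis[OF F, of "\<lambda>z. q * qinner z u"]
    by (simp add: qscale_assoc norm_mult power_mult_distrib)
  also have "\<dots> \<le> (norm q * norm u)\<^sup>2"
    using bessel[OF F, of u]
    by (simp add: sum_distrib_left[symmetric] power_mult_distrib mult_left_mono)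
  finally show ?thesis by (simp add: power2_le_iff_abs_le)
qed

abbreviation "summand q u \<equiv> (\<lambda>z. z *\<^sub>H q *\<^sub>H qinner z u)"

lemma has_sum_norm:
  assumes "(summand q u has_sum v) N"
  shows "norm v \<le> norm q * norm u"
proof (rule tendsto_upperbound)
  show "((\<lambda>F. norm (sum (summand q u) F)) \<longlongrightarrow> norm v) (finite_subsets_at_top N)"
    using assms by (intro tendsto_norm) (simp add: has_sum_def)
  show "\<forall>\<^sub>F F in finite_subsets_at_top N. norm (sum (summand q u) F) \<le> norm q * norm u"
    by (rule eventually_finite_subsets_at_top_weakI) (rule partial_norm)
qed simp

lemma summand_add: "summand q (u + v) z = summand q u z + summand q v z"
  by (simp add: qinner_add_right qscale_add_right)

lemma summand_diff: "summand q (u - v) z = summand q u z - summand q v z"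
  by (metis add_diff_cancel diff_add_cancel summand_add)

text \<open>The infinite sum in \<open>left_mult_of\<close> carries information only once the family
  is summable. On \<open>fin_span\<close> all but finitely many terms vanish, and the uniform bound
  \<open>partial_norm\<close> carries summability over to the closure.\<close>

lemma left_mult_sums: "(summand q u has_sum left_mult_of N q u) N"
proof -
  have fin: "summand q u summable_on N" if u: "u \<in> fin_span" for u
  proof -
    obtain F c where F: "finite F" "F \<subseteq> N" "u = (\<Sum>z\<in>F. z *\<^sub>H c z)"
      using u by (auto simp: fin_span_def)
    have "summand q u z = 0" if "z \<in> N - F" for z
    proof -
      have "qinner z (w *\<^sub>H c w) = 0" if "w \<in> F" for w
        using ortho[of z w] \<open>z \<in> N - F\<close> that F(2) by (auto simp: qinner_qscale_right)
      then show ?thesis by (simp add: F(3) qinner_sum_right)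
    qed
    then have "summand q u summable_on N \<longleftrightarrow> summand q u summable_on F"
      using F(2) by (intro summable_on_cong_neutral) auto
    then show ?thesis using F(1) by simp
  qed
  have "u \<in> closure fin_span" using closure_fin_span by simp
  then obtain x where x: "\<And>k. x k \<in> fin_span" "x \<longlonglongrightarrow> u" unfolding closure_sequential by blast
  define v where "v k = infsum (summand q (x k)) N" for k :: nat
  have v: "(summand q (x k) has_sum v k) N" for k
    unfolding v_def using fin[OF x(1)] by (rule has_sum_infsum)
  have d: "norm (v k - v l) \<le> norm q * norm (x k - x l)" for k l
  proof (rule has_sum_norm)
    have "((\<lambda>z. summand q (x k) z + - summand q (x l) z) has_sum (v k + - v l)) N"
      using v by (intro has_sum_add) (simp_all add: has_sum_uminus)
    then show "(summand q (x k - x l) has_sum (v k - v l)) N" by (simp add: summand_diff)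
  qed
  have "Cauchy x" using x(2) by (intro convergent_Cauchy) (auto simp: convergent_def)
  have "Cauchy v"
  proof (rule metric_CauchyI)
    fix e :: real assume e: "0 < e"
    have q: "norm q + 1 > 0" by (smt (verit) norm_ge_zero)
    obtain M where M: "\<And>m n. m \<ge> M \<Longrightarrow> n \<ge> M \<Longrightarrow> dist (x m) (x n) < e / (norm q + 1)"
      using metric_CauchyD[OF \<open>Cauchy x\<close>, of "e / (norm q + 1)"] e q by auto
    have "dist (v m) (v n) < e" if "m \<ge> M" "n \<ge> M" for m n
    proof -
      have "norm (v m - v n) \<le> (norm q + 1) * norm (x m - x n)"
        using d[of m n] by (smt (verit) mult_right_mono norm_ge_zero)
      also have "\<dots> < (norm q + 1) * (e / (norm q + 1))"
        using M[OF that] q by (intro mult_strict_left_mono) (simp_all add: dist_norm)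
      finally show ?thesis using q by (simp add: dist_norm)
    qed
    then show "\<exists>M. \<forall>m\<ge>M. \<forall>n\<ge>M. dist (v m) (v n) < e" by blast
  qed
  then obtain w where w: "v \<longlonglongrightarrow> w" using Cauchy_convergent convergent_def by blast
  have "(summand q u has_sum w) N"
    unfolding has_sum_def
  proof (rule tendstoI)
    fix e :: real assume e: "0 < e"
    have "(\<lambda>k. norm q * norm (u - x k) + norm (v k - w)) \<longlonglongrightarrow> norm q * norm (u - u) + norm (w - w)"
      by (intro tendsto_intros x w)
    then have "\<forall>\<^sub>F k in sequentially. norm q * norm (u - x k) + norm (v k - w) < e / 2"
      using e by (intro order_tendstoD) auto
    then obtain k where k: "norm q * norm (u - x k) + norm (v k - w) < e / 2"
      by (auto simp: eventually_sequentially)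
    have "\<forall>\<^sub>F F in finite_subsets_at_top N. dist (sum (summand q (x k)) F) (v k) < e / 2"
      using v[of k] e unfolding has_sum_def by (intro tendstoD) auto
    moreover have "\<forall>\<^sub>F F in finite_subsets_at_top N. finite F \<and> F \<subseteq> N"
      by (rule eventually_finite_subsets_at_top_weakI) simp
    ultimately show "\<forall>\<^sub>F F in finite_subsets_at_top N. dist (sum (summand q u) F) w < e"
    proof eventually_elim
      case (elim F)
      have "sum (summand q u) F - sum (summand q (x k)) F = sum (summand q (u - x k)) F"
        by (simp add: summand_diff sum_subtractf)
      then have "norm (sum (summand q u) F - sum (summand q (x k)) F) \<le> norm q * norm (u - x k)"
        using partial_norm[of F q "u - x k"] elim by simp
      then show ?case
        using k elim dist_triangle[of "sum (summand q u) F" w "v k"]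
          dist_triangle[of "sum (summand q u) F" "v k" "sum (summand q (x k)) F"]
        by (simp add: dist_norm)
    qed
  qed
  then show ?thesis unfolding left_mult_of_def by (simp add: infsumI)
qed

lemma left_mult_eqI: "(summand q u has_sum v) N \<Longrightarrow> left_mult_of N q u = v"
  using left_mult_sums has_sum_unique by blast

lemma left_mult_norm: "norm (left_mult_of N q u) \<le> norm q * norm u"
  by (rule has_sum_norm[OF left_mult_sums])

lemma left_mult_qscale: "left_mult_of N q (u *\<^sub>H p) = left_mult_of N q u *\<^sub>H p"
proof (rule left_mult_eqI)
  have "((\<lambda>z. summand q u z *\<^sub>H p) has_sum left_mult_of N q u *\<^sub>H p) N"
    using has_sum_bounded_linear[OF bounded_linear_qscale left_mult_sums] by (simp add: o_def)
  then show "(summand q (u *\<^sub>H p) has_sum left_mult_of N q u *\<^sub>H p) N"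
    by (simp add: qinner_qscale_right qscale_assoc mult.assoc)
qed

lemma left_mult_bounded_op: "bounded_op (left_mult_of N q)"
proof (rule bounded_opI)
  show "bounded_linear (left_mult_of N q)"
  proof (rule bounded_linear_of_norm_le[OF _ _ left_mult_norm])
    fix u v and r :: real
    show "left_mult_of N q (u + v) = left_mult_of N q u + left_mult_of N q v"
      by (rule left_mult_eqI) (use has_sum_add[OF left_mult_sums left_mult_sums] in \<open>simp add: summand_add\<close>)
    show "left_mult_of N q (r *\<^sub>R u) = r *\<^sub>R left_mult_of N q u"
      by (simp add: scaleR_conv_qscale left_mult_qscale)
  qed
qed (rule left_mult_qscale)

lemma left_mult_basis:
  assumes "z \<in> N"
  shows "left_mult_of N q (z *\<^sub>H p) = z *\<^sub>H (q * p)"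
proof (rule left_mult_eqI)
  have "(summand q (z *\<^sub>H p) has_sum sum (summand q (z *\<^sub>H p)) {z}) {z}" by (rule has_sum_finite) simp
  moreover have "sum (summand q (z *\<^sub>H p)) {z} = z *\<^sub>H (q * p)"
    using ortho[OF assms assms] by (simp add: qinner_qscale_right qscale_assoc)
  moreover have "summand q (z *\<^sub>H p) w = 0" if "w \<in> N - {z}" for w
    using ortho[of w z] assms that by (simp add: qinner_qscale_right)
  ultimately show "(summand q (z *\<^sub>H p) has_sum z *\<^sub>H (q * p)) N"
    using assms by (subst has_sum_cong_neutral[where g = "summand q (z *\<^sub>H p)" and T = "{z}"]) auto
qed

end

text \<open>Everything is checked on right multiples of basis vectors, where \<open>L q\<close>
  sends \<open>z *\<^sub>H p\<close> to \<open>z *\<^sub>H (q * p)\<close>.\<close>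

lemma left_scalar_mult_properties:
  assumes L: "left_scalar_mult L"
  shows lsm_bounded_op: "bounded_op (L q)"
    and lsm_mult: "L p (L q u) = L (p * q) u"
    and lsm_add: "L (p + q) u = L p u + L q u"
    and lsm_of_real: "L (of_real r) u = r *\<^sub>R u"
    and lsm_inner: "inner (L q u) v = inner u (L (qcnj q) v)"
proof -
  obtain N where N: "hilbert_basis N" "L = left_mult_of N" using L by (auto simp: left_scalar_mult_def)
  interpret onb N by unfold_locales (rule N(1))
  show bop: "bounded_op (L q)" for q unfolding N(2) by (rule left_mult_bounded_op)
  note bl = bounded_op_bl[OF bop]
  have basis: "L q (z *\<^sub>H p) = z *\<^sub>H (q * p)" if "z \<in> N" for q p z
    unfolding N(2) using that by (rule left_mult_basis)
  show "L p (L q u) = L (p * q) u"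
    by (rule bounded_linear_eqI[OF bounded_linear_compose[OF bl bl] bl]) (simp add: basis mult.assoc)
  show "L (p + q) u = L p u + L q u"
    by (rule bounded_linear_eqI[OF bl bounded_linear_add[OF bl bl]])
      (simp add: basis distrib_right qscale_add_right)
  show "L (of_real r) u = r *\<^sub>R u"
    by (rule bounded_linear_eqI[OF bl bounded_linear_const_scaleR[OF bounded_linear_ident]])
      (simp add: basis scaleR_conv_qscale qscale_assoc quat_of_real_commute)
  have 1: "inner (z *\<^sub>H (q * p)) v = inner (z *\<^sub>H p) (L (qcnj q) v)" if z: "z \<in> N" for z p v
  proof (rule bounded_linear_eqI[OF bounded_linear_inner_right
        bounded_linear_compose[OF bounded_linear_inner_right bl]])
    fix w p' assume w: "w \<in> N"
    have "inner (q * p) p' = inner p (qcnj q * p')"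
      by (simp add: inner_quat_def algebra_simps)
    then show "inner (z *\<^sub>H (q * p)) (w *\<^sub>H p') = inner (z *\<^sub>H p) (L (qcnj q) (w *\<^sub>H p'))"
      using z w by (simp add: basis inner_basis)
  qed
  show "inner (L q u) v = inner u (L (qcnj q) v)"
    by (rule bounded_linear_eqI[OF bounded_linear_compose[OF bounded_linear_inner_left bl]
          bounded_linear_inner_left]) (simp add: basis 1)
qed

lemma lsm_norm:
  assumes L: "left_scalar_mult L"
  shows "norm (L q u) = norm q * norm u"
proof -
  have "(norm (L q u))\<^sup>2 = inner u (L (qcnj q) (L q u))"
    by (simp add: power2_norm_eq_inner lsm_inner[OF L])
  also have "\<dots> = (norm q * norm u)\<^sup>2"
    by (simp add: lsm_mult[OF L] qcnj_mult_self lsm_of_real[OF L] power_mult_distrib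
        power2_norm_eq_inner[symmetric] del: of_real_power)
  finally show ?thesis by (simp add: power2_eq_iff_nonneg)
qed

lemma lsm_one:
  assumes L: "left_scalar_mult L"
  shows "L 1 u = u"
  using lsm_of_real[OF L, of 1] by simp

lemma lsm_zero:
  assumes L: "left_scalar_mult L"
  shows "L 0 u = 0"
  using lsm_of_real[OF L, of 0] by simp

section \<open>The half plane and its Borel sets\<close>

lemma imag_units_iff: "\<iota> \<in> imag_units \<longleftrightarrow> qRe \<iota> = 0 \<and> norm \<iota> = 1"
proof
  assume "\<iota> \<in> imag_units"
  then have sq: "\<iota> * \<iota> = -1" by (simp add: imag_units_def power2_eq_square)
  then have "norm \<iota> * norm \<iota> = 1" by (metis norm_minus_cancel norm_mult norm_one)
  then have n: "norm \<iota> = 1" by (smt (verit) mult_cancel_left norm_ge_zero square_eq_1_iff)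
  then have "qRe \<iota> * qRe \<iota> + qIm1 \<iota> * qIm1 \<iota> + qIm2 \<iota> * qIm2 \<iota> + qIm3 \<iota> * qIm3 \<iota> = 1"
    using norm_quat_sq[of \<iota>] by simp
  moreover have "qRe \<iota> * qRe \<iota> - qIm1 \<iota> * qIm1 \<iota> - qIm2 \<iota> * qIm2 \<iota> - qIm3 \<iota> * qIm3 \<iota> = -1"
    using sq by (simp add: quat_eq_iff)
  ultimately have "qRe \<iota> * qRe \<iota> = 0" by linarith
  with n show "qRe \<iota> = 0 \<and> norm \<iota> = 1" by simp
next
  assume "qRe \<iota> = 0 \<and> norm \<iota> = 1"
  then show "\<iota> \<in> imag_units"
    using norm_quat_sq[of \<iota>] by (auto simp: imag_units_def power2_eq_square quat_eq_iff)
qed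

lemma imag_units_square: "\<iota> \<in> imag_units \<Longrightarrow> \<iota> * \<iota> = -1"
  by (simp add: imag_units_def power2_eq_square)

lemma imag_units_cnj: "\<iota> \<in> imag_units \<Longrightarrow> qcnj \<iota> = - \<iota>"
  by (simp add: imag_units_iff quat_eq_iff)

lemma inner_of_real_imag: "\<iota> \<in> imag_units \<Longrightarrow> inner \<iota> (of_real a) = 0"
  by (simp add: imag_units_iff inner_quat_def)

lemma inner_imag_imag: "\<iota> \<in> imag_units \<Longrightarrow> inner \<iota> (\<iota> * of_real b) = b"
proof -
  assume i: "\<iota> \<in> imag_units"
  have "inner \<iota> (\<iota> * of_real b) = b * (norm \<iota>)\<^sup>2" by (simp add: norm_quat_sq inner_quat_def algebra_simps)
  then show ?thesis using i by (simp add: imag_units_iff)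
qed

lemma qRe_imag_mult: "\<iota> \<in> imag_units \<Longrightarrow> qRe (\<iota> * of_real b) = 0"
  by (simp add: imag_units_iff)

text \<open>\<open>qRe\<close> and \<open>inner \<iota>\<close> serve as Cartesian coordinates of
  the half plane.\<close>

lemma half_plane_iff:
  assumes "\<iota> \<in> imag_units"
  shows "q \<in> half_plane \<iota> \<longleftrightarrow> q = of_real (qRe q) + \<iota> * of_real (inner \<iota> q) \<and> inner \<iota> q \<ge> 0"
proof
  assume "q \<in> half_plane \<iota>"
  then obtain a b where q: "q = of_real a + \<iota> * of_real b" "b \<ge> 0" by (auto simp: half_plane_def)
  have "qRe q = a" using assms by (simp add: q(1) imag_units_iff)
  moreover have "inner \<iota> q = b"
    using assms by (simp add: q(1) inner_add_right inner_of_real_imag inner_imag_imag)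
  ultimately show "q = of_real (qRe q) + \<iota> * of_real (inner \<iota> q) \<and> inner \<iota> q \<ge> 0" using q by simp
next
  assume "q = of_real (qRe q) + \<iota> * of_real (inner \<iota> q) \<and> inner \<iota> q \<ge> 0"
  then show "q \<in> half_plane \<iota>" unfolding half_plane_def by blast
qed

lemma qRe_eq_inner: "qRe q = inner 1 q"
  by (simp add: inner_quat_def)

lemma closed_half_plane: "\<iota> \<in> imag_units \<Longrightarrow> closed (half_plane \<iota>)"
proof -
  assume i: "\<iota> \<in> imag_units"
  have "half_plane \<iota> = {q. q = of_real (inner 1 q) + \<iota> * of_real (inner \<iota> q)} \<inter> {q. inner \<iota> q \<ge> 0}"
    using half_plane_iff[OF i] by (auto simp: qRe_eq_inner)
  moreover have "closed ({q. q = of_real (inner 1 q) + \<iota> * of_real (inner \<iota> q)} \<inter> {q. inner \<iota> q \<ge> 0})"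
    by (intro closed_Int closed_Collect_eq closed_Collect_le continuous_intros)
  ultimately show ?thesis by simp
qed

lemma sets_half_plane_borel:
  "\<iota> \<in> imag_units \<Longrightarrow> E \<in> sets (half_plane_borel \<iota>) \<longleftrightarrow> E \<subseteq> half_plane \<iota> \<and> E \<in> sets borel"
  using closed_half_plane[of \<iota>] by (subst sets_restrict_space_iff) auto

lemma space_half_plane_borel [simp]: "space (half_plane_borel \<iota>) = half_plane \<iota>"
  by (simp add: space_restrict_space)

lemma openin_half_plane_borel:
  "\<iota> \<in> imag_units \<Longrightarrow> openin (top_of_set (half_plane \<iota>)) U \<Longrightarrow> U \<in> sets (half_plane_borel \<iota>)"
  using closed_half_plane[of \<iota>] by (auto simp: sets_half_plane_borel openin_open)

section \<open>Projection-valued measures\<close>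

locale qpvm =
  fixes \<iota> :: quat and P :: "quat set \<Rightarrow> 'h::quat_hilbert \<Rightarrow> 'h"
  assumes iota: "\<iota> \<in> imag_units" and pvm: "qPVM \<iota> P"
begin

abbreviation "HP \<equiv> half_plane \<iota>"
abbreviation "HB \<equiv> sets (half_plane_borel \<iota>)"

lemma HB_sub: "E \<in> HB \<Longrightarrow> E \<subseteq> HP"
  by (simp add: sets_half_plane_borel[OF iota])

lemma HP_HB: "HP \<in> HB"
  using sets.top[of "half_plane_borel \<iota>"] by simp

lemma P_bop: "E \<in> HB \<Longrightarrow> bounded_op (P E)"
  using pvm by (simp add: qPVM_def)

lemma P_bl: "E \<in> HB \<Longrightarrow> bounded_linear (P E)"
  by (rule bounded_op_bl[OF P_bop])

lemma P_Int: "E \<in> HB \<Longrightarrow> E' \<in> HB \<Longrightarrow> P E (P E' u) = P (E \<inter> E') u"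
  using pvm unfolding qPVM_def by (metis comp_apply)

lemma P_proj: "E \<in> HB \<Longrightarrow> is_proj (P E)"
  using pvm positive_op_iff[OF P_bop] P_Int[of E E] by (simp add: qPVM_def is_proj_def)

lemma P_HP [simp]: "P HP u = u"
  using pvm by (simp add: qPVM_def)

lemma P_sums: "range E \<subseteq> HB \<Longrightarrow> disjoint_family E \<Longrightarrow> (\<lambda>n. P (E n) u) sums P (\<Union>n. E n) u"
  using pvm unfolding qPVM_def by blast

text \<open>Countable additivity for a sequence of empty sets gives a convergent series with
  constant terms.\<close>

lemma P_empty [simp]: "P {} u = 0"
proof -
  have "(\<lambda>n::nat. P {} u) sums P (\<Union>n::nat. {}) u"
    by (rule P_sums) (auto simp: disjoint_family_on_def)
  then have "(\<lambda>n::nat. P {} u) \<longlonglongrightarrow> 0" by (intro summable_LIMSEQ_zero) (auto simp: sums_iff)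
  then show ?thesis by (simp add: LIMSEQ_const_iff)
qed

lemma P_Un:
  assumes "E \<in> HB" "E' \<in> HB" "E \<inter> E' = {}"
  shows "P (E \<union> E') u = P E u + P E' u"
proof -
  have "(\<lambda>n. P (binaryset E E' n) u) sums P (\<Union>n. binaryset E E' n) u"
    using assms by (intro P_sums)
      (auto simp: range_binaryset_eq disjoint_family_on_def binaryset_def)
  moreover have "(\<lambda>n. P (binaryset E E' n) u) sums (P E u + P E' u)"
    by (rule binaryset_sums) simp
  ultimately show ?thesis by (simp add: UN_binaryset_eq sums_unique2)
qed

lemma P_diff:
  assumes "E \<in> HB" "E' \<in> HB" "E' \<subseteq> E"
  shows "P (E - E') u = P E u - P E' u"
proof -
  have "E' \<union> (E - E') = E" using assms by blast
  then show ?thesis using P_Un[of E' "E - E'" u] assms by (simp add: sets.Diff)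
qed

lemma P_mono_zero: "E \<in> HB \<Longrightarrow> E' \<in> HB \<Longrightarrow> E \<subseteq> E' \<Longrightarrow> P E' u = 0 \<Longrightarrow> P E u = 0"
  by (metis P_Int P_bl inf.absorb1 bounded_linear.linear linear_0)

lemma P_UN_finite:
  assumes "finite I" "\<And>i. i \<in> I \<Longrightarrow> A i \<in> HB" "\<And>i j. i \<in> I \<Longrightarrow> j \<in> I \<Longrightarrow> i \<noteq> j \<Longrightarrow> A i \<inter> A j = {}"
  shows "P (\<Union>i\<in>I. A i) u = (\<Sum>i\<in>I. P (A i) u)"
  using assms
proof (induction I rule: finite_induct)
  case (insert i I)
  have "A i \<inter> (\<Union>j\<in>I. A j) = {}" using insert.prems(2)[of i] insert.hyps by blast
  moreover have "(\<Union>j\<in>I. A j) \<in> HB" using insert by (intro sets.finite_UN) auto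
  ultimately show ?case using insert by (simp add: P_Un)
qed simp

lemma P_incseq:
  assumes E: "\<And>n. E n \<in> HB" "incseq E"
  shows "(\<lambda>n. P (E n) u) \<longlonglongrightarrow> P (\<Union>n. E n) u"
proof -
  have d: "disjointed E n \<in> HB" for n
    using sets.range_disjointed_sets[of E "half_plane_borel \<iota>"] E(1) by auto
  have "(\<lambda>n. P (disjointed E n) u) sums P (\<Union>n. disjointed E n) u"
    using d by (intro P_sums) (auto simp: disjoint_family_disjointed)
  then have "(\<lambda>n. \<Sum>i<n. P (disjointed E i) u) \<longlonglongrightarrow> P (\<Union>n. E n) u"
    by (simp add: sums_def UN_disjointed_eq)
  then have "(\<lambda>n. \<Sum>i<Suc n. P (disjointed E i) u) \<longlonglongrightarrow> P (\<Union>n. E n) u"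
    by (rule LIMSEQ_Suc)
  moreover have "(\<Sum>i<Suc n. P (disjointed E i) u) = P (E n) u" for n
  proof -
    have "(\<Sum>i<Suc n. P (disjointed E i) u) = P (\<Union>i<Suc n. disjointed E i) u"
      using d disjoint_family_disjointed[of E]
      by (intro P_UN_finite[symmetric]) (auto simp: disjoint_family_on_def)
    also have "(\<Union>i<Suc n. disjointed E i) = (\<Union>i<Suc n. E i)"
      using finite_UN_disjointed_eq[of E "Suc n"] by (simp add: lessThan_atLeast0)
    also have "\<dots> = E n"
      using E(2) by (force simp: less_Suc_eq_le incseq_def)
    finally show ?thesis .
  qed
  ultimately show ?thesis by simp
qed

lemma P_UN_zero:
  assumes E: "\<And>n::nat. E n \<in> HB" "\<And>n. P (E n) u = 0"
  shows "P (\<Union>n. E n) u = 0"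
proof -
  have d: "disjointed E n \<in> HB" for n
    using sets.range_disjointed_sets[of E "half_plane_borel \<iota>"] E(1) by auto
  have "P (disjointed E n) u = 0" for n
    by (rule P_mono_zero[OF d E(1) disjointed_subset E(2)])
  moreover have "(\<lambda>n. P (disjointed E n) u) sums P (\<Union>n. disjointed E n) u"
    using d by (intro P_sums) (auto simp: disjoint_family_disjointed)
  ultimately show ?thesis using sums_unique2[OF sums_zero] by (simp add: UN_disjointed_eq)
qed

lemma P_Union_zero:
  assumes "countable C" "C \<subseteq> HB" "\<And>E. E \<in> C \<Longrightarrow> P E u = 0"
  shows "P (\<Union>C) u = 0"
proof (cases "C = {}")
  case False
  have r: "range (from_nat_into C) = C" using False assms(1) by (rule range_from_nat_into)
  have "P (\<Union>n. from_nat_into C n) u = 0"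
    using assms r by (intro P_UN_zero) (metis rangeI subsetD, metis rangeI)
  then show ?thesis using r by simp
qed simp

lemma P_disjoint: "E \<in> HB \<Longrightarrow> E' \<in> HB \<Longrightarrow> E \<inter> E' = {} \<Longrightarrow> P E (P E' u) = 0"
  by (simp add: P_Int)

lemma P_inner_disjoint:
  "E \<in> HB \<Longrightarrow> E' \<in> HB \<Longrightarrow> E \<inter> E' = {} \<Longrightarrow> inner (P E u) (P E' v) = 0"
  using selfadj_inner[OF is_proj_selfadj[OF P_proj], of E u "P E' v"] by (simp add: P_disjoint)

lemma norm_P_sum:
  assumes "finite I" "\<And>i. i \<in> I \<Longrightarrow> A i \<in> HB" "\<And>i j. i \<in> I \<Longrightarrow> j \<in> I \<Longrightarrow> i \<noteq> j \<Longrightarrow> A i \<inter> A j = {}"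
  shows "(norm (\<Sum>i\<in>I. P (A i) (v i)))\<^sup>2 = (\<Sum>i\<in>I. (norm (P (A i) (v i)))\<^sup>2)"
proof -
  have "(norm (\<Sum>i\<in>I. P (A i) (v i)))\<^sup>2 = (\<Sum>i\<in>I. \<Sum>j\<in>I. inner (P (A j) (v j)) (P (A i) (v i)))"
    by (simp add: power2_norm_eq_inner inner_sum_left inner_sum_right)
  also have "\<dots> = (\<Sum>i\<in>I. \<Sum>j\<in>I. if j = i then inner (P (A j) (v j)) (P (A i) (v i)) else 0)"
    using assms by (intro sum.cong) (auto simp: P_inner_disjoint)
  also have "\<dots> = (\<Sum>i\<in>I. (norm (P (A i) (v i)))\<^sup>2)"
    using assms(1) by (simp add: power2_norm_eq_inner)
  finally show ?thesis .
qed

abbreviation "supp \<equiv> qsupp \<iota> P"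

text \<open>The complement of the support is a possibly uncountable union of open null sets; by
  Lindelof's theorem a countable subfamily has the same union, so it is null.\<close>

lemma supp_closed: "closed supp" and supp_sub: "supp \<subseteq> HP" and P_supp_compl: "P (HP - supp) u = 0"
  and supp_HB: "supp \<in> HB"
proof -
  let ?F = "{U. openin (top_of_set HP) U \<and> P U = (\<lambda>u. 0)}"
  have supp: "supp = HP - \<Union>?F" by (simp add: qsupp_def)
  show sub: "supp \<subseteq> HP" by (auto simp: supp)
  have o: "openin (top_of_set HP) (\<Union>?F)" by (intro openin_Union) auto
  then have "closedin (top_of_set HP) supp" unfolding supp by (intro closedin_diff) auto
  then show cl: "closed supp" using closedin_closed_trans closed_half_plane[OF iota] by blast
  then show "supp \<in> HB" using sub by (simp add: sets_half_plane_borel[OF iota])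
  obtain C where C: "C \<subseteq> ?F" "countable C" "\<Union>C = \<Union>?F"
    by (rule Lindelof_openin[of ?F HP]) auto
  have "P (\<Union>C) u = 0"
    using C(1,2) openin_half_plane_borel[OF iota] by (intro P_Union_zero) auto
  moreover have "HP - supp = \<Union>?F" using openin_imp_subset[OF o] by (auto simp: supp)
  ultimately show "P (HP - supp) u = 0" by (simp add: C(3))
qed

lemma P_supp: "P supp u = u"
  using P_diff[OF HP_HB supp_HB supp_sub, of u] P_supp_compl[of u] by simp

lemma supp_iff:
  "q \<in> supp \<longleftrightarrow> q \<in> HP \<and> (\<forall>U. openin (top_of_set HP) U \<and> q \<in> U \<longrightarrow> P U \<noteq> (\<lambda>u. 0))"
  by (auto simp: qsupp_def)

end

section \<open>The functional calculus of an iqPVM\<close>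

locale iqpvm = qpvm +
  fixes L
  assumes left: "left_scalar_mult L"
    and comm_PL: "E \<in> sets (half_plane_borel \<iota>) \<Longrightarrow> P E (L q u) = L q (P E u)"
begin

abbreviation "simple \<equiv> simple_function (half_plane_borel \<iota>)"
abbreviation "fib g b \<equiv> g -` {b} \<inter> HP"
abbreviation "si \<equiv> simple_qint \<iota> P L"

lemmas L_bop = lsm_bounded_op[OF left]
  and L_mult = lsm_mult[OF left] and L_add = lsm_add[OF left] and L_of_real = lsm_of_real[OF left]
  and L_inner = lsm_inner[OF left] and L_norm = lsm_norm[OF left] and L_one = lsm_one[OF left]
  and L_zero = lsm_zero[OF left]

lemmas L_bl = bounded_op_bl[OF L_bop]

lemma L_sum: "L q (sum f I) = (\<Sum>i\<in>I. L q (f i))"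
  by (rule linear_sum[OF bounded_linear.linear[OF L_bl]])

lemma L_diff: "L (p - q) u = L p u - L q u"
  using L_add[of "p - q" q u] by simp

lemma simple_finite: "simple g \<Longrightarrow> finite (g ` HP)"
  using simple_functionD(1) by fastforce

lemma fib_HB: "simple g \<Longrightarrow> fib g b \<in> HB"
  using simple_functionD(2)[of "half_plane_borel \<iota>" g "{b}"] by simp

lemma fib_disjoint: "b \<noteq> c \<Longrightarrow> fib g b \<inter> fib g c = {}"
  by auto

text \<open>Frees the integral from its canonical form: distinct values of \<open>g\<close> may have
  the same image under \<open>h\<close>. Applied to pairs of simple functions, it evaluates
  integrals on a common refinement.\<close>

lemma si_comp:
  assumes g: "simple g"
  shows "si (\<lambda>x. h (g x)) u = (\<Sum>b\<in>g ` HP. L (h b) (P (fib g b) u))"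
proof -
  have "(\<Sum>b\<in>g ` HP. L (h b) (P (fib g b) u))
      = (\<Sum>y\<in>h ` g ` HP. \<Sum>b\<in>{b \<in> g ` HP. h b = y}. L (h b) (P (fib g b) u))"
    by (rule sum.image_gen[OF simple_finite[OF g]])
  also have "\<dots> = (\<Sum>y\<in>h ` g ` HP. L y (P (fib (\<lambda>x. h (g x)) y) u))"
  proof (intro sum.cong refl)
    fix y
    let ?B = "{b \<in> g ` HP. h b = y}"
    have "(\<Sum>b\<in>?B. L (h b) (P (fib g b) u)) = L y (\<Sum>b\<in>?B. P (fib g b) u)"
      by (simp add: L_sum)
    also have "(\<Sum>b\<in>?B. P (fib g b) u) = P (\<Union>b\<in>?B. fib g b) u"
      using simple_finite[OF g] by (intro P_UN_finite[symmetric] fib_HB g fib_disjoint) auto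
    also have "(\<Union>b\<in>?B. fib g b) = fib (\<lambda>x. h (g x)) y" by auto
    finally show "(\<Sum>b\<in>?B. L (h b) (P (fib g b) u)) = L y (P (fib (\<lambda>x. h (g x)) y) u)" .
  qed
  finally show ?thesis by (simp add: simple_qint_def image_image)
qed

lemma si_bop: "simple s \<Longrightarrow> bounded_op (si s)"
  unfolding simple_qint_def
  by (intro bounded_op_sum bounded_op_comp[OF L_bop P_bop] fib_HB)

lemma si_pair:
  assumes s: "simple s" "simple s'"
  shows "si (\<lambda>x. h (s x) (s' x)) u
    = (\<Sum>b\<in>(\<lambda>x. (s x, s' x)) ` HP. L (h (fst b) (snd b)) (P (fib (\<lambda>x. (s x, s' x)) b) u))"
  using si_comp[OF simple_function_Pair[OF s], of "\<lambda>b. h (fst b) (snd b)"] by simp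

lemma si_diff:
  assumes s: "simple s" "simple s'"
  shows "si (\<lambda>x. s x - s' x) u = si s u - si s' u"
  using si_pair[OF s, of "\<lambda>a b. a"] si_pair[OF s, of "\<lambda>a b. b"] si_pair[OF s, of "\<lambda>a b. a - b"]
  by (simp add: L_diff sum_subtractf)

lemma si_mult:
  assumes s: "simple s" "simple s'"
  shows "si (\<lambda>x. s x * s' x) u = si s (si s' u)"
proof -
  let ?g = "\<lambda>x. (s x, s' x)"
  have g: "simple ?g" by (intro simple_function_Pair s)
  have fin: "finite (?g ` HP)" by (rule simple_finite[OF g])
  have "si s (si s' u) = (\<Sum>b\<in>?g ` HP. L (fst b) (P (fib ?g b) (si s' u)))"
    using si_pair[OF s, of "\<lambda>a b. a"] by simp
  also have "\<dots> = (\<Sum>b\<in>?g ` HP. L (fst b * snd b) (P (fib ?g b) u))"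
  proof (intro sum.cong refl)
    fix b assume b: "b \<in> ?g ` HP"
    have "P (fib ?g b) (si s' u) = P (fib ?g b) (\<Sum>c\<in>?g ` HP. L (snd c) (P (fib ?g c) u))"
      using si_pair[OF s, of "\<lambda>a b. b" u] by simp
    also have "\<dots> = (\<Sum>c\<in>?g ` HP. P (fib ?g b) (L (snd c) (P (fib ?g c) u)))"
      by (rule linear_sum[OF bounded_linear.linear[OF P_bl[OF fib_HB[OF g]]]])
    also have "\<dots> = (\<Sum>c\<in>?g ` HP. if c = b then L (snd b) (P (fib ?g b) u) else 0)"
    proof (intro sum.cong refl)
      fix c
      have "P (fib ?g b) (L (snd c) (P (fib ?g c) u)) = L (snd c) (P (fib ?g b \<inter> fib ?g c) u)"
        by (simp only: comm_PL[OF fib_HB[OF g]] P_Int[OF fib_HB[OF g] fib_HB[OF g]])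
      moreover have "fib ?g b \<inter> fib ?g c = {}" if "c \<noteq> b" using that by (intro fib_disjoint) auto
      ultimately show "P (fib ?g b) (L (snd c) (P (fib ?g c) u))
          = (if c = b then L (snd b) (P (fib ?g b) u) else 0)"
        using linear_0[OF bounded_linear.linear[OF L_bl]] by auto
    qed
    also have "\<dots> = L (snd b) (P (fib ?g b) u)" using fin b by simp
    finally show "L (fst b) (P (fib ?g b) (si s' u)) = L (fst b * snd b) (P (fib ?g b) u)"
      by (simp add: L_mult)
  qed
  finally show ?thesis using si_pair[OF s, of "\<lambda>a b. a * b"] by simp
qed

lemma si_cnj:
  assumes s: "simple s"
  shows "inner (si s u) v = inner u (si (\<lambda>x. qcnj (s x)) v)"
proof -
  have "inner (L b (P (fib s b) u)) v = inner u (L (qcnj b) (P (fib s b) v))" for b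
    using selfadj_inner[OF is_proj_selfadj[OF P_proj[OF fib_HB[OF s]]]]
    by (simp add: L_inner comm_PL[OF fib_HB[OF s]])
  then show ?thesis
    unfolding si_comp[OF s, of qcnj v] by (simp add: simple_qint_def inner_sum_left inner_sum_right)
qed

text \<open>The blocks belonging to different values are orthogonal and \<open>L y\<close>
  multiplies norms by \<open>norm y\<close>, so Pythagoras yields the supremum bound without summing
  over the values.\<close>

lemma si_norm:
  assumes s: "simple s" and c: "\<And>x. x \<in> HP \<Longrightarrow> norm (s x) \<le> c"
  shows "norm (si s u) \<le> c * norm u"
proof -
  have fin: "finite (s ` HP)" by (rule simple_finite[OF s])
  \<comment> \<open>The half plane is nonempty, so the bound \<open>c\<close> is
    nonnegative.\<close>
  have "0 \<in> HP" by (auto simp: half_plane_def intro!: exI[of _ 0])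
  then have c0: "c \<ge> 0" using c norm_ge_zero order_trans by blast
  have "si s u = (\<Sum>y\<in>s ` HP. P (fib s y) (L y u))"
    by (simp add: simple_qint_def comm_PL[OF fib_HB[OF s]])
  then have "(norm (si s u))\<^sup>2 = (\<Sum>y\<in>s ` HP. (norm (P (fib s y) (L y u)))\<^sup>2)"
    using fin by (simp add: norm_P_sum[OF fin fib_HB[OF s] fib_disjoint])
  also have "\<dots> = (\<Sum>y\<in>s ` HP. (norm y)\<^sup>2 * (norm (P (fib s y) u))\<^sup>2)"
    by (simp add: comm_PL[OF fib_HB[OF s]] L_norm power_mult_distrib)
  also have "\<dots> \<le> (\<Sum>y\<in>s ` HP. c\<^sup>2 * (norm (P (fib s y) u))\<^sup>2)"
    using c by (intro sum_mono mult_right_mono power_mono) auto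
  also have "\<dots> = c\<^sup>2 * (norm (\<Sum>y\<in>s ` HP. P (fib s y) u))\<^sup>2"
    by (simp add: norm_P_sum[OF fin fib_HB[OF s] fib_disjoint] sum_distrib_left)
  also have "(\<Sum>y\<in>s ` HP. P (fib s y) u) = P (\<Union>y\<in>s ` HP. fib s y) u"
    by (rule P_UN_finite[OF fin fib_HB[OF s] fib_disjoint, symmetric])
  also have "(\<Union>y\<in>s ` HP. fib s y) = HP" by auto
  finally have "(norm (si s u))\<^sup>2 \<le> (c * norm u)\<^sup>2" by (simp add: power_mult_distrib)
  then show ?thesis using c0 by (simp add: power2_le_iff_abs_le)
qed

lemma si_indicator:
  assumes E: "E \<in> HB"
  shows "si (\<lambda>x. if x \<in> E then q else 0) u = L q (P E u)"
    and "simple (\<lambda>x. if x \<in> E then q else 0)"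
proof -
  let ?g = "\<lambda>x. x \<in> E"
  have g: "simple ?g"
  proof -
    have "?g -` {b} \<inter> HP \<in> HB" for b
    proof (cases b)
      case True
      then have "?g -` {b} \<inter> HP = E" using HB_sub[OF E] by auto
      then show ?thesis using E by simp
    next
      case False
      then have "?g -` {b} \<inter> HP = HP - E" by auto
      then show ?thesis using E HP_HB by (simp add: sets.Diff)
    qed
    then show ?thesis by (simp add: simple_function_def)
  qed
  show "simple (\<lambda>x. if x \<in> E then q else 0)"
    using simple_function_compose1[OF g, of "\<lambda>b. if b then q else 0"] by simp
  have "si (\<lambda>x. if x \<in> E then q else 0) u = (\<Sum>b\<in>?g ` HP. L (if b then q else 0) (P (fib ?g b) u))"
    using si_comp[OF g, of "\<lambda>b. if b then q else 0"] by simp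
  \<comment> \<open>A truth value that is not attained has an empty fibre and contributes
    zero.\<close>
  also have "\<dots> = (\<Sum>b\<in>{True, False}. L (if b then q else 0) (P (fib ?g b) u))"
  proof (rule sum.mono_neutral_left)
    show "\<forall>i\<in>{True, False} - ?g ` HP. L (if i then q else 0) (P (fib ?g i) u) = 0"
    proof
      fix i assume "i \<in> {True, False} - ?g ` HP"
      then have "fib ?g i = {}" by auto
      then show "L (if i then q else 0) (P (fib ?g i) u) = 0"
        using linear_0[OF bounded_linear.linear[OF L_bl]] by auto
    qed
  qed auto
  finally show "si (\<lambda>x. if x \<in> E then q else 0) u = L q (P E u)"
    using HB_sub[OF E] by (simp add: L_zero vimage_def inf.absorb1)
qed

section \<open>Integrals of uniform limits of simple functions\<close>

abbreviation "is_int \<equiv> has_bounded_qint \<iota> P L"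

text \<open>Trades the limits and \<open>onorm\<close> for a single approximation per tolerance
  \<open>e\<close>, the form in which the rules of the calculus are proved.\<close>

lemma int_iff:
  "is_int \<phi> A \<longleftrightarrow> bounded_op A \<and>
    (\<forall>e>0. \<exists>s. simple s \<and> (\<forall>x\<in>HP. norm (s x - \<phi> x) \<le> e) \<and> (\<forall>u. norm (si s u - A u) \<le> e * norm u))"
proof
  assume L: "is_int \<phi> A"
  then obtain s where A: "bounded_op A" and s: "\<And>n. simple (s n)"
      "uniform_limit HP s \<phi> sequentially" "(\<lambda>n. onorm (\<lambda>u. si (s n) u - A u)) \<longlonglongrightarrow> 0"
    by (auto simp: has_bounded_qint_def)
  have "\<exists>s. simple s \<and> (\<forall>x\<in>HP. norm (s x - \<phi> x) \<le> e) \<and> (\<forall>u. norm (si s u - A u) \<le> e * norm u)"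
    if e: "e > 0" for e :: real
  proof -
    have "\<forall>\<^sub>F n in sequentially. \<forall>x\<in>HP. dist (s n x) (\<phi> x) < e"
      using s(2) e by (rule uniform_limitD)
    moreover have "\<forall>\<^sub>F n in sequentially. onorm (\<lambda>u. si (s n) u - A u) < e"
      using s(3) e by (rule order_tendstoD)
    ultimately have "\<forall>\<^sub>F n in sequentially. (\<forall>x\<in>HP. dist (s n x) (\<phi> x) < e) \<and> onorm (\<lambda>u. si (s n) u - A u) < e"
      by eventually_elim simp
    then obtain n where n: "\<forall>x\<in>HP. dist (s n x) (\<phi> x) < e" "onorm (\<lambda>u. si (s n) u - A u) < e"
      by (auto simp: eventually_sequentially)
    have "norm (si (s n) u - A u) \<le> e * norm u" for u
    proof -
      have "bounded_linear (\<lambda>u. si (s n) u - A u)"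
        by (intro bounded_linear_sub bounded_op_bl si_bop s A)
      then have "norm (si (s n) u - A u) \<le> onorm (\<lambda>u. si (s n) u - A u) * norm u" by (rule onorm)
      also have "\<dots> \<le> e * norm u" using n by (intro mult_right_mono) auto
      finally show ?thesis .
    qed
    then show ?thesis using n s(1) by (intro exI[of _ "s n"]) (auto simp: dist_norm less_imp_le)
  qed
  with A show "bounded_op A \<and> (\<forall>e>0. \<exists>s. simple s \<and> (\<forall>x\<in>HP. norm (s x - \<phi> x) \<le> e)
    \<and> (\<forall>u. norm (si s u - A u) \<le> e * norm u))" by blast
next
  assume R: "bounded_op A \<and>
    (\<forall>e>0. \<exists>s. simple s \<and> (\<forall>x\<in>HP. norm (s x - \<phi> x) \<le> e) \<and> (\<forall>u. norm (si s u - A u) \<le> e * norm u))"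
  then have "\<forall>n. \<exists>s. simple s \<and> (\<forall>x\<in>HP. norm (s x - \<phi> x) \<le> 1 / Suc n)
      \<and> (\<forall>u. norm (si s u - A u) \<le> 1 / Suc n * norm u)"
    by (metis of_nat_0_less_iff zero_less_Suc zero_less_divide_1_iff)
  then obtain s where s: "\<And>n. simple (s n)" "\<And>n x. x \<in> HP \<Longrightarrow> norm (s n x - \<phi> x) \<le> 1 / Suc n"
      "\<And>n u. norm (si (s n) u - A u) \<le> 1 / Suc n * norm u" by metis
  have lim: "(\<lambda>n. 1 / real (Suc n)) \<longlonglongrightarrow> 0" by (rule LIMSEQ_Suc[OF lim_1_over_n])
  have "uniform_limit HP s \<phi> sequentially"
  proof (rule uniform_limitI)
    fix e :: real assume "e > 0"
    then have "\<forall>\<^sub>F n in sequentially. 1 / real (Suc n) < e" by (intro order_tendstoD[OF lim])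
    then show "\<forall>\<^sub>F n in sequentially. \<forall>x\<in>HP. dist (s n x) (\<phi> x) < e"
    proof eventually_elim
      case (elim n)
      then show ?case using s(2)[of _ n] by (auto simp: dist_norm intro: le_less_trans)
    qed
  qed
  moreover have "(\<lambda>n. onorm (\<lambda>u. si (s n) u - A u)) \<longlonglongrightarrow> 0"
  proof (rule tendsto_sandwich[OF _ _ tendsto_const lim])
    show "\<forall>\<^sub>F n in sequentially. 0 \<le> onorm (\<lambda>u. si (s n) u - A u)"
      using R s(1) by (intro always_eventually allI onorm_pos_le bounded_linear_sub bounded_op_bl si_bop) auto
    show "\<forall>\<^sub>F n in sequentially. onorm (\<lambda>u. si (s n) u - A u) \<le> 1 / real (Suc n)"
      using s(3) by (intro always_eventually allI onorm_bound) auto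
  qed
  ultimately show "is_int \<phi> A" unfolding has_bounded_qint_def using R s(1) by blast
qed

lemma intD:
  assumes "is_int \<phi> A" "e > 0"
  obtains s where "simple s" "\<And>x. x \<in> HP \<Longrightarrow> norm (s x - \<phi> x) \<le> e" "\<And>u. norm (si s u - A u) \<le> e * norm u"
proof -
  obtain s where "simple s \<and> (\<forall>x\<in>HP. norm (s x - \<phi> x) \<le> e) \<and> (\<forall>u. norm (si s u - A u) \<le> e * norm u)"
    using conjunct2[OF assms(1)[unfolded int_iff], rule_format, OF assms(2)] ..
  then show ?thesis by (intro that[of s]) auto
qed

lemma int_bop: "is_int \<phi> A \<Longrightarrow> bounded_op A"
  by (simp add: has_bounded_qint_def)

lemma int_simple: "simple s \<Longrightarrow> is_int s (si s)"
  unfolding int_iff by (intro conjI si_bop allI impI exI[of _ s]) auto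

lemma int_cong: "is_int \<phi> A \<Longrightarrow> (\<And>x. x \<in> HP \<Longrightarrow> \<phi> x = \<psi> x) \<Longrightarrow> is_int \<psi> A"
  unfolding int_iff by simp

lemma int_bounded:
  assumes "is_int \<phi> A"
  obtains c where "c > 0" "\<And>x. x \<in> HP \<Longrightarrow> norm (\<phi> x) \<le> c"
proof -
  obtain s where s: "simple s" "\<And>x. x \<in> HP \<Longrightarrow> norm (s x - \<phi> x) \<le> 1"
    using intD[OF assms zero_less_one] by metis
  have "finite (s ` HP)" by (rule simple_finite[OF s(1)])
  then obtain m where m: "\<And>y. y \<in> s ` HP \<Longrightarrow> norm y \<le> m"
    using finite_imp_bounded[of "s ` HP"] by (auto simp: bounded_iff)
  have "norm (\<phi> x) \<le> \<bar>m\<bar> + 1" if "x \<in> HP" for x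
    using s(2)[OF that] m[of "s x"] that norm_triangle_sub[of "\<phi> x" "s x"]
    by (simp add: norm_minus_commute)
  then show ?thesis by (intro that[of "\<bar>m\<bar> + 1"]) auto
qed

lemma int_norm:
  assumes A: "is_int \<phi> A" and c: "\<And>x. x \<in> HP \<Longrightarrow> norm (\<phi> x) \<le> c"
  shows "norm (A u) \<le> c * norm u"
proof (rule field_le_epsilon)
  fix e :: real assume e: "e > 0"
  define d where "d = e / (2 * (norm u + 1))"
  have nu: "norm u + 1 > 0" by (smt (verit) norm_ge_zero)
  then have d: "d > 0" using e by (simp add: d_def)
  obtain s where s: "simple s" "\<And>x. x \<in> HP \<Longrightarrow> norm (s x - \<phi> x) \<le> d" "\<And>u. norm (si s u - A u) \<le> d * norm u"
    using intD[OF A d] by metis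
  have "norm (s x) \<le> c + d" if "x \<in> HP" for x
    using s(2)[OF that] c[OF that] norm_triangle_sub[of "s x" "\<phi> x"] by simp
  then have "norm (si s u) \<le> (c + d) * norm u" by (rule si_norm[OF s(1)])
  then have "norm (A u) \<le> (c + d) * norm u + d * norm u"
    using s(3)[of u] norm_triangle_sub[of "A u" "si s u"] by (simp add: norm_minus_commute)
  also have "\<dots> = c * norm u + 2 * d * norm u" by (simp add: algebra_simps)
  also have "2 * d * norm u \<le> e" using e nu by (simp add: d_def field_simps)
  finally show "norm (A u) \<le> c * norm u + e" by simp
qed

lemma int_diff:
  assumes A: "is_int \<phi> A" and B: "is_int \<psi> B"
  shows "is_int (\<lambda>x. \<phi> x - \<psi> x) (\<lambda>u. A u - B u)"
  unfolding int_iff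
proof (intro conjI allI impI)
  show "bounded_op (\<lambda>u. A u - B u)" by (intro bounded_op_diff int_bop[OF A] int_bop[OF B])
  fix e :: real assume "e > 0"
  then have e: "e / 2 > 0" by simp
  obtain s where s: "simple s" "\<And>x. x \<in> HP \<Longrightarrow> norm (s x - \<phi> x) \<le> e/2" "\<And>u. norm (si s u - A u) \<le> e/2 * norm u"
    using intD[OF A e] by metis
  obtain t where t: "simple t" "\<And>x. x \<in> HP \<Longrightarrow> norm (t x - \<psi> x) \<le> e/2" "\<And>u. norm (si t u - B u) \<le> e/2 * norm u"
    using intD[OF B e] by metis
  show "\<exists>s. simple s \<and> (\<forall>x\<in>HP. norm (s x - (\<phi> x - \<psi> x)) \<le> e) \<and> (\<forall>u. norm (si s u - (A u - B u)) \<le> e * norm u)"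
  proof (intro exI conjI ballI allI)
    show "simple (\<lambda>x. s x - t x)" by (rule simple_function_compose2[OF s(1) t(1)])
    fix x assume x: "x \<in> HP"
    have "s x - t x - (\<phi> x - \<psi> x) = (s x - \<phi> x) - (t x - \<psi> x)" by simp
    then have "norm (s x - t x - (\<phi> x - \<psi> x)) \<le> norm (s x - \<phi> x) + norm (t x - \<psi> x)"
      using norm_triangle_ineq4[of "s x - \<phi> x" "t x - \<psi> x"] by metis
    then show "norm (s x - t x - (\<phi> x - \<psi> x)) \<le> e" using s(2)[OF x] t(2)[OF x] by simp
  next
    fix u
    have "si (\<lambda>x. s x - t x) u - (A u - B u) = (si s u - A u) - (si t u - B u)"
      using si_diff[OF s(1) t(1)] by simp
    then have "norm (si (\<lambda>x. s x - t x) u - (A u - B u)) \<le> norm (si s u - A u) + norm (si t u - B u)"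
      using norm_triangle_ineq4[of "si s u - A u" "si t u - B u"] by metis
    then show "norm (si (\<lambda>x. s x - t x) u - (A u - B u)) \<le> e * norm u"
      using s(3)[of u] t(3)[of u] by (simp add: field_simps)
  qed
qed

lemma int_unique:
  assumes "is_int \<phi> A" "is_int \<phi> B"
  shows "A = B"
proof
  fix u
  have "norm (A u - B u) \<le> 0 * norm u" by (rule int_norm[OF int_diff[OF assms]]) simp
  then show "A u = B u" by simp
qed

text \<open>Quaternionic values do not commute, but \<open>L\<close> is multiplicative in the same
  order and commutes with \<open>P\<close>. The estimate splits the error as
  \<open>(s - \<phi>) t + \<phi> (t - \<psi>)\<close>, on functions and on operators alike.\<close>

lemma int_mult:
  assumes A: "is_int \<phi> A" and B: "is_int \<psi> B"
  shows "is_int (\<lambda>x. \<phi> x * \<psi> x) (\<lambda>u. A (B u))"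
  unfolding int_iff
proof (intro conjI allI impI)
  interpret A: bounded_linear A by (rule bounded_op_bl[OF int_bop[OF A]])
  show "bounded_op (\<lambda>u. A (B u))" by (rule bounded_op_comp[OF int_bop[OF A] int_bop[OF B]])
  obtain a where a: "a > 0" "\<And>x. x \<in> HP \<Longrightarrow> norm (\<phi> x) \<le> a" using int_bounded[OF A] by metis
  obtain b where b: "b > 0" "\<And>x. x \<in> HP \<Longrightarrow> norm (\<psi> x) \<le> b" using int_bounded[OF B] by metis
  fix e :: real assume e: "e > 0"
  \<comment> \<open>Chosen so that \<open>d * (b + d) + a * d \<le> e\<close>, where
    \<open>b + d\<close> bounds the approximation \<open>t\<close> of \<open>\<psi>\<close>;
    \<open>d \<le> 1\<close> tames the quadratic term.\<close>
  define d where "d = min 1 (e / (a + b + 1))"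
  have ab: "a + b + 1 > 0" using a(1) b(1) by simp
  have "d \<le> e / (a + b + 1)" by (simp add: d_def)
  then have "d * (a + b + 1) \<le> e" using ab by (simp only: pos_le_divide_eq)
  moreover have "d > 0" "d \<le> 1" using ab e by (simp_all add: d_def)
  ultimately have d: "d > 0" "d \<le> 1" "d * (a + b + 1) \<le> e" by blast+
  have "d * (a + b + d) \<le> d * (a + b + 1)" using d by (intro mult_left_mono) auto
  then have de: "d * (b + d) + a * d \<le> e" using d(3) by (simp add: algebra_simps)
  obtain s where s: "simple s" "\<And>x. x \<in> HP \<Longrightarrow> norm (s x - \<phi> x) \<le> d" "\<And>u. norm (si s u - A u) \<le> d * norm u"
    using intD[OF A d(1)] by metis
  obtain t where t: "simple t" "\<And>x. x \<in> HP \<Longrightarrow> norm (t x - \<psi> x) \<le> d" "\<And>u. norm (si t u - B u) \<le> d * norm u"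
    using intD[OF B d(1)] by metis
  have tb: "norm (t x) \<le> b + d" if "x \<in> HP" for x
    using t(2)[OF that] b(2)[OF that] norm_triangle_sub[of "t x" "\<psi> x"] by simp
  show "\<exists>s. simple s \<and> (\<forall>x\<in>HP. norm (s x - (\<phi> x * \<psi> x)) \<le> e) \<and> (\<forall>u. norm (si s u - A (B u)) \<le> e * norm u)"
  proof (intro exI conjI ballI allI)
    show "simple (\<lambda>x. s x * t x)" by (rule simple_function_compose2[OF s(1) t(1)])
    fix x assume x: "x \<in> HP"
    have "s x * t x - \<phi> x * \<psi> x = (s x - \<phi> x) * t x + \<phi> x * (t x - \<psi> x)"
      by (simp add: left_diff_distrib right_diff_distrib)
    then have "norm (s x * t x - \<phi> x * \<psi> x) \<le> norm (s x - \<phi> x) * norm (t x) + norm (\<phi> x) * norm (t x - \<psi> x)"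
      by (metis norm_mult norm_triangle_ineq)
    also have "\<dots> \<le> d * (b + d) + a * d"
      using s(2)[OF x] tb[OF x] a t(2)[OF x] d(1) x by (intro add_mono mult_mono) auto
    finally show "norm (s x * t x - \<phi> x * \<psi> x) \<le> e" using de by simp
  next
    fix u
    have "si (\<lambda>x. s x * t x) u - A (B u) = (si s (si t u) - A (si t u)) + A (si t u - B u)"
      using si_mult[OF s(1) t(1)] by (simp add: A.diff)
    then have "norm (si (\<lambda>x. s x * t x) u - A (B u)) \<le> norm (si s (si t u) - A (si t u)) + norm (A (si t u - B u))"
      by (metis norm_triangle_ineq)
    also have "\<dots> \<le> d * norm (si t u) + a * norm (si t u - B u)"
      by (intro add_mono s(3) int_norm[OF A a(2)])
    also have "\<dots> \<le> d * ((b + d) * norm u) + a * (d * norm u)"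
      using d(1) a(1) by (intro add_mono mult_left_mono si_norm[OF t(1) tb] t(3)) auto
    also have "\<dots> = (d * (b + d) + a * d) * norm u" by (simp add: algebra_simps)
    also have "\<dots> \<le> e * norm u" using de by (intro mult_right_mono) auto
    finally show "norm (si (\<lambda>x. s x * t x) u - A (B u)) \<le> e * norm u" .
  qed
qed

lemma int_indicator: "E \<in> HB \<Longrightarrow> is_int (\<lambda>x. if x \<in> E then q else 0) (\<lambda>u. L q (P E u))"
proof -
  assume E: "E \<in> HB"
  have "si (\<lambda>x. if x \<in> E then q else 0) = (\<lambda>u. L q (P E u))" using si_indicator(1)[OF E] by blast
  then show ?thesis using int_simple[OF si_indicator(2)[OF E, of q]] by simp
qed

lemma int_const: "is_int (\<lambda>x. q) (L q)"
  using int_indicator[OF HP_HB, of q] by (auto intro: int_cong)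

lemma int_P: "E \<in> HB \<Longrightarrow> is_int (\<lambda>x. if x \<in> E then 1 else 0) (P E)"
  using int_indicator[of E 1] by (simp add: L_one)

lemma int_restrict:
  assumes "is_int \<phi> A" "E \<in> HB"
  shows "is_int (\<lambda>x. if x \<in> E then \<phi> x else 0) (\<lambda>u. A (P E u))"
  by (rule int_cong[OF int_mult[OF assms(1) int_P[OF assms(2)]]]) simp

lemma int_restrict_left:
  assumes "is_int \<phi> A" "E \<in> HB"
  shows "is_int (\<lambda>x. if x \<in> E then \<phi> x else 0) (\<lambda>u. P E (A u))"
  by (rule int_cong[OF int_mult[OF int_P[OF assms(2)] assms(1)]]) simp

lemma int_P_commute:
  assumes "is_int \<phi> A" "E \<in> HB"
  shows "P E (A u) = A (P E u)"
  using int_unique[OF int_restrict[OF assms] int_restrict_left[OF assms]] by (simp add: fun_eq_iff)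

lemma int_uminus: "is_int \<phi> A \<Longrightarrow> is_int (\<lambda>x. - \<phi> x) (\<lambda>u. - A u)"
  using int_diff[OF int_const[of 0]] by (simp add: L_zero)

lemma int_add: "is_int \<phi> A \<Longrightarrow> is_int \<psi> B \<Longrightarrow> is_int (\<lambda>x. \<phi> x + \<psi> x) (\<lambda>u. A u + B u)"
  using int_diff[OF _ int_uminus] by fastforce

lemma int_scaleR: "is_int \<phi> A \<Longrightarrow> is_int (\<lambda>x. of_real r * \<phi> x) (\<lambda>u. r *\<^sub>R A u)"
  using int_mult[OF int_const[of "of_real r"]] by (simp add: L_of_real)

lemma int_cnj:
  assumes A: "is_int \<phi> A"
  shows "is_int (\<lambda>x. qcnj (\<phi> x)) (adj A)"
  unfolding int_iff
proof (intro conjI allI impI)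
  note bA = int_bop[OF A]
  show "bounded_op (adj A)" by (rule adj_properties(1)[OF bA])
  fix e :: real assume e: "e > 0"
  obtain s where s: "simple s" "\<And>x. x \<in> HP \<Longrightarrow> norm (s x - \<phi> x) \<le> e" "\<And>u. norm (si s u - A u) \<le> e * norm u"
    using intD[OF A e] by metis
  show "\<exists>s. simple s \<and> (\<forall>x\<in>HP. norm (s x - qcnj (\<phi> x)) \<le> e) \<and> (\<forall>u. norm (si s u - adj A u) \<le> e * norm u)"
  proof (intro exI conjI ballI allI)
    show "simple (\<lambda>x. qcnj (s x))" by (rule simple_function_compose1[OF s(1)])
    fix x assume x: "x \<in> HP"
    show "norm (qcnj (s x) - qcnj (\<phi> x)) \<le> e"
      using s(2)[OF x] norm_qcnj[of "s x - \<phi> x"] by simp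
  next
    fix u
    let ?w = "si (\<lambda>x. qcnj (s x)) u - adj A u"
    \<comment> \<open>Testing against \<open>?w\<close> itself transfers the bound on
      \<open>si s - A\<close> to the difference of the adjoints.\<close>
    have "(norm ?w)\<^sup>2 = inner (si s ?w - A ?w) u"
      using si_cnj[OF s(1), of ?w u] adj_properties(2)[OF bA, of u ?w]
      by (simp add: power2_norm_eq_inner inner_diff_left inner_diff_right inner_commute)
    also have "\<dots> \<le> norm (si s ?w - A ?w) * norm u" by (rule norm_cauchy_schwarz)
    also have "\<dots> \<le> (e * norm ?w) * norm u" by (intro mult_right_mono s(3)) simp
    finally have "norm ?w * norm ?w \<le> (e * norm u) * norm ?w" by (simp add: power2_eq_square ac_simps)
    then show "norm ?w \<le> e * norm u" using e by (cases "norm ?w = 0") auto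
  qed
qed

end

subsection \<open>Existence of integrals\<close>

text \<open>Rounds each coordinate down to a multiple of \<open>1 / n\<close>. Real quaternions stay
  real, so for real integrands the approximations are blind to the left multiplication.\<close>

definition qgrid :: "nat \<Rightarrow> quat \<Rightarrow> quat" where
  "qgrid n q = (\<Sum>b\<in>Basis. (real_of_int \<lfloor>real n * inner q b\<rfloor> / real n) *\<^sub>R b)"

lemma qgrid_dist:
  assumes n: "n > 0"
  shows "norm (qgrid n q - q) \<le> real DIM(quat) / real n"
proof -
  have "\<bar>inner (qgrid n q - q) b\<bar> \<le> 1 / real n" if b: "b \<in> Basis" for b
  proof -
    have "inner (qgrid n q - q) b = (real_of_int \<lfloor>real n * inner q b\<rfloor> - real n * inner q b) / real n"
      using b n by (simp add: qgrid_def inner_diff_left field_simps)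
    moreover have "\<bar>real_of_int \<lfloor>real n * inner q b\<rfloor> - real n * inner q b\<bar> \<le> 1" by linarith
    ultimately show ?thesis by (simp add: divide_right_mono)
  qed
  then have "(\<Sum>b\<in>Basis. \<bar>inner (qgrid n q - q) b\<bar>) \<le> (\<Sum>b\<in>(Basis::quat set). 1 / real n)"
    by (intro sum_mono)
  then show ?thesis using norm_le_l1[of "qgrid n q - q"] by simp
qed

lemma qgrid_of_real: "qgrid n (of_real r) = of_real (real_of_int \<lfloor>real n * r\<rfloor> / real n)"
  by (simp add: qgrid_def Basis_quat_def inner_quat_def quat_eq_iff del: of_real_divide of_real_of_int_eq)

lemma qgrid_measurable [measurable]: "qgrid n \<in> borel_measurable borel"
  unfolding qgrid_def by measurable

lemma finite_qgrid_image:
  assumes "bounded S"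
  shows "finite (qgrid n ` S)"
proof -
  obtain c where c: "\<And>q. q \<in> S \<Longrightarrow> norm q \<le> c" using assms by (auto simp: bounded_iff)
  let ?m = "\<lceil>real n * c\<rceil> + 1"
  let ?F = "Basis \<rightarrow>\<^sub>E {- ?m..?m}"
  let ?h = "\<lambda>k. \<Sum>b\<in>(Basis::quat set). (real_of_int (k b) / real n) *\<^sub>R b"
  have "qgrid n q \<in> ?h ` ?F" if q: "q \<in> S" for q
  proof
    let ?k = "restrict (\<lambda>b. \<lfloor>real n * inner q b\<rfloor>) Basis"
    show "qgrid n q = ?h ?k" by (simp add: qgrid_def)
    have "\<bar>real n * inner q b\<bar> \<le> real n * c" if "b \<in> Basis" for b
      using Basis_le_norm[OF that, of q] c[OF q] by (simp add: abs_mult mult_left_mono)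
    then show "?k \<in> ?F" by (intro restrict_PiE_iff[THEN iffD2] ballI) (smt (verit) atLeastAtMost_iff ceiling_correct floor_correct of_int_less_iff le_floor_iff of_int_minus of_int_add of_int_1)
  qed
  then have sub: "qgrid n ` S \<subseteq> ?h ` ?F" by blast
  have "finite ?F" by (intro finite_PiE) auto
  then show ?thesis by (rule finite_subset[OF sub finite_imageI])
qed

context iqpvm
begin

lemma simple_qgrid:
  assumes "\<phi> \<in> borel_measurable (half_plane_borel \<iota>)" "bounded (\<phi> ` HP)"
  shows "simple (\<lambda>x. qgrid n (\<phi> x))"
proof (rule simple_function_borel_measurable)
  show "(\<lambda>x. qgrid n (\<phi> x)) \<in> borel_measurable (half_plane_borel \<iota>)"
    using measurable_compose[OF assms(1) qgrid_measurable] .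
  show "finite ((\<lambda>x. qgrid n (\<phi> x)) ` space (half_plane_borel \<iota>))"
    using finite_qgrid_image[OF assms(2), of n] by (simp add: image_image)
qed

text \<open>The integrals of the rounded functions are Cauchy at the rate of the grid; the pointwise
  limit inherits this rate and is therefore a limit in norm.\<close>

lemma int_exists:
  assumes "\<phi> \<in> borel_measurable (half_plane_borel \<iota>)" "bounded (\<phi> ` HP)"
  obtains A where "is_int \<phi> A"
proof -
  let ?c = "real DIM(quat)"
  define s where "s n x = qgrid (Suc n) (\<phi> x)" for n x
  have s: "simple (s n)" for n
    using simple_qgrid[OF assms, of "Suc n"] by (simp add: s_def[abs_def])
  have sd: "norm (s n x - \<phi> x) \<le> ?c / Suc n" for n x
    unfolding s_def by (rule qgrid_dist) simp
  have bl: "bounded_linear (si (s n))" for n by (rule bounded_op_bl[OF si_bop[OF s]])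
  have d: "norm (si (s n) u - si (s m) u) \<le> (?c / Suc n + ?c / Suc m) * norm u" for n m u
  proof -
    have "norm (s n x - s m x) \<le> ?c / Suc n + ?c / Suc m" for x
      using norm_triangle_ineq4[of "s n x - \<phi> x" "s m x - \<phi> x"] sd[of n x] sd[of m x] by simp
    then have "norm (si (\<lambda>x. s n x - s m x) u) \<le> (?c / Suc n + ?c / Suc m) * norm u"
      by (intro si_norm simple_function_compose2[OF s s])
    then show ?thesis by (simp add: si_diff[OF s s])
  qed
  have lim: "(\<lambda>n. ?c / Suc n) \<longlonglongrightarrow> 0"
    using tendsto_mult[OF tendsto_const LIMSEQ_Suc[OF lim_1_over_n], of ?c] by simp
  have conv: "convergent (\<lambda>n. si (s n) u)" for u
  proof (rule Cauchy_convergent, rule metric_CauchyI)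
    fix e :: real assume e: "e > 0"
    have "(\<lambda>n. (?c / Suc n + ?c / Suc n) * norm u) \<longlonglongrightarrow> (0 + 0) * norm u"
      by (intro tendsto_intros lim)
    then have "\<forall>\<^sub>F n in sequentially. (?c / Suc n + ?c / Suc n) * norm u < e"
      using e by (intro order_tendstoD) auto
    then obtain N where N: "(?c / Suc N + ?c / Suc N) * norm u < e" by (auto simp: eventually_sequentially)
    have "dist (si (s m) u) (si (s n) u) < e" if "m \<ge> N" "n \<ge> N" for m n
    proof -
      have "?c / Suc m \<le> ?c / Suc N" "?c / Suc n \<le> ?c / Suc N"
        using that by (auto intro!: divide_left_mono)
      then have "(?c / Suc m + ?c / Suc n) * norm u \<le> (?c / Suc N + ?c / Suc N) * norm u"
        by (intro mult_right_mono add_mono) auto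
      then show ?thesis using d[of m u n] N by (simp add: dist_norm)
    qed
    then show "\<exists>M. \<forall>m\<ge>M. \<forall>n\<ge>M. dist (si (s m) u) (si (s n) u) < e" by blast
  qed
  then obtain A where A: "\<And>u. (\<lambda>n. si (s n) u) \<longlonglongrightarrow> A u" unfolding convergent_def by metis
  have dA: "norm (si (s n) u - A u) \<le> (?c / Suc n) * norm u" for n u
  proof (rule LIMSEQ_le)
    show "(\<lambda>m. norm (si (s n) u - si (s m) u)) \<longlonglongrightarrow> norm (si (s n) u - A u)" by (intro tendsto_intros A)
    have "(\<lambda>m. (?c / Suc n + ?c / Suc m) * norm u) \<longlonglongrightarrow> (?c / Suc n + 0) * norm u"
      by (intro tendsto_intros lim)
    then show "(\<lambda>m. (?c / Suc n + ?c / Suc m) * norm u) \<longlonglongrightarrow> (?c / Suc n) * norm u" by simp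
    show "\<exists>N. \<forall>m\<ge>N. norm (si (s n) u - si (s m) u) \<le> (?c / Suc n + ?c / Suc m) * norm u"
      using d by blast
  qed
  obtain k where k: "\<And>u. norm (si (s 0) u) \<le> norm u * k"
    using bounded_linear.bounded[OF bl] by blast
  have "bounded_op A"
  proof (rule bounded_opI)
    show "bounded_linear A"
    proof (rule bounded_linear_of_norm_le[where c = "k + ?c"])
      fix u v and r :: real
      have "(\<lambda>n. si (s n) (u + v)) \<longlonglongrightarrow> A u + A v"
        by (simp add: linear_add[OF bounded_linear.linear[OF bl]], intro tendsto_intros A)
      then show "A (u + v) = A u + A v" using A LIMSEQ_unique by blast
      have "(\<lambda>n. si (s n) (r *\<^sub>R u)) \<longlonglongrightarrow> r *\<^sub>R A u"
        by (simp add: linear_scale[OF bounded_linear.linear[OF bl]], intro tendsto_intros A)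
      then show "A (r *\<^sub>R u) = r *\<^sub>R A u" using A LIMSEQ_unique by blast
      show "norm (A u) \<le> (k + ?c) * norm u"
        using dA[of 0 u] k[of u] norm_triangle_sub[of "A u" "si (s 0) u"]
        by (simp add: norm_minus_commute algebra_simps)
    qed
    fix u q
    have "(\<lambda>n. si (s n) (u *\<^sub>H q)) \<longlonglongrightarrow> A u *\<^sub>H q"
      by (simp add: bounded_op_qscale[OF si_bop[OF s]], intro bounded_linear.tendsto[OF bounded_linear_qscale] A)
    then show "A (u *\<^sub>H q) = A u *\<^sub>H q" using A LIMSEQ_unique by blast
  qed
  moreover have "\<exists>t. simple t \<and> (\<forall>x\<in>HP. norm (t x - \<phi> x) \<le> e) \<and> (\<forall>u. norm (si t u - A u) \<le> e * norm u)"
    if e: "e > 0" for e :: real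
  proof -
    obtain n where n: "?c / Suc n < e"
      using order_tendstoD(2)[OF lim e] by (auto simp: eventually_sequentially)
    have "norm (si (s n) u - A u) \<le> e * norm u" for u
      using dA[of n u] n by (meson less_imp_le mult_right_mono norm_ge_zero order_trans)
    moreover have "norm (s n x - \<phi> x) \<le> e" for x using sd[of n x] n by linarith
    ultimately show ?thesis using s by blast
  qed
  ultimately have "is_int \<phi> A" unfolding int_iff by blast
  then show ?thesis by (rule that)
qed

lemma int_approx:
  assumes "is_int \<phi> A" "simple s" "\<And>x. x \<in> HP \<Longrightarrow> norm (s x - \<phi> x) \<le> e"
  shows "norm (si s u - A u) \<le> e * norm u"
  by (rule int_norm[OF int_diff[OF int_simple[OF assms(2)] assms(1)] assms(3)])

text \<open>Multiplying by \<open>P supp\<close>, the identity, discards all values off the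
  support.\<close>

lemma int_supp_cong:
  assumes A: "is_int \<phi> A" and B: "is_int \<psi> B" and eq: "\<And>x. x \<in> supp \<Longrightarrow> \<phi> x = \<psi> x"
  shows "A = B"
proof
  fix u
  have "is_int (\<lambda>x. if x \<in> supp then \<psi> x else 0) (\<lambda>u. A (P supp u))"
    by (rule int_cong[OF int_restrict[OF A supp_HB]]) (simp add: eq)
  then have "A (P supp u) = B (P supp u)"
    using int_unique[OF _ int_restrict[OF B supp_HB]] by metis
  then show "A u = B u" by (simp add: P_supp)
qed

lemma int_norm_on:
  assumes A: "is_int \<phi> A" and E: "E \<in> HB" and c: "c \<ge> 0" "\<And>x. x \<in> E \<Longrightarrow> norm (\<phi> x) \<le> c"
  shows "norm (A (P E u)) \<le> c * norm (P E u)"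
proof -
  have "norm (A (P E (P E u))) \<le> c * norm (P E u)"
    by (rule int_norm[OF int_restrict[OF A E]]) (use c in auto)
  then show ?thesis by (simp add: is_proj_idem[OF P_proj[OF E]])
qed

lemma P_supp_cong:
  assumes "E \<in> HB" "E' \<in> HB" "E \<inter> supp = E' \<inter> supp"
  shows "P E u = P E' u"
  using P_Int[OF assms(1) supp_HB, of u] P_Int[OF assms(2) supp_HB, of u] assms(3) by (simp add: P_supp)

lemma measurable_on_HP:
  assumes "S \<in> HB" "\<phi> \<in> borel_measurable borel"
  shows "(\<lambda>x. if x \<in> S then \<phi> x else 0) \<in> borel_measurable (half_plane_borel \<iota>)"
proof -
  have "S \<in> sets borel" using assms(1) by (simp add: sets_half_plane_borel[OF iota])
  then show ?thesis
    using assms(2) by (intro measurable_restrict_space1 measurable_If_set) auto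
qed

abbreviation "on_supp \<equiv> (\<lambda>x. if x \<in> supp then x else 0)"

text \<open>Justifies the definite description in \<open>qint\<close>: boundedness of the support
  gives existence, and \<open>int_unique\<close> uniqueness.\<close>

lemma qint_iff:
  assumes "bounded supp"
  shows "T = qint \<iota> P L (\<lambda>x. x) \<longleftrightarrow> is_int on_supp T"
proof -
  have "on_supp ` HP \<subseteq> insert 0 supp" by auto
  then have "bounded (on_supp ` HP)" using assms bounded_subset bounded_insert by metis
  then obtain A where A: "is_int on_supp A"
    using int_exists[OF measurable_on_HP[OF supp_HB, of "\<lambda>x. x"]] by auto
  have "qint \<iota> P L (\<lambda>x. x) = A"
    unfolding qint_def by (rule the_equality[where P = "is_int on_supp"]) (use A int_unique in blast)+
  then show ?thesis using A int_unique by blast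
qed

lemma int_real_selfadj:
  assumes "is_int (\<lambda>x. of_real (f x)) F"
  shows "selfadj F"
proof -
  have "is_int (\<lambda>x. of_real (f x)) (adj F)" using int_cnj[OF assms] by simp
  then have "adj F = F" using assms int_unique by blast
  then show ?thesis
    using adj_properties(2)[OF int_bop[OF assms]] bounded_op_bl[OF int_bop[OF assms]]
    by (intro selfadjI) auto
qed

text \<open>\<open>F\<close> is the square of the self-adjoint integral of
  \<open>sqrt (f x)\<close>.\<close>

lemma int_real_nonneg:
  assumes F: "is_int (\<lambda>x. of_real (f x)) F" and f: "f \<in> borel_measurable (half_plane_borel \<iota>)"
    and ge: "\<And>x. x \<in> HP \<Longrightarrow> f x \<ge> 0"
  shows "inner u (F u) \<ge> 0"
proof -
  obtain c where c: "c > 0" "\<And>x. x \<in> HP \<Longrightarrow> norm (of_real (f x) :: quat) \<le> c"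
    by (rule int_bounded[OF F]) blast
  have "bounded ((\<lambda>x. of_real (sqrt (f x)) :: quat) ` HP)"
    unfolding bounded_iff
  proof (intro exI ballI)
    fix y assume "y \<in> (\<lambda>x. of_real (sqrt (f x)) :: quat) ` HP"
    then obtain x where x: "x \<in> HP" "y = of_real (sqrt (f x))" by blast
    then show "norm y \<le> sqrt c" using c(2)[OF x(1)] ge[OF x(1)] by simp
  qed
  moreover have "(\<lambda>x. of_real (sqrt (f x)) :: quat) \<in> borel_measurable (half_plane_borel \<iota>)"
    using f by measurable
  ultimately obtain G where G: "is_int (\<lambda>x. of_real (sqrt (f x))) G" using int_exists by blast
  have "is_int (\<lambda>x. of_real (f x)) (\<lambda>u. G (G u))"
    by (rule int_cong[OF int_mult[OF G G]]) (simp add: ge of_real_mult[symmetric] del: of_real_mult)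
  then have "F u = G (G u)" using int_unique[OF F] by metis
  then show ?thesis using selfadj_inner[OF int_real_selfadj[OF G], of u "G u"]
    by (metis inner_ge_zero)
qed

end

text \<open>Rounding a real function gives real values, on which every left multiplication is the
  scalar action; hence the approximating integrals for \<open>L\<close> and \<open>L'\<close>
  coincide.\<close>

lemma int_real_indep:
  assumes 1: "iqpvm \<iota> P L" and 2: "iqpvm \<iota> P L'"
    and F: "has_bounded_qint \<iota> P L (\<lambda>x. of_real (f x)) F"
    and f: "f \<in> borel_measurable (half_plane_borel \<iota>)"
  shows "has_bounded_qint \<iota> P L' (\<lambda>x. of_real (f x)) F"
proof -
  interpret A: iqpvm \<iota> P L by fact
  interpret B: iqpvm \<iota> P L' by fact
  let ?\<phi> = "\<lambda>x. of_real (f x) :: quat"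
  let ?c = "real DIM(quat)"
  have m: "?\<phi> \<in> borel_measurable (half_plane_borel \<iota>)" using f by measurable
  obtain c where c: "c > 0" "\<And>x. x \<in> A.HP \<Longrightarrow> norm (?\<phi> x) \<le> c" by (rule A.int_bounded[OF F]) blast
  have b: "bounded (?\<phi> ` A.HP)" unfolding bounded_iff using c by blast
  obtain G where G: "B.is_int ?\<phi> G" by (rule B.int_exists[OF m b])
  have "F u = G u" for u
  proof -
    have n: "norm (F u - G u) \<le> 2 * (?c / real (Suc n)) * norm u" for n
    proof -
      let ?s = "\<lambda>x. qgrid (Suc n) (?\<phi> x)"
      have s: "A.simple ?s" by (rule A.simple_qgrid[OF m b])
      have d: "norm (?s x - ?\<phi> x) \<le> ?c / real (Suc n)" for x by (rule qgrid_dist) simp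
      have "A.si ?s u = B.si ?s u"
      proof -
        have "L y (P E u) = L' y (P E u)" if y: "y \<in> ?s ` A.HP" for y E
        proof -
          obtain x where "y = ?s x" using y by blast
          then show ?thesis by (simp only: qgrid_of_real A.L_of_real B.L_of_real)
        qed
        then show ?thesis unfolding simple_qint_def by (intro sum.cong refl)
      qed
      then have "F u - G u = (B.si ?s u - G u) - (A.si ?s u - F u)" by simp
      then have "norm (F u - G u) \<le> norm (B.si ?s u - G u) + norm (A.si ?s u - F u)"
        by (metis norm_triangle_ineq4)
      also have "\<dots> \<le> ?c / real (Suc n) * norm u + ?c / real (Suc n) * norm u"
        by (intro add_mono A.int_approx[OF F s d] B.int_approx[OF G s d])
      also have "\<dots> = 2 * (?c / real (Suc n)) * norm u" by (simp only: mult_2 distrib_right)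
      finally show ?thesis .
    qed
    have "(\<lambda>n. 2 * (?c * (1 / real (Suc n))) * norm u) \<longlonglongrightarrow> 2 * (?c * 0) * norm u"
      by (intro tendsto_intros LIMSEQ_Suc[OF lim_1_over_n])
    then have "norm (F u - G u) \<le> 2 * (?c * 0) * norm u"
      by (rule LIMSEQ_le[OF tendsto_const]) (use n in auto)
    then show ?thesis by simp
  qed
  then have "F = G" by blast
  with G show ?thesis by simp
qed

subsection \<open>Elements of the half plane\<close>

lemma half_plane_commute:
  assumes "\<iota> \<in> imag_units" "x \<in> half_plane \<iota>"
  shows "\<iota> * x = x * \<iota>"
proof -
  obtain a b where x: "x = of_real a + \<iota> * of_real b" using assms(2) by (auto simp: half_plane_def)
  show ?thesis by (simp add: x distrib_left distrib_right quat_of_real_commute mult.assoc)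
qed

lemma half_plane_cnj:
  assumes i: "\<iota> \<in> imag_units" and x: "x \<in> half_plane \<iota>"
  shows "x + qcnj x = of_real (2 * qRe x)" "x - qcnj x = \<iota> * of_real (2 * inner \<iota> x)"
proof -
  show "x + qcnj x = of_real (2 * qRe x)" by (simp add: quat_eq_iff del: of_real_mult)
  define b where "b = inner \<iota> x"
  have xb: "x = of_real (qRe x) + \<iota> * of_real b" using half_plane_iff[OF i] x b_def by blast
  have "qcnj (of_real (qRe x) + \<iota> * of_real b) = of_real (qRe x) - \<iota> * of_real b"
    by (simp add: imag_units_cnj[OF i] quat_of_real_commute)
  then have c: "qcnj x = of_real (qRe x) - \<iota> * of_real b" using xb by metis
  have "x - qcnj x = (of_real (qRe x) + \<iota> * of_real b) - (of_real (qRe x) - \<iota> * of_real b)"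
    using xb c by metis
  also have "\<dots> = \<iota> * of_real (2 * b)"
    by (simp only: mult_2 of_real_add distrib_left) simp
  finally show "x - qcnj x = \<iota> * of_real (2 * inner \<iota> x)" by (simp add: b_def)
qed

lemma half_plane_anticommute:
  assumes i: "\<iota> \<in> imag_units" and x: "x \<in> half_plane \<iota>" and k: "\<iota> * \<kappa> = - (\<kappa> * \<iota>)"
  shows "\<kappa> * x = qcnj x * \<kappa>"
proof -
  obtain a b where x: "x = of_real a + \<iota> * of_real b" using x by (auto simp: half_plane_def)
  have k': "\<kappa> * \<iota> = - (\<iota> * \<kappa>)" using k by simp
  have "\<kappa> * x = of_real a * \<kappa> + (\<kappa> * \<iota>) * of_real b"
    by (simp add: x distrib_left quat_of_real_commute mult.assoc)
  also have "\<dots> = (of_real a - \<iota> * of_real b) * \<kappa>"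
    unfolding k' by (simp add: left_diff_distrib mult.assoc quat_of_real_commute)
  also have "of_real a - \<iota> * of_real b = qcnj x"
    by (simp add: x imag_units_cnj[OF i] quat_of_real_commute)
  finally show ?thesis .
qed

lemma norm_cplane: "\<iota> \<in> imag_units \<Longrightarrow> (norm (of_real a + \<iota> * of_real b))\<^sup>2 = a\<^sup>2 + b\<^sup>2"
proof -
  assume i: "\<iota> \<in> imag_units"
  have "(norm (of_real a + \<iota> * of_real b))\<^sup>2 = inner (of_real a) (of_real a :: quat) + inner (\<iota> * of_real b) (\<iota> * of_real b)
      + 2 * inner (of_real a) (\<iota> * of_real b)"
    by (simp add: power2_norm_eq_inner inner_add_left inner_add_right inner_commute)
  moreover have "inner (of_real a) (\<iota> * of_real b) = 0" using i by (simp add: inner_quat_def imag_units_iff)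
  ultimately show ?thesis
    using i by (simp add: power2_norm_eq_inner[symmetric] norm_mult imag_units_iff)
qed

text \<open>The expression factors as \<open>(x - q) * (x - qcnj q)\<close>, and a point of the half
  plane is at least as close to \<open>q\<close> as to its mirror image
  \<open>qcnj q\<close>.\<close>

lemma half_plane_Delta:
  assumes i: "\<iota> \<in> imag_units" and x: "x \<in> half_plane \<iota>" and q: "q \<in> half_plane \<iota>"
  shows "(norm (x - q))\<^sup>2 \<le> norm (x * x - of_real (2 * qRe q) * x + of_real ((norm q)\<^sup>2))"
    and "norm (x * x - of_real (2 * qRe q) * x + of_real ((norm q)\<^sup>2)) \<le> norm (x - q) * (norm x + norm q)"
proof -
  obtain a b where x: "x = of_real a + \<iota> * of_real b" "b \<ge> 0" using x by (auto simp: half_plane_def)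
  obtain c d where qq: "q = of_real c + \<iota> * of_real d" "d \<ge> 0" using q by (auto simp: half_plane_def)
  have cq: "qcnj q = of_real c - \<iota> * of_real d"
    by (simp add: qq imag_units_cnj[OF i] quat_of_real_commute)
  have com: "x * q = q * x"
    using half_plane_commute[OF i \<open>q \<in> half_plane \<iota>\<close>]
    by (simp add: x distrib_left distrib_right quat_of_real_commute mult.assoc)
      (metis mult.assoc quat_of_real_commute)
  have "x * x - of_real (2 * qRe q) * x + of_real ((norm q)\<^sup>2) = (x - q) * (x - qcnj q)"
  proof -
    have "of_real (2 * qRe q) * x = x * (q + qcnj q)"
      by (simp only: half_plane_cnj(1)[OF i q] quat_of_real_commute)
    then have "of_real (2 * qRe q) * x = q * x + x * qcnj q" by (simp add: distrib_left com)
    moreover have "of_real ((norm q)\<^sup>2) = q * qcnj q" by (rule qcnj_mult_self(2)[symmetric])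
    ultimately show ?thesis by (simp only: left_diff_distrib right_diff_distrib) simp
  qed
  then have n: "norm (x * x - of_real (2 * qRe q) * x + of_real ((norm q)\<^sup>2)) = norm (x - q) * norm (x - qcnj q)"
    by (simp only: norm_mult)
  have "x - q = of_real (a - c) + \<iota> * of_real (b - d)" "x - qcnj q = of_real (a - c) + \<iota> * of_real (b + d)"
    unfolding cq by (simp_all add: x(1) qq(1) algebra_simps)
  then have "(norm (x - q))\<^sup>2 = (a - c)\<^sup>2 + (b - d)\<^sup>2" "(norm (x - qcnj q))\<^sup>2 = (a - c)\<^sup>2 + (b + d)\<^sup>2"
    using norm_cplane[OF i] by metis+
  moreover have "(b - d)\<^sup>2 \<le> (b + d)\<^sup>2" using x(2) qq(2) by (simp add: power2_eq_square algebra_simps)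
  ultimately have "(norm (x - q))\<^sup>2 \<le> (norm (x - qcnj q))\<^sup>2" by linarith
  then have "norm (x - q) \<le> norm (x - qcnj q)" by (rule power2_le_imp_le) simp
  then show "(norm (x - q))\<^sup>2 \<le> norm (x * x - of_real (2 * qRe q) * x + of_real ((norm q)\<^sup>2))"
    unfolding n by (simp add: power2_eq_square mult_left_mono)
  show "norm (x * x - of_real (2 * qRe q) * x + of_real ((norm q)\<^sup>2)) \<le> norm (x - q) * (norm x + norm q)"
    unfolding n using norm_triangle_ineq4[of x "qcnj q"] by (intro mult_left_mono) auto
qed

section \<open>Spectra of normal operators\<close>

lemma Delta_alt: "bounded_op T \<Longrightarrow> Delta q T u = T (T u) - (2 * qRe q) *\<^sub>R T u + ((norm q)\<^sup>2) *\<^sub>R u"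
  by (simp only: Delta_def bounded_op_qscale scaleR_conv_qscale)

lemma Delta_bop:
  assumes T: "bounded_op T"
  shows "bounded_op (Delta q T)"
proof -
  have "Delta q T = (\<lambda>u. T (T u) - (2 * qRe q) *\<^sub>R T u + ((norm q)\<^sup>2) *\<^sub>R u)"
    using Delta_alt[OF T] by blast
  then show ?thesis
    using bounded_op_comp[OF T T] T
    by (simp only:) (intro bounded_op_add bounded_op_diff bounded_op_scaleR bounded_op_id)
qed

text \<open>\<open>Delta q T\<close> is a real polynomial in the normal operator \<open>T\<close>,
  hence normal. A vector orthogonal to its range lies in the kernel of its adjoint, and for a normal
  operator this is the kernel of the operator itself.\<close>

lemma normal_dense_range:
  assumes T: "bounded_op T" "normal_op T" and ker: "ker (Delta q T) = {0}"
  shows "closure (range (Delta q T)) = UNIV"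
proof (rule dense_subspaceI)
  let ?D = "Delta q T" and ?S = "adj T"
  note S = adj_properties[OF T(1)]
  interpret T: bounded_linear T by (rule bounded_op_bl[OF T(1)])
  interpret S: bounded_linear ?S by (rule bounded_op_bl[OF S(1)])
  have com: "T (?S u) = ?S (T u)" for u using T(2) unfolding normal_op_def by (metis comp_apply)
  interpret D: bounded_linear ?D by (rule bounded_op_bl[OF Delta_bop[OF T(1)]])
  show "subspace (range ?D)" by (rule linear_subspace_image[OF D.linear subspace_UNIV])
  fix u assume u: "\<And>x. x \<in> range ?D \<Longrightarrow> inner u x = 0"
  have D': "inner (Delta q ?S v) w = inner v (?D w)" for v w
    by (simp add: Delta_alt[OF S(1)] Delta_alt[OF T(1)] inner_add_left inner_add_right
        inner_diff_left inner_diff_right S(2))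
  have "?D (Delta q ?S v) = Delta q ?S (?D v)" for v
    by (simp add: Delta_alt[OF S(1)] Delta_alt[OF T(1)] T.add T.diff T.scaleR S.add S.diff S.scaleR com
        algebra_simps)
  then have "inner (?D u) (?D u) = inner u (?D (Delta q ?S u))"
    using D'[of "?D u" u] by (metis D' inner_commute)
  also have "\<dots> = 0" using u by simp
  finally have "u \<in> ker ?D" by (simp add: ker_def)
  then show "u = 0" using ker by simp
qed

lemma residual_spectrum_empty:
  "bounded_op T \<Longrightarrow> normal_op T \<Longrightarrow> residual_spectrum T = {}"
  using normal_dense_range by (auto simp: residual_spectrum_def)

lemma spherical_spectrum_iff:
  assumes "bounded_op T" "normal_op T"
  shows "q \<in> spherical_spectrum T \<longleftrightarrow> ker (Delta q T) \<noteq> {0} \<or> \<not> has_bounded_inverse (Delta q T)"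
  using normal_dense_range[OF assms, of q] by (auto simp: spherical_spectrum_def spherical_resolvent_def)

locale spectral_iqpvm = iqpvm +
  fixes T
  assumes T_int: "is_int on_supp T"
begin

lemma T_bop: "bounded_op T"
  by (rule int_bop[OF T_int])

lemma Delta_int:
  "is_int (\<lambda>x. on_supp x * on_supp x - of_real (2 * qRe q) * on_supp x + of_real ((norm q)\<^sup>2)) (Delta q T)"
proof -
  have "is_int (\<lambda>x. on_supp x * on_supp x - of_real (2 * qRe q) * on_supp x + of_real ((norm q)\<^sup>2) * 1)
      (\<lambda>u. T (T u) - (2 * qRe q) *\<^sub>R T u + ((norm q)\<^sup>2) *\<^sub>R L 1 u)"
    by (intro int_add int_diff int_scaleR int_mult[OF T_int T_int] T_int int_const)
  moreover have "(\<lambda>u. T (T u) - (2 * qRe q) *\<^sub>R T u + ((norm q)\<^sup>2) *\<^sub>R L 1 u) = Delta q T"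
    by (simp add: fun_eq_iff L_one Delta_alt[OF T_bop])
  ultimately show ?thesis by (simp del: of_real_mult of_real_power)
qed

abbreviation "Delta_symbol q x \<equiv> x * x - of_real (2 * qRe q) * x + of_real ((norm q)\<^sup>2)"

text \<open>On \<open>E\<close> the symbol of \<open>Delta q T\<close> has norm at least
  \<open>r\<^sup>2\<close>, so its reciprocal is bounded and \<open>G\<close> is its integral. This
  serves both the kernel of \<open>Delta q T\<close> and, with \<open>E = supp\<close>, the
  resolvent set.\<close>

lemma Delta_left_inverse:
  assumes q: "q \<in> HP" and E: "E \<in> HB" "E \<subseteq> supp" and r: "r > 0" "\<And>x. x \<in> E \<Longrightarrow> r \<le> norm (x - q)"
  obtains G where "bounded_linear G" "\<And>u. G (Delta q T u) = P E u" "\<And>u. Delta q T (G u) = P E u"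
proof -
  let ?\<psi> = "\<lambda>x. if x \<in> E then inverse (Delta_symbol q x) else 0"
  have low: "r\<^sup>2 \<le> norm (Delta_symbol q x)" if "x \<in> E" for x
  proof -
    have "r\<^sup>2 \<le> (norm (x - q))\<^sup>2" using r(1) r(2)[OF that] by (intro power_mono) auto
    also have "\<dots> \<le> norm (Delta_symbol q x)"
      using that E(2) supp_sub by (intro half_plane_Delta(1)[OF iota _ q]) auto
    finally show ?thesis .
  qed
  have "?\<psi> \<in> borel_measurable (half_plane_borel \<iota>)"
    by (rule measurable_on_HP[OF E(1)]) measurable
  moreover have "bounded (?\<psi> ` HP)"
    unfolding bounded_iff
  proof (intro exI ballI)
    fix y assume "y \<in> ?\<psi> ` HP"
    then obtain x where x: "y = ?\<psi> x" by blast
    show "norm y \<le> 1 / r\<^sup>2"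
    proof (cases "x \<in> E")
      case True
      have "inverse (norm (Delta_symbol q x)) \<le> inverse (r\<^sup>2)"
        using low[OF True] r(1) by (intro le_imp_inverse_le) auto
      then show ?thesis using True x by (simp add: norm_inverse divide_inverse del: of_real_mult of_real_power)
    qed (use x r in auto)
  qed
  ultimately obtain G where G: "is_int ?\<psi> G" using int_exists by blast
  have nz: "Delta_symbol q x \<noteq> 0" if "x \<in> E" for x using low[OF that] r(1) by (smt (verit) norm_eq_zero zero_less_power)
  have 1: "(\<lambda>u. G (Delta q T u)) = P E"
    using nz E(2) by (intro int_supp_cong[OF int_mult[OF G Delta_int] int_P[OF E(1)]]) auto
  have 2: "(\<lambda>u. Delta q T (G u)) = P E"
    using nz E(2) by (intro int_supp_cong[OF int_mult[OF Delta_int G] int_P[OF E(1)]]) auto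
  show ?thesis
    using that[OF bounded_op_bl[OF int_bop[OF G]]] 1 2 by metis
qed

lemma singleton_HB: "q \<in> HP \<Longrightarrow> {q} \<in> HB"
  by (simp add: sets_half_plane_borel[OF iota])

lemma ker_Delta:
  assumes q: "q \<in> HP"
  shows "u \<in> ker (Delta q T) \<longleftrightarrow> P {q} u = u"
proof
  assume "u \<in> ker (Delta q T)"
  then have D: "Delta q T u = 0" by (simp add: ker_def)
  \<comment> \<open>Exhausts \<open>supp - {q}\<close> by sets at positive distance from
    \<open>q\<close>; on each of them \<open>Delta q T\<close> is invertible and so kills no
    vector.\<close>
  define E where "E n = {x \<in> supp. 1 / real (Suc n) \<le> norm (x - q)}" for n
  have E: "E n \<in> HB" for n
  proof -
    have "closed {x. 1 / real (Suc n) \<le> norm (x - q)}" by (intro closed_Collect_le continuous_intros)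
    then have "closed (supp \<inter> {x. 1 / real (Suc n) \<le> norm (x - q)})" using supp_closed by blast
    moreover have "E n = supp \<inter> {x. 1 / real (Suc n) \<le> norm (x - q)}" by (auto simp: E_def)
    ultimately show ?thesis using supp_sub by (auto simp: sets_half_plane_borel[OF iota])
  qed
  have "P (E n) u = 0" for n
  proof -
    obtain G where G: "bounded_linear G" "\<And>u. G (Delta q T u) = P (E n) u"
      by (rule Delta_left_inverse[OF q E, of n "1 / real (Suc n)"]) (auto simp: E_def)
    show ?thesis using G(2)[of u] D linear_0[OF bounded_linear.linear[OF G(1)]] by simp
  qed
  then have "P (\<Union>n. E n) u = 0" by (rule P_UN_zero[OF E])
  moreover have "(\<Union>n. E n) = supp - {q}"
  proof -
    have "\<exists>n. 1 / real (Suc n) \<le> norm (x - q)" if xq: "x \<noteq> q" for x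
    proof -
      obtain n where "inverse (real (Suc n)) < norm (x - q)"
        using reals_Archimedean[of "norm (x - q)"] xq by auto
      then show ?thesis by (intro exI[of _ n]) (simp add: inverse_eq_divide)
    qed
    then show ?thesis by (auto simp: E_def)
  qed
  ultimately have z: "P (supp - {q}) u = 0" by simp
  have dj: "(supp - {q}) \<inter> {q} = {}" by simp
  have "P (supp - {q} \<union> {q}) u = P {q} u"
    using P_Un[OF _ singleton_HB[OF q] dj, of u] z supp_HB singleton_HB[OF q] by (simp add: sets.Diff)
  moreover have "P (supp - {q} \<union> {q}) u = P HP u"
    using supp_HB singleton_HB[OF q] HP_HB supp_sub by (intro P_supp_cong sets.Un sets.Diff) auto
  ultimately show "P {q} u = u" by simp
next
  assume u: "P {q} u = u"
  show "u \<in> ker (Delta q T)"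
  proof (cases "q \<in> supp")
    case True
    \<comment> \<open>The symbol vanishes at \<open>q\<close>, so the norm bound holds with constant
      0.\<close>
    have "norm (Delta q T (P {q} u)) \<le> 0 * norm (P {q} u)"
    proof (rule int_norm_on[OF Delta_int singleton_HB[OF q]])
      fix x assume "x \<in> {q}"
      then have x: "x = q" by simp
      show "norm (on_supp x * on_supp x - of_real (2 * qRe q) * on_supp x + of_real ((norm q)\<^sup>2)) \<le> 0"
        using True x half_plane_Delta(2)[OF iota q q] by (simp del: of_real_mult of_real_power)
    qed simp
    then show ?thesis by (simp add: u ker_def)
  next
    case False
    \<comment> \<open>Off the support the truncated symbol at \<open>q\<close> is
      \<open>(norm q)\<^sup>2\<close> and says nothing, but there \<open>P {q}\<close>
      vanishes.\<close>
    then have "P {q} u = 0"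
      using P_mono_zero[OF singleton_HB[OF q] _ _ P_supp_compl, of u] q HP_HB supp_HB by (auto simp: sets.Diff)
    then show ?thesis using u linear_0[OF bounded_linear.linear[OF bounded_op_bl[OF Delta_bop[OF T_bop]]]]
      by (simp add: ker_def)
  qed
qed

lemma point_spectrum_iff:
  assumes q: "q \<in> HP"
  shows "q \<in> point_spectrum T \<longleftrightarrow> P {q} \<noteq> (\<lambda>u. 0)"
proof -
  have "ker (Delta q T) = {0} \<longleftrightarrow> (\<forall>u. P {q} u = 0)"
    using ker_Delta[OF q] is_proj_idem[OF P_proj[OF singleton_HB[OF q]]]
      linear_0[OF bounded_linear.linear[OF P_bl[OF singleton_HB[OF q]]]]
    by (smt (verit, best) Collect_cong singleton_conv singleton_iff set_eqI)
  then show ?thesis by (auto simp: point_spectrum_def)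
qed

lemma inv_Delta:
  assumes "ker (Delta q T) = {0}"
  shows "inv (Delta q T) (Delta q T u) = u"
proof (rule inv_f_f)
  interpret D: bounded_linear "Delta q T" by (rule bounded_op_bl[OF Delta_bop[OF T_bop]])
  show "inj (Delta q T)"
    using assms D.diff by (intro injI) (metis (mono_tags, lifting) ker_def mem_Collect_eq right_minus_eq singletonD)
qed

lemma spectrum_iff:
  assumes n: "normal_op T" and q: "q \<in> HP"
  shows "q \<in> spherical_spectrum T \<longleftrightarrow> q \<in> supp"
proof
  assume s: "q \<in> spherical_spectrum T"
  show "q \<in> supp"
  proof (rule ccontr)
    assume "q \<notin> supp"
    then have "open (- supp)" "q \<in> - supp" using supp_closed by auto
    then obtain r where r: "r > 0" "ball q r \<subseteq> - supp" using open_contains_ball by blast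
    have "r \<le> norm (x - q)" if "x \<in> supp" for x
    proof (rule ccontr)
      assume "\<not> r \<le> norm (x - q)"
      then have "x \<in> ball q r" by (simp add: dist_norm norm_minus_commute)
      then show False using r(2) that by blast
    qed
    then obtain G where G: "bounded_linear G" "\<And>u. G (Delta q T u) = u" "\<And>u. Delta q T (G u) = u"
      using Delta_left_inverse[OF q supp_HB subset_refl r(1)] P_supp by metis
    have ker: "ker (Delta q T) = {0}"
      using G(2) linear_0[OF bounded_linear.linear[OF G(1)]]
        linear_0[OF bounded_linear.linear[OF bounded_op_bl[OF Delta_bop[OF T_bop, of q]]]]
      by (auto simp: ker_def) (metis)
    obtain K where K: "\<And>u. norm (G u) \<le> norm u * K" using bounded_linear.bounded[OF G(1)] by blast
    have "has_bounded_inverse (Delta q T)"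
      unfolding has_bounded_inverse_def
    proof (intro exI ballI)
      fix v assume "v \<in> range (Delta q T)"
      then obtain u where u: "v = Delta q T u" by blast
      then show "norm (inv (Delta q T) v) \<le> K * norm v"
        using K[of v] by (simp add: inv_Delta[OF ker] G(2) mult.commute)
    qed
    with ker s show False using spherical_spectrum_iff[OF T_bop n] by blast
  qed
next
  assume s: "q \<in> supp"
  show "q \<in> spherical_spectrum T"
  proof (rule ccontr)
    assume "q \<notin> spherical_spectrum T"
    then have ker: "ker (Delta q T) = {0}" and bi: "has_bounded_inverse (Delta q T)"
      using spherical_spectrum_iff[OF T_bop n] by auto
    obtain K where K: "\<And>v. v \<in> range (Delta q T) \<Longrightarrow> norm (inv (Delta q T) v) \<le> K * norm v"
      using bi by (auto simp: has_bounded_inverse_def)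
    have Ku: "norm u \<le> K * norm (Delta q T u)" for u
      using K[of "Delta q T u"] by (simp add: inv_Delta[OF ker])
    \<comment> \<open>Within distance \<open>r \<le> 1\<close> of \<open>q\<close> the symbol is at
      most \<open>r * (1 + 2 * norm q)\<close>. The second bound on \<open>r\<close> makes this,
      times \<open>\<bar>K\<bar> + 1\<close>, at most 1/2, which contradicts the lower bound
      \<open>Ku\<close> on a nonzero vector of the local spectral subspace.\<close>
    define r where "r = min 1 (1 / (2 * (\<bar>K\<bar> + 1) * (1 + 2 * norm q)))"
    have den: "2 * (\<bar>K\<bar> + 1) * (1 + 2 * norm q) > 0" by (intro mult_pos_pos) (auto intro: add_pos_nonneg)
    then have r: "r > 0" "r \<le> 1" "r * (2 * (\<bar>K\<bar> + 1) * (1 + 2 * norm q)) \<le> 1"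
      by (simp_all add: r_def pos_le_divide_eq[symmetric])
    let ?U = "HP \<inter> ball q r"
    have oU: "openin (top_of_set HP) ?U" by (simp add: openin_open_Int)
    have "q \<in> ?U" using q r(1) by simp
    then have "P ?U \<noteq> (\<lambda>u. 0)" using s oU supp_iff by blast
    then obtain v where v: "P ?U v \<noteq> 0" by blast
    let ?E = "?U \<inter> supp"
    have U: "?U \<in> HB" by (rule openin_half_plane_borel[OF iota oU])
    then have E: "?E \<in> HB" using supp_HB by (rule sets.Int)
    have Ev: "P ?E v \<noteq> 0" using v P_Int[OF U supp_HB, of v] by (simp add: P_supp)
    have "norm (Delta q T (P ?E v)) \<le> (r * (1 + 2 * norm q)) * norm (P ?E v)"
    proof (rule int_norm_on[OF Delta_int E])
      show "r * (1 + 2 * norm q) \<ge> 0" using r(1) by simp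
      fix x assume x: "x \<in> ?E"
      then have xq: "norm (x - q) \<le> r" by (auto simp: dist_norm norm_minus_commute)
      have "norm x \<le> 1 + norm q" using norm_triangle_sub[of x q] xq r(2) by simp
      then have "norm (x - q) * (norm x + norm q) \<le> r * (1 + 2 * norm q)"
        using xq r(1) by (intro mult_mono) auto
      moreover have "norm (Delta_symbol q x) \<le> norm (x - q) * (norm x + norm q)"
        using x by (intro half_plane_Delta(2)[OF iota _ q]) auto
      ultimately show "norm (on_supp x * on_supp x - of_real (2 * qRe q) * on_supp x + of_real ((norm q)\<^sup>2))
          \<le> r * (1 + 2 * norm q)"
        using x by (simp del: of_real_mult of_real_power)
    qed
    then have "K * norm (Delta q T (P ?E v)) \<le> (\<bar>K\<bar> + 1) * ((r * (1 + 2 * norm q)) * norm (P ?E v))"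
      by (intro mult_mono) auto
    then have "norm (P ?E v) \<le> (\<bar>K\<bar> + 1) * ((r * (1 + 2 * norm q)) * norm (P ?E v))"
      using Ku[of "P ?E v"] by linarith
    also have "\<dots> = (r * (2 * (\<bar>K\<bar> + 1) * (1 + 2 * norm q))) * (norm (P ?E v) / 2)" by (simp add: algebra_simps)
    also have "\<dots> \<le> 1 * (norm (P ?E v) / 2)" by (intro mult_right_mono r(3)) auto
    finally show False using Ev by simp
  qed
qed

lemma spectrum_eq: "normal_op T \<Longrightarrow> supp = spherical_spectrum T \<inter> HP"
  using spectrum_iff supp_sub by blast

lemma continuous_spectrum_iff:
  assumes n: "normal_op T" and q: "q \<in> HP"
  shows "q \<in> continuous_spectrum T \<longleftrightarrow> P {q} = (\<lambda>u. 0) \<and>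
    (\<forall>U. openin (top_of_set HP) U \<and> q \<in> U \<longrightarrow> P U \<noteq> (\<lambda>u. 0))"
proof -
  have "q \<in> continuous_spectrum T \<longleftrightarrow> ker (Delta q T) = {0} \<and> q \<in> spherical_spectrum T"
    using spherical_spectrum_iff[OF T_bop n] normal_dense_range[OF T_bop n]
    by (auto simp: continuous_spectrum_def)
  also have "\<dots> \<longleftrightarrow> P {q} = (\<lambda>u. 0) \<and> q \<in> supp"
    using point_spectrum_iff[OF q] spectrum_iff[OF n q] by (simp add: point_spectrum_def)
  finally show ?thesis using supp_iff q by blast
qed

end

section \<open>Intertwining operators\<close>

context iqpvm
begin

lemma int_pow_commute:
  assumes "is_int \<phi> F" "E \<in> HB"
  shows "P E ((F ^^ n) u) = (F ^^ n) (P E u)"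
  by (induction n) (simp_all add: int_P_commute[OF assms])

lemma int_pow_upper:
  assumes F: "is_int \<phi> F" and E: "E \<in> HB" and a: "a \<ge> 0" "\<And>x. x \<in> E \<Longrightarrow> norm (\<phi> x) \<le> a"
  shows "norm ((F ^^ n) (P E u)) \<le> a ^ n * norm u"
proof (induction n)
  case 0
  show ?case using is_proj_norm_le[OF P_proj[OF E]] by simp
next
  case (Suc n)
  have "norm ((F ^^ Suc n) (P E u)) = norm (F (P E ((F ^^ n) u)))"
    by (simp add: int_pow_commute[OF F E])
  also have "\<dots> \<le> a * norm (P E ((F ^^ n) u))" by (rule int_norm_on[OF F E a])
  also have "\<dots> \<le> a * (a ^ n * norm u)"
    using Suc a(1) by (simp add: int_pow_commute[OF F E] mult_left_mono)
  finally show ?case by simp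
qed

text \<open>The integral \<open>G\<close> of the reciprocal of \<open>f\<close> on \<open>E\<close>
  inverts \<open>F\<close> there with norm at most \<open>1 / a\<close>, so each application of
  \<open>F\<close> stretches the \<open>E\<close>-component by at least \<open>a\<close>.\<close>

lemma int_pow_lower:
  assumes F: "is_int (\<lambda>x. of_real (f x)) F" and f: "f \<in> borel_measurable borel"
    and E: "E \<in> HB" and a: "a > 0" "\<And>x. x \<in> E \<Longrightarrow> a \<le> f x"
  shows "a ^ n * norm (P E w) \<le> norm ((F ^^ n) w)"
proof -
  let ?\<psi> = "\<lambda>x. if x \<in> E then inverse (of_real (f x)) else (0::quat)"
  have nb: "norm (?\<psi> x) \<le> 1 / a" for x
    using a(1) a(2)[of x] by (auto simp: norm_inverse divide_inverse intro!: le_imp_inverse_le)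
  then have "bounded (?\<psi> ` HP)" unfolding bounded_iff by blast
  moreover have "?\<psi> \<in> borel_measurable (half_plane_borel \<iota>)"
    using f by (intro measurable_on_HP[OF E]) measurable
  ultimately obtain G where G: "is_int ?\<psi> G" using int_exists by blast
  have "is_int (\<lambda>x. if x \<in> E then 1 else 0) (\<lambda>u. G (F u))"
  proof (rule int_cong[OF int_mult[OF G F]])
    fix x
    show "?\<psi> x * of_real (f x) = (if x \<in> E then 1 else 0)"
      using a(1) a(2)[of x] by auto
  qed
  then have GF: "G (F u) = P E u" for u using int_unique[OF int_P[OF E]] by metis
  have step: "a * norm (P E w) \<le> norm (P E (F w))" for w
  proof -
    have "P E w = P E (G (F w))" by (simp add: GF is_proj_idem[OF P_proj[OF E]])
    also have "\<dots> = G (P E (F w))" by (rule int_P_commute[OF G E])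
    finally have "P E w = G (P E (F w))" .
    moreover have "norm (G (P E (F w))) \<le> 1 / a * norm (P E (F w))"
      by (rule int_norm_on[OF G E _ nb]) (use a(1) in simp)
    ultimately have "norm (P E w) \<le> 1 / a * norm (P E (F w))" by simp
    then show ?thesis using a(1) by (simp add: field_simps)
  qed
  show ?thesis
  proof (induction n arbitrary: w)
    case 0
    show ?case using is_proj_norm_le[OF P_proj[OF E]] by simp
  next
    case (Suc n)
    have "a ^ Suc n * norm (P E w) = a ^ n * (a * norm (P E w))" by simp
    also have "\<dots> \<le> a ^ n * norm (P E (F w))" using step a(1) by (intro mult_left_mono) auto
    also have "\<dots> \<le> norm ((F ^^ n) (F w))" by (rule Suc)
    finally show ?case by (simp add: funpow_swap1)
  qed
qed

abbreviation "sublevel f a \<equiv> {x \<in> HP. f x \<le> (a::real)}"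

lemma sublevel_HB: "f \<in> borel_measurable borel \<Longrightarrow> sublevel f a \<in> HB"
proof -
  assume f: "f \<in> borel_measurable borel"
  have "{x \<in> space borel. f x \<le> a} \<in> sets borel" using f by measurable
  then have "HP \<inter> {x. f x \<le> a} \<in> sets borel" using closed_half_plane[OF iota] by auto
  then show ?thesis by (simp add: sets_half_plane_borel[OF iota] Collect_conj_eq)
qed

lemma superlevel_HB: "(f :: quat \<Rightarrow> real) \<in> borel_measurable borel \<Longrightarrow> {x \<in> HP. a \<le> f x} \<in> HB"
  using sublevel_HB[of "\<lambda>x. - f x" "- a"] by simp

end

context
  fixes \<iota> :: quat and P P' :: "quat set \<Rightarrow> 'h::quat_hilbert \<Rightarrow> 'h" and L L' f F F' X
  assumes 1: "iqpvm \<iota> P L" and 2: "iqpvm \<iota> P' L'"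
    and F: "has_bounded_qint \<iota> P L (\<lambda>x. of_real (f x)) F"
    and F': "has_bounded_qint \<iota> P' L' (\<lambda>x. of_real (f x)) F'"
    and f: "f \<in> borel_measurable borel"
    and X: "bounded_linear X" "\<And>u. X (F u) = F' (X u)"
begin

text \<open>The upper power estimate asks for a bound on the norm of the integrand; positivity makes
  \<open>f x \<le> a\<close> such a bound.\<close>

lemma intertwine_nonneg:
  assumes ab: "0 \<le> a" "a < b" and pos: "\<And>x. x \<in> half_plane \<iota> \<Longrightarrow> 0 \<le> f x"
  shows "P' {x \<in> half_plane \<iota>. b \<le> f x} (X (P {x \<in> half_plane \<iota>. f x \<le> a} u)) = 0"
proof -
  interpret A: iqpvm \<iota> P L by (rule 1)
  interpret B: iqpvm \<iota> P' L' by (rule 2)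
  interpret X: bounded_linear X by (rule X)
  let ?E = "{x \<in> half_plane \<iota>. f x \<le> a}" and ?E' = "{x \<in> half_plane \<iota>. b \<le> f x}"
  let ?w = "P' ?E' (X (P ?E u))"
  obtain K where K: "K > 0" "\<And>v. norm (X v) \<le> norm v * K" using X.pos_bounded by blast
  have XF: "(F' ^^ n) (X v) = X ((F ^^ n) v)" for n v by (induction n) (simp_all add: X(2))
  have "b ^ n * norm ?w \<le> K * norm u * a ^ n" for n
  proof -
    have "b ^ n * norm ?w \<le> norm ((F' ^^ n) (X (P ?E u)))"
      using ab by (intro B.int_pow_lower[OF F' f B.superlevel_HB[OF f]]) auto
    also have "\<dots> \<le> norm ((F ^^ n) (P ?E u)) * K" unfolding XF by (rule K(2))
    also have "\<dots> \<le> (a ^ n * norm u) * K"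
      using ab pos K(1) by (intro mult_right_mono A.int_pow_upper[OF F A.sublevel_HB[OF f]]) auto
    finally show ?thesis by (simp add: ac_simps)
  qed
  then have le: "norm ?w \<le> K * norm u * (a / b) ^ n" for n
    using ab by (simp add: power_divide field_simps)
  have "(\<lambda>n. K * norm u * (a / b) ^ n) \<longlonglongrightarrow> K * norm u * 0"
    using ab by (intro tendsto_intros LIMSEQ_power_zero) auto
  then have "norm ?w \<le> K * norm u * 0" by (rule LIMSEQ_le[OF tendsto_const]) (use le in auto)
  then show ?thesis by simp
qed

end

text \<open>Adding a real constant to \<open>f\<close> changes both operators by the same scalar, so
  intertwining persists. The shift \<open>c + \<bar>a\<bar>\<close> makes both the function and the
  lower level nonnegative.\<close>

lemma intertwine_disjoint:
  fixes P P' :: "quat set \<Rightarrow> 'h::quat_hilbert \<Rightarrow> 'h"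
  assumes 1: "iqpvm \<iota> P L" and 2: "iqpvm \<iota> P' L'"
    and F: "has_bounded_qint \<iota> P L (\<lambda>x. of_real (f x)) F"
    and F': "has_bounded_qint \<iota> P' L' (\<lambda>x. of_real (f x)) F'"
    and f: "f \<in> borel_measurable borel"
    and X: "bounded_linear X" "\<And>u. X (F u) = F' (X u)" and ab: "a < b"
  shows "P' {x \<in> half_plane \<iota>. b \<le> f x} (X (P {x \<in> half_plane \<iota>. f x \<le> a} u)) = 0"
proof -
  interpret A: iqpvm \<iota> P L by (rule 1)
  interpret B: iqpvm \<iota> P' L' by (rule 2)
  interpret X: bounded_linear X by (rule X)
  obtain c where c: "c > 0" "\<And>x. x \<in> half_plane \<iota> \<Longrightarrow> norm (of_real (f x) :: quat) \<le> c"
    by (rule A.int_bounded[OF F]) blast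
  define m where "m = c + \<bar>a\<bar>"
  let ?g = "\<lambda>x. f x + m"
  have "A.is_int (\<lambda>x. of_real (?g x)) (\<lambda>u. F u + L (of_real m) u)"
    using A.int_add[OF F A.int_const[of "of_real m"]] by simp
  moreover have "B.is_int (\<lambda>x. of_real (?g x)) (\<lambda>u. F' u + L' (of_real m) u)"
    using B.int_add[OF F' B.int_const[of "of_real m"]] by simp
  moreover have "?g \<in> borel_measurable borel" using f by measurable
  moreover have "X (F u + L (of_real m) u) = F' (X u) + L' (of_real m) (X u)" for u
    by (simp add: X.add X(2) A.L_of_real B.L_of_real X.scaleR)
  moreover have "0 \<le> ?g x" if "x \<in> half_plane \<iota>" for x using c(2)[OF that] by (simp add: m_def)
  moreover have "0 \<le> a + m" "a + m < b + m" using c(1) ab by (auto simp: m_def)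
  ultimately have "P' {x \<in> half_plane \<iota>. b + m \<le> ?g x} (X (P {x \<in> half_plane \<iota>. ?g x \<le> a + m} u)) = 0"
    by (intro intertwine_nonneg[OF 1 2 _ _ _ X(1)])
  then show ?thesis by simp
qed

text \<open>It is shown that \<open>X\<close> maps the sublevel subspace into the sublevel subspace
  and complement into complement. Disjointness being available only across a gap, the complement is
  exhausted by the sets \<open>G n\<close>.\<close>

lemma intertwine_le:
  fixes P P' :: "quat set \<Rightarrow> 'h::quat_hilbert \<Rightarrow> 'h"
  assumes 1: "iqpvm \<iota> P L" and 2: "iqpvm \<iota> P' L'"
    and F: "has_bounded_qint \<iota> P L (\<lambda>x. of_real (f x)) F"
    and F': "has_bounded_qint \<iota> P' L' (\<lambda>x. of_real (f x)) F'"
    and f: "f \<in> borel_measurable borel"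
    and X: "bounded_linear X" "\<And>u. X (F u) = F' (X u)"
  shows "X (P {x \<in> half_plane \<iota>. f x \<le> a} u) = P' {x \<in> half_plane \<iota>. f x \<le> a} (X u)"
proof -
  interpret A: iqpvm \<iota> P L by (rule 1)
  interpret B: iqpvm \<iota> P' L' by (rule 2)
  interpret X: bounded_linear X by (rule X)
  let ?E = "{x \<in> half_plane \<iota>. f x \<le> a}"
  define G where "G n = {x \<in> half_plane \<iota>. a + 1 / real (Suc n) \<le> f x}" for n
  have E: "?E \<in> A.HB" by (rule A.sublevel_HB[OF f])
  have G: "G n \<in> A.HB" for n unfolding G_def by (rule A.superlevel_HB[OF f])
  have UG: "(\<Union>n. G n) = A.HP - ?E"
  proof -
    have "\<exists>n. a + 1 / real (Suc n) \<le> f x" if "\<not> f x \<le> a" for x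
    proof -
      obtain n where "inverse (real (Suc n)) < f x - a" using reals_Archimedean[of "f x - a"] \<open>\<not> f x \<le> a\<close> by auto
      then show ?thesis by (intro exI[of _ n]) (simp add: inverse_eq_divide)
    qed
    moreover have "\<not> f x \<le> a" if "a + 1 / real (Suc n) \<le> f x" for x n
      using \<open>a + 1 / real (Suc n) \<le> f x\<close> by (smt (verit) divide_pos_pos of_nat_0_less_iff zero_less_Suc)
    ultimately show ?thesis unfolding G_def by blast
  qed
  have inc: "incseq G"
    unfolding incseq_def G_def
  proof (intro allI impI subsetI)
    fix m n x assume "m \<le> n" "x \<in> {x \<in> half_plane \<iota>. a + 1 / real (Suc m) \<le> f x}"
    moreover have "1 / real (Suc n) \<le> 1 / real (Suc m)" using \<open>m \<le> n\<close> by (simp add: frac_le)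
    ultimately show "x \<in> {x \<in> half_plane \<iota>. a + 1 / real (Suc n) \<le> f x}" by auto
  qed
  have "P' (G n) (X (P ?E u)) = 0" for n
    unfolding G_def by (rule intertwine_disjoint[OF 1 2 F F' f X]) simp
  then have "P' (A.HP - ?E) (X (P ?E u)) = 0" unfolding UG[symmetric] by (rule B.P_UN_zero[OF G])
  then have 1: "P' ?E (X (P ?E u)) = X (P ?E u)"
    using B.P_diff[OF B.HP_HB E B.HB_sub[OF E], of "X (P ?E u)"] by simp
  \<comment> \<open>Passing to \<open>- f\<close> turns the superlevel set \<open>G n\<close> into a
    sublevel set and reverses the roles of the two sets.\<close>
  have "P' ?E (X (P (G n) u)) = 0" for n
  proof -
    have "A.is_int (\<lambda>x. of_real (- f x)) (\<lambda>u. - F u)" using A.int_uminus[OF F] by simp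
    moreover have "B.is_int (\<lambda>x. of_real (- f x)) (\<lambda>u. - F' u)" using B.int_uminus[OF F'] by simp
    moreover have "(\<lambda>x. - f x) \<in> borel_measurable borel" using f by measurable
    ultimately have "P' {x \<in> half_plane \<iota>. - a \<le> - f x} (X (P {x \<in> half_plane \<iota>. - f x \<le> - (a + 1 / real (Suc n))} u)) = 0"
      by (rule intertwine_disjoint[OF assms(1) 2 _ _ _ X(1)]) (simp_all add: linear_neg[OF X.linear] X(2))
    then show ?thesis unfolding G_def by (simp only: neg_le_iff_le)
  qed
  moreover have "(\<lambda>n. P' ?E (X (P (G n) u))) \<longlonglongrightarrow> P' ?E (X (P (A.HP - ?E) u))"
    unfolding UG[symmetric]
    by (intro bounded_linear.tendsto[OF B.P_bl[OF E]] X.tendsto A.P_incseq[OF G inc])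
  ultimately have "P' ?E (X (P (A.HP - ?E) u)) = 0" by (simp add: LIMSEQ_const_iff)
  then have "P' ?E (X u) = P' ?E (X (P ?E u))"
    using A.P_diff[OF A.HP_HB E A.HB_sub[OF E], of u] linear_diff[OF bounded_linear.linear[OF B.P_bl[OF E]]]
    by (simp add: X.diff)
  with 1 show ?thesis by simp
qed

section \<open>Real and imaginary parts of \<open>T\<close> as integrals\<close>

context spectral_iqpvm
begin

definition "ReT u = (1/2) *\<^sub>R (T u + adj T u)"
text \<open>The square of the imaginary part, written with \<open>T\<close> and \<open>adj T\<close>
  only: \<open>T - adj T\<close> has symbol \<open>\<iota> * of_real (2 * inner \<iota> x)\<close>
  on the support, and the square of this is \<open>-4\<close> times the square of the imaginary
  coordinate. \<open>ImT\<close>, in contrast, is written with \<open>L\<close>.\<close>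

definition "SqT u = (-1/4) *\<^sub>R (T (T u - adj T u) - adj T (T u - adj T u))"
definition "ImT u = (-1/2) *\<^sub>R L \<iota> (T u - adj T u)"

lemma supp_HP: "x \<in> supp \<Longrightarrow> x \<in> HP"
  using supp_sub by blast

lemma T_cnj: "is_int (\<lambda>x. qcnj (on_supp x)) (adj T)"
  by (rule int_cnj[OF T_int])

lemma ReT_int: "is_int (\<lambda>x. of_real (if x \<in> supp then qRe x else 0)) ReT"
proof -
  have "ReT = (\<lambda>u. (1/2) *\<^sub>R (T u + adj T u))" by (simp add: ReT_def fun_eq_iff)
  moreover have "is_int (\<lambda>x. of_real (1/2) * (on_supp x + qcnj (on_supp x))) (\<lambda>u. (1/2) *\<^sub>R (T u + adj T u))"
    by (rule int_scaleR[OF int_add[OF T_int T_cnj]])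
  moreover have "of_real (1/2) * (on_supp x + qcnj (on_supp x)) = of_real (if x \<in> supp then qRe x else 0)" for x
  proof (cases "x \<in> supp")
    case True
    have "of_real (1/2) * (x + qcnj x) = of_real (1/2 * (2 * qRe x))"
      by (simp only: half_plane_cnj(1)[OF iota supp_HP[OF True]] of_real_mult)
    then show ?thesis using True by simp
  qed simp
  ultimately show ?thesis by (simp only:)
qed

lemma diff_int: "is_int (\<lambda>x. \<iota> * of_real (if x \<in> supp then 2 * inner \<iota> x else 0)) (\<lambda>u. T u - adj T u)"
  by (rule int_cong[OF int_diff[OF T_int T_cnj]]) (auto simp: half_plane_cnj(2)[OF iota supp_HP] simp del: of_real_mult)

lemma SqT_int: "is_int (\<lambda>x. of_real (if x \<in> supp then (inner \<iota> x)\<^sup>2 else 0)) SqT"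
proof -
  let ?b = "\<lambda>x. if x \<in> supp then 2 * inner \<iota> x else 0"
  have e: "SqT = (\<lambda>u. (-1/4) *\<^sub>R (T (T u - adj T u) - adj T (T u - adj T u)))"
    by (simp add: SqT_def fun_eq_iff)
  have "is_int (\<lambda>x. of_real (-1/4) * ((\<iota> * of_real (?b x)) * (\<iota> * of_real (?b x)))) SqT"
    unfolding e by (rule int_scaleR[OF int_mult[OF diff_int diff_int]])
  moreover have "of_real (-1/4) * ((\<iota> * of_real (?b x)) * (\<iota> * of_real (?b x)))
      = of_real (if x \<in> supp then (inner \<iota> x)\<^sup>2 else 0)" for x
  proof -
    have "(\<iota> * of_real b) * (\<iota> * of_real b) = of_real (- (b * b))" for b
    proof -
      have "(\<iota> * of_real b) * (\<iota> * of_real b) = \<iota> * (of_real b * \<iota>) * of_real b" by (simp only: mult.assoc)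
      also have "\<dots> = (\<iota> * \<iota>) * (of_real b * of_real b)"
        by (simp only: quat_of_real_commute[of b \<iota>] mult.assoc)
      finally show ?thesis by (simp add: imag_units_square[OF iota])
    qed
    then have "of_real (-1/4) * ((\<iota> * of_real (?b x)) * (\<iota> * of_real (?b x))) = of_real (-1/4 * - (?b x * ?b x))"
      by (simp only: of_real_mult)
    moreover have "-1/4 * - (?b x * ?b x) = (if x \<in> supp then (inner \<iota> x)\<^sup>2 else 0)"
      by (simp add: power2_eq_square)
    ultimately show ?thesis by (simp only:)
  qed
  ultimately show ?thesis by (simp only:)
qed

lemma ImT_int: "is_int (\<lambda>x. of_real (if x \<in> supp then inner \<iota> x else 0)) ImT"
proof -
  let ?b = "\<lambda>x. if x \<in> supp then 2 * inner \<iota> x else 0"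
  have e: "ImT = (\<lambda>u. (-1/2) *\<^sub>R L \<iota> (T u - adj T u))" by (simp add: ImT_def fun_eq_iff)
  have "is_int (\<lambda>x. of_real (-1/2) * (\<iota> * (\<iota> * of_real (?b x)))) ImT"
    unfolding e by (rule int_scaleR[OF int_mult[OF int_const diff_int]])
  moreover have "of_real (-1/2) * (\<iota> * (\<iota> * of_real (?b x))) = of_real (if x \<in> supp then inner \<iota> x else 0)" for x
  proof -
    have "\<iota> * (\<iota> * of_real b) = of_real (- b)" for b
      using imag_units_square[OF iota] by (simp add: mult.assoc[symmetric])
    then have "of_real (-1/2) * (\<iota> * (\<iota> * of_real (?b x))) = of_real (-1/2 * - ?b x)"
      by (simp only: of_real_mult)
    moreover have "-1/2 * - ?b x = (if x \<in> supp then inner \<iota> x else 0)" by simp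
    ultimately show ?thesis by (simp only:)
  qed
  ultimately show ?thesis by (simp only:)
qed

lemma supp_bounded:
  obtains R where "R > 0" "\<And>x. x \<in> supp \<Longrightarrow> norm x \<le> R"
proof -
  obtain c where "c > 0" "\<And>x. x \<in> HP \<Longrightarrow> norm (on_supp x) \<le> c" by (rule int_bounded[OF T_int]) blast
  then show ?thesis using that[of c] supp_HP by (metis (full_types))
qed

text \<open>Allows the integrand to be changed off the support, so that integrals for two measures
  can share one globally defined function.\<close>

lemma real_int_extend:
  assumes A: "is_int (\<lambda>x. of_real (f x)) A" and g: "g \<in> borel_measurable borel" "\<And>x. \<bar>g x\<bar> \<le> c"
    and eq: "\<And>x. x \<in> supp \<Longrightarrow> f x = g x"
  shows "is_int (\<lambda>x. of_real (g x)) A"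
proof -
  have "(\<lambda>x. of_real (g x) :: quat) \<in> borel_measurable (half_plane_borel \<iota>)"
    using g(1) by (intro measurable_restrict_space1) measurable
  moreover have "bounded ((\<lambda>x. of_real (g x) :: quat) ` HP)"
    unfolding bounded_iff using g(2) by (intro exI[of _ c]) auto
  ultimately obtain B where B: "is_int (\<lambda>x. of_real (g x)) B" using int_exists by blast
  have "A = B" by (rule int_supp_cong[OF A B]) (simp add: eq)
  with B show ?thesis by simp
qed

abbreviation "preim A \<equiv> {x \<in> HP. (inner 1 x, inner \<iota> x) \<in> A}"

lemma preim_HB: "A \<in> sets borel \<Longrightarrow> preim A \<in> HB"
proof -
  assume A: "A \<in> sets borel"
  have "(\<lambda>x::quat. (inner 1 x, inner \<iota> x)) \<in> borel_measurable borel"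
    by (intro borel_measurable_continuous_onI continuous_intros)
  from measurable_sets[OF this A] have "HP \<inter> {x. (inner 1 x, inner \<iota> x) \<in> A} \<in> sets borel"
    using closed_half_plane[OF iota] by (auto simp: vimage_def)
  then show ?thesis by (simp add: sets_half_plane_borel[OF iota] Collect_conj_eq)
qed

lemma preim_surj:
  assumes "E \<in> HB"
  obtains A where "A \<in> sets borel" "E = preim A"
proof
  let ?h = "\<lambda>p::real \<times> real. of_real (fst p) + \<iota> * of_real (snd p)"
  have "?h \<in> borel_measurable borel" by (intro borel_measurable_continuous_onI continuous_intros)
  moreover have "E \<in> sets borel" using assms by (simp add: sets_half_plane_borel[OF iota])
  ultimately show "?h -` E \<in> sets borel" using measurable_sets[of ?h borel borel E] by simp
  show "E = preim (?h -` E)"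
    using HB_sub[OF assms] half_plane_iff[OF iota] by (auto simp: qRe_eq_inner)
qed

end

theorem intertwine:
  fixes P P' :: "quat set \<Rightarrow> 'h::quat_hilbert \<Rightarrow> 'h"
  assumes 1: "spectral_iqpvm \<iota> P L T" and 2: "spectral_iqpvm \<iota> P' L' T'"
    and X: "bounded_linear X"
    and re: "\<And>u. X (spectral_iqpvm.ReT T u) = spectral_iqpvm.ReT T' (X u)"
    and sq: "\<And>u. X (spectral_iqpvm.SqT T u) = spectral_iqpvm.SqT T' (X u)"
    and E: "E \<in> sets (half_plane_borel \<iota>)"
  shows "X (P E u) = P' E (X u)"
proof -
  interpret A: spectral_iqpvm \<iota> P L T by (rule 1)
  interpret B: spectral_iqpvm \<iota> P' L' T' by (rule 2)
  interpret X: bounded_linear X by (rule X)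
  obtain R1 where R1: "R1 > 0" "\<And>x. x \<in> A.supp \<Longrightarrow> norm x \<le> R1" by (rule A.supp_bounded) blast
  obtain R2 where R2: "R2 > 0" "\<And>x. x \<in> B.supp \<Longrightarrow> norm x \<le> R2" by (rule B.supp_bounded) blast
  define R where "R = max R1 R2"
  have R: "R > 0" "\<And>x. x \<in> A.supp \<union> B.supp \<Longrightarrow> norm x \<le> R"
    using R1 R2 by (auto simp: R_def le_max_iff_disj)
  have re_le: "\<bar>inner 1 x\<bar> \<le> R" and im_le: "\<bar>inner \<iota> x\<bar> \<le> R" if "x \<in> A.supp \<union> B.supp" for x
    using R(2)[OF that] Cauchy_Schwarz_ineq2[of 1 x] Cauchy_Schwarz_ineq2[of \<iota> x] A.iota
    by (simp_all add: imag_units_iff)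
  \<comment> \<open>At this stage the two supports may differ. Clamping at \<open>R\<close> and
    \<open>R\<^sup>2\<close> gives bounded functions on all quaternions that agree with the
    coordinates on either support.\<close>
  define f where "f x = max (- R) (min R (inner 1 x))" for x :: quat
  define g where "g x = min (R\<^sup>2) ((inner \<iota> x)\<^sup>2)" for x
  have fm: "f \<in> borel_measurable borel" and gm: "g \<in> borel_measurable borel"
    unfolding f_def[abs_def] g_def[abs_def] by measurable
  have fb: "\<bar>f x\<bar> \<le> R" and gb: "\<bar>g x\<bar> \<le> R\<^sup>2" for x using R(1) by (auto simp: f_def g_def)
  have feq: "f x = inner 1 x" if "x \<in> A.supp \<union> B.supp" for x
    using re_le[OF that] by (auto simp: f_def min_def max_def abs_le_iff)
  have geq: "g x = (inner \<iota> x)\<^sup>2" if "x \<in> A.supp \<union> B.supp" for x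
    using im_le[OF that] R(1) by (simp add: g_def min_def abs_le_square_iff[symmetric])
  have Af: "A.is_int (\<lambda>x. of_real (f x)) A.ReT"
    by (rule A.real_int_extend[OF A.ReT_int fm fb]) (simp add: feq qRe_eq_inner)
  have Bf: "B.is_int (\<lambda>x. of_real (f x)) B.ReT"
    by (rule B.real_int_extend[OF B.ReT_int fm fb]) (simp add: feq qRe_eq_inner)
  have Ag: "A.is_int (\<lambda>x. of_real (g x)) A.SqT"
    by (rule A.real_int_extend[OF A.SqT_int gm gb]) (simp add: geq)
  have Bg: "B.is_int (\<lambda>x. of_real (g x)) B.SqT"
    by (rule B.real_int_extend[OF B.SqT_int gm gb]) (simp add: geq)
  have iA: "iqpvm \<iota> P L" and iB: "iqpvm \<iota> P' L'" by unfold_locales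
  have m1: "(\<lambda>x::quat. inner 1 x) \<in> borel_measurable borel" and m2: "(\<lambda>x::quat. inner \<iota> x) \<in> borel_measurable borel"
    by measurable
  have 1: "X (P (A.sublevel (inner 1) a) v) = P' (A.sublevel (inner 1) a) (X v)" for a v
  proof -
    have "P (A.sublevel (inner 1) a) v = P (A.sublevel f a) v" for v
      by (rule A.P_supp_cong[OF A.sublevel_HB[OF m1] A.sublevel_HB[OF fm]]) (auto simp: feq)
    moreover have "P' (A.sublevel (inner 1) a) v = P' (A.sublevel f a) v" for v
      by (rule B.P_supp_cong[OF A.sublevel_HB[OF m1] A.sublevel_HB[OF fm]]) (auto simp: feq)
    ultimately show ?thesis using intertwine_le[OF iA iB Af Bf fm X re] by simp
  qed
  \<comment> \<open>Only the square of the imaginary coordinate is at hand; since this coordinate is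
    nonnegative on the half plane, its sublevel sets at \<open>a \<ge> 0\<close> are those of the
    square at \<open>a\<^sup>2\<close>.\<close>
  have 2: "X (P (A.sublevel (inner \<iota>) a) v) = P' (A.sublevel (inner \<iota>) a) (X v)" for a v
  proof (cases "a \<ge> 0")
    case True
    have iff: "inner \<iota> x \<le> a \<longleftrightarrow> g x \<le> a\<^sup>2" if "x \<in> A.supp \<union> B.supp" for x
    proof -
      have "x \<in> A.HP" using that A.supp_HP B.supp_HP by blast
      then have "inner \<iota> x \<ge> 0" using half_plane_iff[OF A.iota] by blast
      then show ?thesis unfolding geq[OF that] using True by (simp add: abs_le_square_iff[symmetric])
    qed
    have "P (A.sublevel (inner \<iota>) a) v = P (A.sublevel g (a\<^sup>2)) v" for v
      by (rule A.P_supp_cong[OF A.sublevel_HB[OF m2] A.sublevel_HB[OF gm]]) (auto simp: iff)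
    moreover have "P' (A.sublevel (inner \<iota>) a) v = P' (A.sublevel g (a\<^sup>2)) v" for v
      by (rule B.P_supp_cong[OF A.sublevel_HB[OF m2] A.sublevel_HB[OF gm]]) (auto simp: iff)
    ultimately show ?thesis using intertwine_le[OF iA iB Ag Bg gm X sq] by simp
  next
    case False
    have e: "A.sublevel (inner \<iota>) a = {}"
    proof -
      have "\<not> inner \<iota> x \<le> a" if "x \<in> A.HP" for x
        using half_plane_iff[OF A.iota, of x] that False by auto
      then show ?thesis by blast
    qed
    show ?thesis unfolding e by (simp add: X.zero)
  qed
  obtain M where M: "M \<in> sets borel" "E = A.preim M" by (rule A.preim_surj[OF E])
  have Ms: "M \<in> sigma_sets UNIV (range (\<lambda>a::real \<times> real. {..a}))"
    using M(1) by (simp add: borel_eq_atMost)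
  \<comment> \<open>The quadrants of the componentwise order form an intersection-stable generator
    of the Borel sets of the plane, and their preimages are intersections of sublevel sets of the
    two coordinates.\<close>
  have i: "{..a} \<inter> {..b} = {..(min (fst a) (fst b), min (snd a) (snd b))}" for a b :: "real \<times> real"
    by (auto simp: less_eq_prod_def)
  have st: "Int_stable (range (\<lambda>a::real \<times> real. {..a}))"
    unfolding Int_stable_def by (auto simp only: i intro: rangeI)
  have pw: "range (\<lambda>a::real \<times> real. {..a}) \<subseteq> Pow UNIV" by simp
  have "\<forall>v. X (P (A.preim M) v) = P' (A.preim M) (X v)"
    using st pw Ms
  proof (induction M rule: sigma_sets_induct_disjoint)
    case (basic M)
    then obtain a b where M: "M = {..(a, b)}" by auto
    have "A.preim M = A.sublevel (inner 1) a \<inter> A.sublevel (inner \<iota>) b" by (auto simp: M less_eq_prod_def)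
    then show ?case
      by (simp only: A.P_Int[OF A.sublevel_HB[OF m1] A.sublevel_HB[OF m2], symmetric]
          B.P_Int[OF A.sublevel_HB[OF m1] A.sublevel_HB[OF m2], symmetric] 1 2 simp_thms)
  next
    case empty
    show ?case by (simp add: X.zero)
  next
    case (compl M)
    then have "A.preim M \<in> A.HB" by (intro A.preim_HB) (simp add: borel_eq_atMost)
    moreover have "A.preim (UNIV - M) = A.HP - A.preim M" by auto
    ultimately show ?case using compl A.P_diff[OF A.HP_HB] B.P_diff[OF A.HP_HB]
      by (simp add: X.diff)
  next
    case (union M)
    have H: "A.preim (M i) \<in> A.HB" for i
      using union(2) by (intro A.preim_HB) (auto simp: borel_eq_atMost)
    have d: "disjoint_family (\<lambda>i. A.preim (M i))" using union(1) by (auto simp: disjoint_family_on_def)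
    have u: "A.preim (\<Union>i. M i) = (\<Union>i. A.preim (M i))" by auto
    show ?case
    proof
      fix v
      have "(\<lambda>i. X (P (A.preim (M i)) v)) sums X (P (\<Union>i. A.preim (M i)) v)"
        using A.P_sums[OF _ d, of v] H by (intro X.sums) auto
      moreover have "(\<lambda>i. P' (A.preim (M i)) (X v)) sums P' (\<Union>i. A.preim (M i)) (X v)"
        using H by (intro B.P_sums[OF _ d]) auto
      ultimately show "X (P (A.preim (\<Union>i. M i)) v) = P' (A.preim (\<Union>i. M i)) (X v)"
        unfolding u union(3)[rule_format] by (rule sums_unique2)
    qed
  qed
  then show ?thesis using M(2) by simp
qed

section \<open>Uniqueness and the characterization of the left multiplication\<close>

lemma iqpvm_iff:
  assumes "\<iota> \<in> imag_units"
  shows "iqPVM \<iota> P L \<longleftrightarrow> iqpvm \<iota> P L"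
  using assms
  by (auto simp: iqPVM_def iqpvm_def qpvm_def iqpvm_axioms_def fun_eq_iff)

text \<open>Boundedness of the support is implicit in the locale: an integrable function is bounded,
  and \<open>on_supp\<close> is the identity on the support.\<close>

lemma spectral_iqpvm_iff:
  assumes "\<iota> \<in> imag_units"
  shows "iqPVM \<iota> P L \<and> bounded (qsupp \<iota> P) \<and> T = qint \<iota> P L (\<lambda>x. x) \<longleftrightarrow> spectral_iqpvm \<iota> P L T"
proof
  assume H: "iqPVM \<iota> P L \<and> bounded (qsupp \<iota> P) \<and> T = qint \<iota> P L (\<lambda>x. x)"
  then interpret iqpvm \<iota> P L using iqpvm_iff[OF assms] by blast
  show "spectral_iqpvm \<iota> P L T" using H qint_iff by unfold_locales blast
next
  assume "spectral_iqpvm \<iota> P L T"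
  then interpret spectral_iqpvm \<iota> P L T .
  obtain R where "R > 0" "\<And>x. x \<in> supp \<Longrightarrow> norm x \<le> R" by (rule supp_bounded) blast
  then have b: "bounded supp" unfolding bounded_iff by blast
  have "iqPVM \<iota> P L" using iqpvm_iff[OF assms] iqpvm_axioms by blast
  then show "iqPVM \<iota> P L \<and> bounded (qsupp \<iota> P) \<and> T = qint \<iota> P L (\<lambda>x. x)"
    using b qint_iff[OF b] T_int by blast
qed

theorem spectral_measure_unique:
  assumes 1: "spectral_iqpvm \<iota> P L T" and 2: "spectral_iqpvm \<iota> P' L' T"
    and E: "E \<in> sets (half_plane_borel \<iota>)"
  shows "P E = P' E"
  using intertwine[OF 1 2 bounded_linear_ident _ _ E] by (simp add: fun_eq_iff)

text \<open>\<open>P\<close> and \<open>P'\<close> are total functions that agree on Borel sets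
  only, so exchanging them is not a mere rewriting: the support and all simple integrals have to be
  compared.\<close>

lemma spectral_iqpvm_cong:
  assumes 1: "spectral_iqpvm \<iota> P L T" and 2: "spectral_iqpvm \<iota> P' L' T"
  shows "spectral_iqpvm \<iota> P L' T"
proof -
  interpret A: spectral_iqpvm \<iota> P L T by (rule 1)
  interpret B: spectral_iqpvm \<iota> P' L' T by (rule 2)
  have eq: "P E = P' E" if "E \<in> A.HB" for E by (rule spectral_measure_unique[OF 1 2 that])
  interpret C: iqpvm \<iota> P L'
    by unfold_locales (simp_all add: B.left eq B.comm_PL)
  have supp: "A.supp = B.supp"
    using eq openin_half_plane_borel[OF A.iota] unfolding qsupp_def by (metis (mono_tags, lifting))
  have si: "C.si s u = B.si s u" if "A.simple s" for s u
    unfolding simple_qint_def by (simp add: eq[OF A.fib_HB[OF that]])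
  have "C.is_int B.on_supp T"
    using B.T_int unfolding C.int_iff B.int_iff by (simp add: si cong: conj_cong)
  then show ?thesis by unfold_locales (simp add: supp)
qed

context spectral_iqpvm
begin

lemma measurable_qRe_supp: "(\<lambda>x. if x \<in> supp then qRe x else 0) \<in> borel_measurable (half_plane_borel \<iota>)"
  unfolding qRe_eq_inner by (rule measurable_on_HP[OF supp_HB]) measurable

lemma measurable_im_supp: "(\<lambda>x. if x \<in> supp then inner \<iota> x else 0) \<in> borel_measurable (half_plane_borel \<iota>)"
  by (rule measurable_on_HP[OF supp_HB]) measurable

lemma T_add: "T (u + v) = T u + T v" and T_diff: "T (u - v) = T u - T v"
  and T_neg: "T (- u) = - T u" and T_scaleR: "T (r *\<^sub>R u) = r *\<^sub>R T u"
  using bounded_linear.linear[OF bounded_op_bl[OF T_bop]]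
  by (simp_all add: linear_add linear_diff linear_neg linear_scale)

lemma adj_bop: "bounded_op (adj T)" and adj_inner: "inner (adj T u) v = inner u (T v)"
  using adj_properties[OF T_bop] by auto

lemma adj_add: "adj T (u + v) = adj T u + adj T v" and adj_diff: "adj T (u - v) = adj T u - adj T v"
  and adj_neg: "adj T (- u) = - adj T u" and adj_scaleR: "adj T (r *\<^sub>R u) = r *\<^sub>R adj T u"
  using bounded_linear.linear[OF bounded_op_bl[OF adj_bop]]
  by (simp_all add: linear_add linear_diff linear_neg linear_scale)

lemma L_minus: "L (- q) u = - L q u"
  using L_diff[of 0 q u] by (simp add: L_zero)

lemma L_linear: "L q (u + v) = L q u + L q v" "L q (u - v) = L q u - L q v" "L q (- u) = - L q u"
  "L q (r *\<^sub>R u) = r *\<^sub>R L q u"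
  using bounded_linear.linear[OF L_bl]
  by (simp_all add: linear_add linear_diff linear_neg linear_scale)

lemma L_cplane: "L (of_real a + \<iota> * of_real b) u = a *\<^sub>R u + b *\<^sub>R L \<iota> u"
  by (simp add: L_add L_mult[symmetric] L_of_real L_linear)

lemma left_commute: "L \<iota> (T u) = T (L \<iota> u)"
proof -
  have "is_int (\<lambda>x. on_supp x * \<iota>) (\<lambda>u. L \<iota> (T u))"
    by (rule int_cong[OF int_mult[OF int_const T_int]]) (auto simp: half_plane_commute[OF iota])
  from int_unique[OF this int_mult[OF T_int int_const]] show ?thesis by metis
qed

lemma left_anticommute:
  assumes "\<iota> * \<kappa> = - (\<kappa> * \<iota>)"
  shows "L \<kappa> (T u) = adj T (L \<kappa> u)"
proof -
  have "is_int (\<lambda>x. qcnj (on_supp x) * \<kappa>) (\<lambda>u. L \<kappa> (T u))"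
    by (rule int_cong[OF int_mult[OF int_const T_int]]) (auto simp: half_plane_anticommute[OF iota _ assms])
  from int_unique[OF this int_mult[OF T_cnj int_const]] show ?thesis by metis
qed

lemma ImT_selfadj: "selfadj ImT" and ImT_nonneg: "inner u (ImT u) \<ge> 0"
proof -
  show "selfadj ImT" by (rule int_real_selfadj[OF ImT_int])
  show "inner u (ImT u) \<ge> 0"
    using half_plane_iff[OF iota] by (intro int_real_nonneg[OF ImT_int measurable_im_supp]) auto
qed

lemma ImT_square: "ImT (ImT u) = SqT u"
proof -
  have "is_int (\<lambda>x. of_real (if x \<in> supp then (inner \<iota> x)\<^sup>2 else 0)) (\<lambda>u. ImT (ImT u))"
    by (rule int_cong[OF int_mult[OF ImT_int ImT_int]]) (simp add: power2_eq_square)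
  from int_unique[OF this SqT_int] show ?thesis by metis
qed

lemma ImT_commute: "ImT (T u) = T (ImT u)" "ImT (adj T u) = adj T (ImT u)"
proof -
  have "is_int (\<lambda>x. on_supp x * of_real (if x \<in> supp then inner \<iota> x else 0)) (\<lambda>u. ImT (T u))"
    by (rule int_cong[OF int_mult[OF ImT_int T_int]]) (simp add: quat_of_real_commute)
  from int_unique[OF this int_mult[OF T_int ImT_int]] show "ImT (T u) = T (ImT u)" by metis
  have "is_int (\<lambda>x. qcnj (on_supp x) * of_real (if x \<in> supp then inner \<iota> x else 0)) (\<lambda>u. ImT (adj T u))"
    by (rule int_cong[OF int_mult[OF ImT_int T_cnj]]) (simp add: quat_of_real_commute)
  from int_unique[OF this int_mult[OF T_cnj ImT_int]] show "ImT (adj T u) = adj T (ImT u)" by metis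
qed

lemma SqT_alt: "SqT u = (-1/4) *\<^sub>R (T (T u - adj T u) - adj T (T u - adj T u))"
  by (simp add: SqT_def)

end

text \<open>The imaginary part is the integral of a real function, hence the same for both
  multiplications, so \<open>Y = L \<iota> - L' \<iota>\<close> vanishes on the range of
  \<open>T - adj T\<close>. Both operators being skew, \<open>Y\<close> takes values in the kernel
  of \<open>T - adj T\<close>. For \<open>u\<close> orthogonal to that kernel,
  \<open>inner (Y (Y u)) u = 0\<close>, which says \<open>Y u = 0\<close>.\<close>

theorem left_mult_unique:
  assumes 1: "spectral_iqpvm \<iota> P L T" and 2: "spectral_iqpvm \<iota> P' L' T"
    and q: "q \<in> cplane \<iota>" and u: "u \<in> ortho_compl (ker (\<lambda>v. T v - adj T v))"
  shows "L q u = L' q u"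
proof -
  interpret A: spectral_iqpvm \<iota> P L T by (rule 1)
  interpret B: spectral_iqpvm \<iota> P L' T by (rule spectral_iqpvm_cong[OF 1 2])
  let ?B = "\<lambda>v. T v - adj T v"
  have "B.is_int (\<lambda>x. of_real (if x \<in> A.supp then inner \<iota> x else 0)) A.ImT"
    by (rule int_real_indep[OF A.iqpvm_axioms B.iqpvm_axioms A.ImT_int A.measurable_im_supp])
  then have "A.ImT = B.ImT" by (rule B.int_unique[OF _ B.ImT_int])
  then have LB: "L \<iota> (?B v) = L' \<iota> (?B v)" for v
    by (simp add: A.ImT_def B.ImT_def fun_eq_iff)
  define Y where "Y v = L \<iota> v - L' \<iota> v" for v
  have Y': "inner (Y v) w = - inner v (Y w)" for v w
    using A.L_inner[of \<iota> v w] B.L_inner[of \<iota> v w]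
    by (simp add: Y_def inner_diff_left inner_diff_right imag_units_cnj[OF A.iota] A.L_minus B.L_minus)
  have "inner (?B (Y w)) v = 0" for v w
  proof -
    have "inner (?B (Y w)) v = inner (Y w) (adj T v - T v)"
      using A.adj_inner[of v "Y w"] A.adj_inner[of "Y w" v]
      by (simp add: inner_diff_left inner_diff_right inner_commute)
    also have "\<dots> = - inner (Y w) (?B v)" by (simp add: inner_diff_right)
    also have "\<dots> = inner w (Y (?B v))" by (simp add: Y')
    finally show ?thesis by (simp add: Y_def LB)
  qed
  from this[of _ "?B (Y _)"] have BY: "?B (Y w) = 0" for w by (metis inner_eq_zero_iff)
  have "qinner (Y (Y u)) u = 0" using u BY by (simp add: ortho_compl_def ker_def)
  then have "inner (Y (Y u)) u = 0" by (simp add: inner_conv_qinner)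
  then have "inner (Y u) (Y u) = 0" using Y'[of "Y u" u] by simp
  then have "L \<iota> u = L' \<iota> u" by (simp add: Y_def)
  moreover obtain a b where "q = of_real a + \<iota> * of_real b" using q by (auto simp: cplane_def)
  ultimately show ?thesis by (simp add: A.L_cplane B.L_cplane)
qed

section \<open>Units anticommuting with \<open>\<iota>\<close> and the splitting of the
  quaternions\<close>

lemma anticommute_iff:
  assumes "\<iota> \<in> imag_units" "\<kappa> \<in> imag_units"
  shows "\<iota> * \<kappa> = - (\<kappa> * \<iota>) \<longleftrightarrow> inner \<iota> \<kappa> = 0"
  using assms by (auto simp: imag_units_iff quat_eq_iff inner_quat_def algebra_simps)

lemma ex_anticommuting_unit:
  assumes i: "\<iota> \<in> imag_units"
  obtains \<kappa> where "\<kappa> \<in> imag_units" "\<iota> * \<kappa> = - (\<kappa> * \<iota>)"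
proof -
  have "\<exists>v. v \<noteq> 0 \<and> qRe v = 0 \<and> inner \<iota> v = 0"
  proof (cases "qIm1 \<iota> = 0 \<and> qIm2 \<iota> = 0")
    case True
    then show ?thesis by (intro exI[of _ "Quat 0 1 0 0"]) (simp add: inner_quat_def quat_eq_iff)
  next
    case False
    then show ?thesis
      by (intro exI[of _ "Quat 0 (qIm2 \<iota>) (- qIm1 \<iota>) 0"]) (auto simp: inner_quat_def quat_eq_iff)
  qed
  then obtain v where v: "v \<noteq> 0" "qRe v = 0" "inner \<iota> v = 0" by blast
  have "(1 / norm v) *\<^sub>R v \<in> imag_units" using v by (simp add: imag_units_iff)
  moreover have "\<iota> * ((1 / norm v) *\<^sub>R v) = - (((1 / norm v) *\<^sub>R v) * \<iota>)"
    using anticommute_iff[OF i calculation] v(3) by simp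
  ultimately show ?thesis by (rule that)
qed

lemma commutant_imag_unit:
  assumes i: "\<iota> \<in> imag_units" and p: "p * \<iota> = \<iota> * p"
  shows "p = of_real (qRe p) + \<iota> * of_real (inner \<iota> p)"
proof -
  let ?a = "qIm1 \<iota>" and ?b = "qIm2 \<iota>" and ?c = "qIm3 \<iota>"
  have re: "qRe \<iota> = 0" and n: "?a * ?a + ?b * ?b + ?c * ?c = 1"
    using i norm_quat_sq[of \<iota>] by (simp_all add: imag_units_iff)
  \<comment> \<open>The cross product of the imaginary parts of \<open>p\<close> and
    \<open>\<iota>\<close> vanishes, so they are parallel.\<close>
  have e: "qIm2 p * ?c = qIm3 p * ?b" "qIm3 p * ?a = qIm1 p * ?c" "qIm1 p * ?b = qIm2 p * ?a"
    using p re by (simp_all add: quat_eq_iff algebra_simps)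
  have "qIm1 p = qIm1 p * (?a * ?a + ?b * ?b + ?c * ?c)" "qIm2 p = qIm2 p * (?a * ?a + ?b * ?b + ?c * ?c)"
    "qIm3 p = qIm3 p * (?a * ?a + ?b * ?b + ?c * ?c)" using n by simp_all
  moreover have "qIm1 p * (?a * ?a + ?b * ?b + ?c * ?c) = ?a * (?a * qIm1 p + ?b * qIm2 p + ?c * qIm3 p)"
    using e by algebra
  moreover have "qIm2 p * (?a * ?a + ?b * ?b + ?c * ?c) = ?b * (?a * qIm1 p + ?b * qIm2 p + ?c * qIm3 p)"
    using e by algebra
  moreover have "qIm3 p * (?a * ?a + ?b * ?b + ?c * ?c) = ?c * (?a * qIm1 p + ?b * qIm2 p + ?c * qIm3 p)"
    using e by algebra
  ultimately show ?thesis using re by (simp add: quat_eq_iff inner_quat_def)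
qed

lemma cplane_decomposition:
  assumes i: "\<iota> \<in> imag_units" and k: "\<kappa> \<in> imag_units" "\<iota> * \<kappa> = - (\<kappa> * \<iota>)"
  obtains a b c d where "q = (of_real a + \<iota> * of_real b) + (of_real c + \<iota> * of_real d) * \<kappa>"
proof -
  \<comment> \<open>\<open>q1\<close> and \<open>r\<close> are the parts of \<open>q\<close> that
    commute and anticommute with \<open>\<iota>\<close>. Multiplying the second by
    \<open>\<kappa>\<close> makes it commute as well, so both parts are governed by the plane of
    \<open>\<iota>\<close>.\<close>
  define q1 where "q1 = (1/2) *\<^sub>R (q - \<iota> * q * \<iota>)"
  define r where "r = (1/2) *\<^sub>R (q + \<iota> * q * \<iota>)"
  define q2 where "q2 = - (r * \<kappa>)"
  have ii: "\<iota> * (\<iota> * x) = - x" "x * \<iota> * \<iota> = - x" for x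
    using imag_units_square[OF i] by (simp_all add: mult.assoc) (simp add: mult.assoc[symmetric])
  have "q1 * \<iota> = \<iota> * q1"
    by (simp add: q1_def left_diff_distrib right_diff_distrib mult.assoc ii imag_units_square[OF i])
  moreover have r: "r * \<iota> = - (\<iota> * r)"
    by (simp add: r_def distrib_left distrib_right mult.assoc ii imag_units_square[OF i]
        scaleR_right_distrib[symmetric] scaleR_minus_right[symmetric] del: scaleR_minus_right)
  moreover have "q2 * \<iota> = \<iota> * q2"
  proof -
    have "q2 * \<iota> = r * (- (\<kappa> * \<iota>))" by (simp add: q2_def mult.assoc)
    also have "\<dots> = (r * \<iota>) * \<kappa>" by (simp add: k(2)[symmetric] mult.assoc)
    finally show ?thesis by (simp add: r q2_def mult.assoc)
  qed
  moreover have "q = q1 + q2 * \<kappa>"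
  proof -
    have "q2 * \<kappa> = r" by (simp add: q2_def mult.assoc imag_units_square[OF k(1)])
    moreover have "q1 + r = q" by (simp add: q1_def r_def scaleR_right_diff_distrib scaleR_right_distrib
          scaleR_left_distrib[symmetric])
    ultimately show ?thesis by simp
  qed
  ultimately show ?thesis
    using that[of "qRe q1" "inner \<iota> q1" "qRe q2" "inner \<iota> q2"] commutant_imag_unit[OF i] by metis
qed

section \<open>Which left multiplications represent \<open>T\<close>\<close>

theorem left_mult_conditions:
  assumes "spectral_iqpvm \<iota> P L T"
  shows "L \<iota> \<circ> T = T \<circ> L \<iota>"
    and "\<exists>\<kappa>\<in>imag_units. \<iota> * \<kappa> = - (\<kappa> * \<iota>) \<and> L \<kappa> \<circ> T = adj T \<circ> L \<kappa>"
    and "positive_op (\<lambda>u. - L \<iota> (T u - adj T u))"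
proof -
  interpret spectral_iqpvm \<iota> P L T by fact
  show "L \<iota> \<circ> T = T \<circ> L \<iota>" using left_commute by (simp add: fun_eq_iff)
  obtain \<kappa> where k: "\<kappa> \<in> imag_units" "\<iota> * \<kappa> = - (\<kappa> * \<iota>)" by (rule ex_anticommuting_unit[OF iota])
  then show "\<exists>\<kappa>\<in>imag_units. \<iota> * \<kappa> = - (\<kappa> * \<iota>) \<and> L \<kappa> \<circ> T = adj T \<circ> L \<kappa>"
    using left_anticommute[OF k(2)] by (auto simp: fun_eq_iff)
  have e: "(\<lambda>u. - L \<iota> (T u - adj T u)) = (\<lambda>u. 2 *\<^sub>R ImT u)"
    by (simp add: ImT_def fun_eq_iff)
  have b: "bounded_op (\<lambda>u. 2 *\<^sub>R ImT u)" by (intro bounded_op_scaleR int_bop[OF ImT_int])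
  show "positive_op (\<lambda>u. - L \<iota> (T u - adj T u))"
    unfolding e positive_op_iff[OF b] using selfadj_scaleR[OF ImT_selfadj] ImT_nonneg by simp
qed

text \<open>Commutation with \<open>P\<close> comes from \<open>intertwine\<close>, and
  \<open>L \<iota>\<close>, \<open>L \<kappa>\<close> generate all \<open>L q\<close> over the
  reals. The positivity condition then identifies the imaginary part formed with \<open>L\<close>
  with the one formed with \<open>L0\<close>, and \<open>T\<close> is reassembled from its two real
  integrals.\<close>

theorem left_mult_characterization:
  assumes S: "spectral_iqpvm \<iota> P L0 T" and L: "left_scalar_mult L"
    and c1: "L \<iota> \<circ> T = T \<circ> L \<iota>"
    and k: "\<kappa> \<in> imag_units" "\<iota> * \<kappa> = - (\<kappa> * \<iota>)" and c2: "L \<kappa> \<circ> T = adj T \<circ> L \<kappa>"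
    and c3: "positive_op (\<lambda>u. - L \<iota> (T u - adj T u))"
  shows "spectral_iqpvm \<iota> P L T"
proof -
  interpret A: spectral_iqpvm \<iota> P L0 T by fact
  note i = A.iota
  have bop: "bounded_op (L q)" for q by (rule lsm_bounded_op[OF L])
  have lin: "L q (u + v) = L q u + L q v" "L q (u - v) = L q u - L q v" "L q (- u) = - L q u"
    "L q (r *\<^sub>R u) = r *\<^sub>R L q u" for q u v r
    using bounded_linear.linear[OF bounded_op_bl[OF bop]]
    by (simp_all add: linear_add linear_diff linear_neg linear_scale)
  have sq: "L p (L p u) = - u" if "p \<in> imag_units" for p u
    using lsm_mult[OF L, of p p u] lsm_of_real[OF L, of "-1" u] imag_units_square[OF that] by simp
  have i1: "L \<iota> (T u) = T (L \<iota> u)" for u using c1 by (metis comp_apply)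
  have k1: "L \<kappa> (T u) = adj T (L \<kappa> u)" for u using c2 by (metis comp_apply)
  have Li: "inner (L \<iota> u) v = - inner u (L \<iota> v)" for u v
  proof -
    have "L (qcnj \<iota>) v = - L \<iota> v"
      using lsm_mult[OF L, of \<iota> "of_real (-1)" v] imag_units_cnj[OF i] lsm_of_real[OF L, of "-1" v] lin(3)
      by simp
    then show ?thesis by (simp add: lsm_inner[OF L])
  qed
  have i2: "L \<iota> (adj T u) = adj T (L \<iota> u)" for u
  proof (rule vector_eq_rdot[THEN iffD1], rule allI)
    fix v
    show "inner (L \<iota> (adj T u)) v = inner (adj T (L \<iota> u)) v"
      by (simp add: Li A.adj_inner i1)
  qed
  have k2: "L \<kappa> (adj T u) = T (L \<kappa> u)" for u
  proof -
    have "L \<kappa> (adj T (L \<kappa> (- L \<kappa> u))) = L \<kappa> (L \<kappa> (T (- L \<kappa> u)))" by (simp only: k1)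
    then show ?thesis by (simp add: lin sq[OF k(1)] A.T_neg)
  qed
  \<comment> \<open>\<open>L \<iota>\<close> commutes with \<open>T\<close> and
    \<open>adj T\<close>, and \<open>L \<kappa>\<close> exchanges them; real part and squared
    imaginary part are invariant under the exchange.\<close>
  have comm_P: "L p (P E u) = P E (L p u)" if E: "E \<in> A.HB" and p: "p = \<iota> \<or> p = \<kappa>" for p E u
  proof (rule intertwine[OF S S bounded_op_bl[OF bop] _ _ E])
    fix u
    show "L p (A.ReT u) = A.ReT (L p u)"
      using p by (auto simp: A.ReT_def lin i1 i2 k1 k2 add.commute)
    show "L p (A.SqT u) = A.SqT (L p u)"
      using p
    proof
      assume "p = \<iota>"
      then show ?thesis by (simp add: A.SqT_alt lin i1 i2)
    next
      assume "p = \<kappa>"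
      then show ?thesis
        by (simp add: A.SqT_alt lin k1 k2 A.T_diff A.adj_diff algebra_simps)
    qed
  qed
  interpret N: iqpvm \<iota> P L
  proof unfold_locales
    show "left_scalar_mult L" by (rule L)
    fix E q u assume E: "E \<in> A.HB"
    interpret PE: bounded_linear "P E" by (rule A.P_bl[OF E])
    obtain a b c d where q: "q = (of_real a + \<iota> * of_real b) + (of_real c + \<iota> * of_real d) * \<kappa>"
      by (rule cplane_decomposition[OF i k])
    have Lq: "L q v = (a *\<^sub>R v + L \<iota> (b *\<^sub>R v)) + (c *\<^sub>R L \<kappa> v + L \<iota> (d *\<^sub>R L \<kappa> v))" for v
      unfolding q by (simp only: lsm_add[OF L] lsm_mult[OF L, symmetric] lsm_of_real[OF L])
    show "P E (L q u) = L q (P E u)"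
      unfolding Lq using comm_P[OF E, of \<iota>] comm_P[OF E, of \<kappa>] by (simp add: PE.add PE.scaleR lin)
  qed
  define D where "D u = (1/2) *\<^sub>R (- L \<iota> (T u - adj T u))" for u
  have bD: "bounded_op (\<lambda>u. - L \<iota> (T u - adj T u))"
  proof -
    have "bounded_op (\<lambda>u. (-1) *\<^sub>R L \<iota> (T u - adj T u))"
      by (intro bounded_op_scaleR bounded_op_comp[OF bop] bounded_op_diff A.T_bop A.adj_bop)
    then show ?thesis by simp
  qed
  have D: "selfadj D" "inner u (D u) \<ge> 0" for u
    using c3 selfadj_scaleR[of "\<lambda>u. - L \<iota> (T u - adj T u)" "1/2"]
    unfolding positive_op_iff[OF bD] D_def[abs_def] by (auto simp: inner_scaleR_right)
  let ?f = "\<lambda>x. of_real (if x \<in> A.supp then qRe x else 0)"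
  let ?g = "\<lambda>x. of_real (if x \<in> A.supp then inner \<iota> x else 0)"
  have Nf: "N.is_int ?f A.ReT"
    by (rule int_real_indep[OF A.iqpvm_axioms N.iqpvm_axioms A.ReT_int A.measurable_qRe_supp])
  have Ng: "N.is_int ?g A.ImT"
    by (rule int_real_indep[OF A.iqpvm_axioms N.iqpvm_axioms A.ImT_int A.measurable_im_supp])
  have CL: "A.ImT (L \<iota> u) = L \<iota> (A.ImT u)" for u
  proof -
    have "N.is_int (\<lambda>x. \<iota> * ?g x) (\<lambda>u. A.ImT (L \<iota> u))"
      by (rule N.int_cong[OF N.int_mult[OF Ng N.int_const]]) (simp add: quat_of_real_commute)
    from N.int_unique[OF this N.int_mult[OF N.int_const Ng]] show ?thesis by metis
  qed
  have CD: "A.ImT (D u) = D (A.ImT u)" for u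
  proof -
    interpret C: bounded_linear A.ImT by (rule selfadj_bl[OF A.ImT_selfadj])
    show ?thesis
      unfolding D_def by (simp only: C.scaleR linear_neg[OF C.linear] CL C.diff A.ImT_commute)
  qed
  have "D (D u) = A.SqT u" for u
    unfolding D_def A.SqT_alt
    by (simp add: lin i1[symmetric] i2[symmetric] sq[OF i] A.T_diff A.adj_diff A.T_neg A.adj_neg
        A.T_scaleR A.adj_scaleR algebra_simps)
  then have "A.ImT (A.ImT u) = D (D u)" for u by (simp add: A.ImT_square)
  \<comment> \<open>\<open>D\<close> and \<open>ImT\<close> are commuting positive roots of
    \<open>SqT\<close>.\<close>
  then have CDeq: "A.ImT u = D u" for u
    by (rule positive_sqrt_unique[OF A.ImT_selfadj A.ImT_nonneg D, rotated]) (simp add: CD)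
  have T: "A.ReT u + L \<iota> (A.ImT u) = T u" for u
    by (simp add: CDeq D_def A.ReT_def lin sq[OF i] scaleR_right_distrib[symmetric] del: scaleR_right_distrib)
  have "N.is_int (\<lambda>x. ?f x + \<iota> * ?g x) (\<lambda>u. A.ReT u + L \<iota> (A.ImT u))"
    by (rule N.int_add[OF Nf N.int_mult[OF N.int_const Ng]])
  then have "N.is_int (\<lambda>x. ?f x + \<iota> * ?g x) T" by (simp only: T)
  then have "N.is_int A.on_supp T"
  proof (rule N.int_cong)
    fix x
    show "?f x + \<iota> * ?g x = A.on_supp x"
      using half_plane_iff[OF i, of x] A.supp_HP[of x] by auto
  qed
  then show ?thesis by unfold_locales
qed

section \<open>Construction of the left multiplication\<close>

definition qreal :: "quat \<Rightarrow> bool" where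
  "qreal q \<longleftrightarrow> q = of_real (qRe q)"

lemma qreal_of_real [simp]: "qreal (of_real r)"
  by (simp add: qreal_def)

lemma qreal_simps: "qreal 0" "qreal p \<Longrightarrow> qreal q \<Longrightarrow> qreal (p + q)"
  by (auto simp: qreal_def quat_eq_iff)

lemma qreal_commute: "qreal r \<Longrightarrow> r * q = q * r"
  unfolding qreal_def using quat_of_real_commute by metis

lemma closed_qreal: "closed {v. qreal (qinner (u::'h::quat_hilbert) v)}"
proof -
  interpret bounded_linear "qinner u" by (rule bounded_linear_qinner)
  have "qreal (qinner u v) \<longleftrightarrow> qinner u v = of_real (inner u v)" for v
    by (simp add: qreal_def inner_conv_qinner)
  moreover have "closed {v. qinner u v = of_real (inner u v)}"
    by (intro closed_Collect_eq continuous_on continuous_intros)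
  ultimately show ?thesis by simp
qed

lemma qreal_qinner_selfadj:
  assumes R: "bounded_op R" "selfadj R"
  shows "qreal (qinner u (R u))"
proof -
  have "qinner (R u) u = qinner u (R u)"
    by (rule qinner_adjointI[OF R(1)]) (rule selfadj_inner[OF R(2)])
  then have "qcnj (qinner u (R u)) = qinner u (R u)" using qinner_commute by metis
  then show ?thesis by (simp add: qreal_def quat_eq_iff)
qed

text \<open>Real coefficients commute with \<open>q\<close>, so \<open>q\<close> can be moved to the
  right end of every summand.\<close>

lemma (in onb) left_mult_real:
  assumes "\<And>z. z \<in> N \<Longrightarrow> qreal (qinner z x)"
  shows "left_mult_of N q x = x *\<^sub>H q"
proof -
  have L: "left_scalar_mult (left_mult_of N)" using basis by (auto simp: left_scalar_mult_def)
  have "((\<lambda>z. summand 1 x z *\<^sub>H q) has_sum left_mult_of N 1 x *\<^sub>H q) N"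
    using has_sum_bounded_linear[OF bounded_linear_qscale left_mult_sums] by (simp add: o_def)
  moreover have "summand 1 x z *\<^sub>H q = summand q x z" if "z \<in> N" for z
    using qreal_commute[OF assms[OF that], of q] by (simp add: qscale_assoc)
  ultimately have "(summand q x has_sum left_mult_of N 1 x *\<^sub>H q) N"
    using has_sum_cong[of N "\<lambda>z. summand 1 x z *\<^sub>H q" "summand q x"] by simp
  then have "left_mult_of N q x = left_mult_of N 1 x *\<^sub>H q" by (rule left_mult_eqI)
  then show ?thesis by (simp add: lsm_one[OF L])
qed

lemma closure_subspace_mem:
  "linear f \<Longrightarrow> continuous_on UNIV f \<Longrightarrow> (\<And>x. x \<in> M \<Longrightarrow> f x \<in> closure M') \<Longrightarrow> x \<in> closure M \<Longrightarrow> f x \<in> closure M'"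
  using image_closure_subset[of M f "closure M'"] continuous_on_subset[of UNIV f "closure M"] by blast

lemma subspace_fin_span:
  fixes N :: "'h::quat_hilbert set"
  shows "subspace {\<Sum>z\<in>F. z *\<^sub>H c z | F c. finite F \<and> F \<subseteq> N}" (is "subspace ?D")
proof (rule subspaceI)
  show "0 \<in> ?D" by (intro CollectI exI[of _ "{}"]) simp
next
  fix x y assume "x \<in> ?D" "y \<in> ?D"
  then obtain F c G d where F: "finite F" "F \<subseteq> N" "x = (\<Sum>z\<in>F. z *\<^sub>H c z)"
    and G: "finite G" "G \<subseteq> N" "y = (\<Sum>z\<in>G. z *\<^sub>H d z)" by blast
  have "x = (\<Sum>z\<in>F \<union> G. z *\<^sub>H (if z \<in> F then c z else 0))"
    unfolding F(3) using F G by (intro sum.mono_neutral_cong_left) auto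
  moreover have "y = (\<Sum>z\<in>F \<union> G. z *\<^sub>H (if z \<in> G then d z else 0))"
    unfolding G(3) using F G by (intro sum.mono_neutral_cong_left) auto
  ultimately have "x + y = (\<Sum>z\<in>F \<union> G. z *\<^sub>H ((if z \<in> F then c z else 0) + (if z \<in> G then d z else 0)))"
    by (simp only: qscale_add_right sum.distrib)
  then show "x + y \<in> ?D" using F G
    by (intro CollectI exI[of _ "F \<union> G"] exI[of _ "\<lambda>z. (if z \<in> F then c z else 0) + (if z \<in> G then d z else 0)"]) simp
next
  fix x and r :: real assume "x \<in> ?D"
  then obtain F c where F: "finite F" "F \<subseteq> N" "x = (\<Sum>z\<in>F. z *\<^sub>H c z)" by blast
  have "r *\<^sub>R x = (\<Sum>z\<in>F. z *\<^sub>H (c z * of_real r))"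
    unfolding F(3) scaleR_sum_right by (simp add: scaleR_conv_qscale qscale_assoc)
  then show "r *\<^sub>R x \<in> ?D" using F by (intro CollectI exI[of _ F] exI[of _ "\<lambda>z. c z * of_real r"]) simp
qed

section \<open>Real forms adapted to the polar decomposition of the skew part\<close>

locale polar_triple =
  fixes \<iota> :: quat and A B C :: "'h::quat_hilbert \<Rightarrow> 'h"
  assumes iota: "\<iota> \<in> imag_units"
    and A: "bounded_op A" "selfadj A" and C: "bounded_op C" "selfadj C"
    and B: "bounded_op B" "\<And>u v. inner (B u) v = - inner u (B v)"
    and AB: "\<And>u. A (B u) = B (A u)" and AC: "\<And>u. A (C u) = C (A u)" and BC: "\<And>u. B (C u) = C (B u)"
    and CC: "\<And>u. C (C u) = - B (B u)"
begin

sublocale A: bounded_linear A by (rule bounded_op_bl[OF A(1)])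
sublocale B: bounded_linear B by (rule bounded_op_bl[OF B(1)])
sublocale C: bounded_linear C by (rule bounded_op_bl[OF C(1)])

lemmas Aq = bounded_op_qscale[OF A(1)] and Bq = bounded_op_qscale[OF B(1)] and Cq = bounded_op_qscale[OF C(1)]

text \<open>Real subspaces on which \<open>A\<close>, \<open>B\<close>, \<open>C\<close> are given by matrices with entries in the plane of \<open>\<iota>\<close>,
  with \<open>A\<close> and \<open>C\<close> real. A maximal one spans the whole space over the quaternions.\<close>

definition real_form :: "'h set \<Rightarrow> bool" where
  "real_form M \<longleftrightarrow> subspace M \<and> (\<forall>x\<in>M. A x \<in> M \<and> C x \<in> M \<and> B x = C x *\<^sub>H \<iota>) \<and>
    (\<forall>x\<in>M. \<forall>y\<in>M. qreal (qinner x y))"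

lemma real_form_closure:
  assumes M: "real_form M"
  shows "real_form (closure M)"
  unfolding real_form_def
proof (intro conjI ballI)
  have s: "subspace M" and inv: "\<And>x. x \<in> M \<Longrightarrow> A x \<in> M \<and> C x \<in> M \<and> B x = C x *\<^sub>H \<iota>"
    and re: "\<And>x y. x \<in> M \<Longrightarrow> y \<in> M \<Longrightarrow> qreal (qinner x y)"
    using M by (auto simp: real_form_def)
  note cl = subsetD[OF closure_subset]
  show "subspace (closure M)" by (rule closure_subspace[OF s])
  fix x assume x: "x \<in> closure M"
  show "A x \<in> closure M"
    by (rule closure_subspace_mem[OF A.linear A.continuous_on[OF continuous_on_id] _ x]) (use inv cl in blast)
  show "C x \<in> closure M"
    by (rule closure_subspace_mem[OF C.linear C.continuous_on[OF continuous_on_id] _ x]) (use inv cl in blast)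
  have "closed {x. B x = C x *\<^sub>H \<iota>}"
    by (intro closed_Collect_eq B.continuous_on C.continuous_on bounded_linear.continuous_on[OF bounded_linear_qscale]
        continuous_on_id)
  then have "closure M \<subseteq> {x. B x = C x *\<^sub>H \<iota>}" using inv by (intro closure_minimal) auto
  then show "B x = C x *\<^sub>H \<iota>" using x by blast
  fix y assume y: "y \<in> closure M"
  have 1: "qreal (qinner z y)" if z: "z \<in> M" for z
  proof -
    have "closure M \<subseteq> {v. qreal (qinner z v)}" using re[OF z] by (intro closure_minimal closed_qreal) auto
    then show ?thesis using y by blast
  qed
  have 2: "qreal (qinner z w) \<Longrightarrow> qreal (qinner w z)" for z w
    using qinner_commute[of w z] by (metis qreal_def qcnj_of_real)
  have "closure M \<subseteq> {v. qreal (qinner y v)}" using 1 2 by (intro closure_minimal closed_qreal) auto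
  then show "qreal (qinner x y)" using x 2 by blast
qed

lemma ex_maximal_real_form:
  obtains M where "real_form M" "\<And>M'. real_form M' \<Longrightarrow> M \<subseteq> M' \<Longrightarrow> M' = M"
proof -
  have "real_form {0}" by (simp add: real_form_def subspace_single_0 A.zero B.zero C.zero qreal_simps)
  then have ne: "{M. real_form M} \<noteq> {}" by blast
  have "\<Union>Ch \<in> {M. real_form M}" if Ch: "Ch \<noteq> {}" "subset.chain {M. real_form M} Ch" for Ch
  proof -
    have R: "real_form M" if "M \<in> Ch" for M using Ch(2) that by (auto simp: subset_chain_def)
    have two: "\<exists>M\<in>Ch. x \<in> M \<and> y \<in> M" if xy: "x \<in> \<Union>Ch" "y \<in> \<Union>Ch" for x y
    proof -
      obtain X Y where XY: "X \<in> Ch" "Y \<in> Ch" "x \<in> X" "y \<in> Y" using xy by blast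
      then have "X \<subseteq> Y \<or> Y \<subseteq> X" using Ch(2) by (auto simp: subset_chain_def)
      then show ?thesis using XY by blast
    qed
    have Rs: "subspace M" if "M \<in> Ch" for M using R[OF that] by (simp add: real_form_def)
    have "subspace (\<Union>Ch)"
    proof (rule subspaceI)
      show "0 \<in> \<Union>Ch" using Ch(1) Rs subspace_0 by blast
      show "x + y \<in> \<Union>Ch" if xy: "x \<in> \<Union>Ch" "y \<in> \<Union>Ch" for x y
        using two[OF xy] Rs subspace_add by blast
      show "c *\<^sub>R x \<in> \<Union>Ch" if x: "x \<in> \<Union>Ch" for c x
        using x Rs subspace_scale by blast
    qed
    moreover have "qreal (qinner x y)" if xy: "x \<in> \<Union>Ch" "y \<in> \<Union>Ch" for x y
      using two[OF xy] R by (auto simp: real_form_def)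
    moreover have "A x \<in> \<Union>Ch \<and> C x \<in> \<Union>Ch \<and> B x = C x *\<^sub>H \<iota>" if x: "x \<in> \<Union>Ch" for x
      using x R by (auto simp: real_form_def)
    ultimately show ?thesis by (simp add: real_form_def)
  qed
  from subset_Zorn_nonempty[OF ne this] obtain M where "M \<in> {M. real_form M}"
      "\<forall>X\<in>{M. real_form M}. M \<subseteq> X \<longrightarrow> X = M" by blast
  then show ?thesis using that[of M] by blast
qed

lemma norm_C: "norm (C u) = norm (B u)"
proof -
  have "(norm (C u))\<^sup>2 = inner u (C (C u))" by (simp add: power2_norm_eq_inner selfadj_inner[OF C(2)])
  also have "\<dots> = (norm (B u))\<^sup>2" by (simp add: CC power2_norm_eq_inner B(2))
  finally show ?thesis by (simp add: power2_eq_iff_nonneg)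
qed

text \<open>The vector \<open>C v - B v *\<^sub>H \<iota>\<close> always solves the equation because
  \<open>C\<^sup>2 = - B\<^sup>2\<close>. If it vanishes, \<open>v *\<^sub>H \<kappa>\<close> is
  used in place of \<open>v\<close>: anticommutation flips one sign, so that the two terms add up
  instead of cancelling. If \<open>C v = 0\<close>, then \<open>B v = 0\<close> by
  \<open>norm_C\<close> and \<open>v\<close> itself serves.\<close>

lemma ex_eigen_vector:
  assumes W: "subspace W" "\<And>u. u \<in> W \<Longrightarrow> B u \<in> W" "\<And>u. u \<in> W \<Longrightarrow> C u \<in> W" "\<And>u q. u \<in> W \<Longrightarrow> u *\<^sub>H q \<in> W"
    and v: "v \<in> W" "v \<noteq> 0" and k: "\<iota> * \<kappa> = - (\<kappa> * \<iota>)" "\<kappa> \<noteq> 0"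
  obtains u where "u \<in> W" "u \<noteq> 0" "B u = C u *\<^sub>H \<iota>"
proof -
  let ?u = "\<lambda>v. C v - B v *\<^sub>H \<iota>"
  have ii: "x *\<^sub>H \<iota> *\<^sub>H \<iota> = - x" for x :: 'h
    using iota by (simp add: qscale_assoc imag_units_def power2_eq_square qscale_minus qscale_one)
  have uW: "?u v \<in> W" if "v \<in> W" for v using that by (intro subspace_diff[OF W(1)] W)
  have Bu: "B (?u v) = C (?u v) *\<^sub>H \<iota>" for v
    by (simp add: B.diff C.diff Bq Cq BC qscale_diff ii CC qscale_minus)
  show ?thesis
  proof (cases "C v = 0")
    case True
    then have "B v = 0" using norm_C[of v] by simp
    with True v show ?thesis by (intro that[of v]) auto
  next
    case False
    show ?thesis
    proof (cases "?u v = 0")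
      case True
      have "B (v *\<^sub>H \<kappa>) *\<^sub>H \<iota> = - (B v *\<^sub>H \<iota> *\<^sub>H \<kappa>)"
      proof -
        have "\<kappa> * \<iota> = - (\<iota> * \<kappa>)" using k by simp
        then show ?thesis by (simp add: Bq qscale_assoc qscale_minus)
      qed
      also have "B v *\<^sub>H \<iota> = C v" using True by simp
      finally have "?u (v *\<^sub>H \<kappa>) = 2 *\<^sub>R (C v *\<^sub>H \<kappa>)" by (simp add: Cq scaleR_2)
      moreover have "C v *\<^sub>H \<kappa> \<noteq> 0" using False k(2) norm_qscale[of "C v" \<kappa>] by (metis mult_eq_0_iff norm_eq_zero)
      ultimately have "?u (v *\<^sub>H \<kappa>) \<noteq> 0" by simp
      then show ?thesis using that[OF uW[OF W(4)[OF v(1)]] _ Bu] by blast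
    next
      case 2: False
      then show ?thesis using that[OF uW[OF v(1)] _ Bu] by blast
    qed
  qed
qed

abbreviation "word_op i j \<equiv> (\<lambda>u. (A ^^ i) ((C ^^ j) u))"

lemma funpow_commute:
  assumes "\<And>u. X (Y u) = Y (X u)"
  shows "X ((Y ^^ n) u) = (Y ^^ n) (X u)"
  by (induction n) (simp_all add: assms)

lemma word_op_bop: "bounded_op (word_op i j)"
proof -
  have p: "bounded_op X \<Longrightarrow> bounded_op (X ^^ n)" for X :: "'h \<Rightarrow> 'h" and n
  proof (induction n)
    case 0
    show ?case using bounded_op_id by (simp add: id_def)
  next
    case (Suc n)
    then show ?case using bounded_op_comp[of X "X ^^ n"] by (simp add: comp_def)
  qed
  show ?thesis by (rule bounded_op_comp[OF p[OF A(1)] p[OF C(1)]])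
qed

lemma word_op_adj: "inner (word_op i j u) v = inner u (word_op i j v)"
proof -
  have p: "inner ((X ^^ n) u) v = inner u ((X ^^ n) v)" if "selfadj X" for X :: "'h \<Rightarrow> 'h" and n u v
  proof (induction n arbitrary: v)
    case (Suc n)
    have "X ((X ^^ n) v) = (X ^^ n) (X v)" by (rule funpow_swap1)
    then show ?case by (simp add: selfadj_inner[OF that] Suc.IH)
  qed simp
  have c: "(C ^^ j) ((A ^^ i) v) = (A ^^ i) ((C ^^ j) v)"
    by (rule funpow_commute[of "C ^^ j" A i, OF funpow_commute[of A C, OF AC, symmetric]])
  show ?thesis by (simp add: p[OF A(2)] p[OF C(2)] c)
qed

lemma word_op_word_op: "word_op i j (word_op k l u) = word_op (i + k) (j + l) u"
proof -
  have "(C ^^ j) (A w) = A ((C ^^ j) w)" for w by (rule funpow_commute[of A C, OF AC, symmetric])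
  then have "(C ^^ j) ((A ^^ k) w) = (A ^^ k) ((C ^^ j) w)" for w by (rule funpow_commute)
  then show ?thesis by (simp add: funpow_add)
qed

text \<open>Words in the commuting self-adjoint operators \<open>A\<close>, \<open>C\<close> are
  self-adjoint and closed under products, so the scalar product is the diagonal form of a single
  self-adjoint word, hence real.\<close>

lemma qreal_word_op: "qreal (qinner (word_op i j u) (word_op k l u))"
proof -
  have "qinner (word_op i j u) (word_op k l u) = qinner u (word_op i j (word_op k l u))"
    by (rule qinner_adjointI[OF word_op_bop word_op_adj])
  also have "\<dots> = qinner u (word_op (i + k) (j + l) u)" by (simp only: word_op_word_op)
  finally show ?thesis
    using qreal_qinner_selfadj[OF word_op_bop, of "i + k" "j + l" u]
    by (simp add: selfadj_def bounded_op_bl[OF word_op_bop] word_op_adj)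
qed

definition "cyc u = span (range (\<lambda>(i, j). word_op i j u))"

lemma real_form_cyc:
  assumes u: "B u = C u *\<^sub>H \<iota>"
  shows "real_form (cyc u)"
proof -
  let ?G = "range (\<lambda>(i, j). word_op i j u)"
  have A': "A x \<in> cyc u" if "x \<in> cyc u" for x
    using that unfolding cyc_def
  proof (induction rule: span_induct)
    case base
    show ?case by (auto simp: subspace_def A.add A.scaleR A.zero intro: span_add span_scale span_zero)
  next
    case (step x)
    then obtain i j where x: "x = word_op i j u" by auto
    have "A x \<in> ?G" by (rule range_eqI[of _ _ "(Suc i, j)"]) (simp add: x)
    then show ?case by (simp add: span_base)
  qed
  have C': "C x \<in> cyc u" if "x \<in> cyc u" for x
    using that unfolding cyc_def
  proof (induction rule: span_induct)
    case base
    show ?case by (auto simp: subspace_def C.add C.scaleR C.zero intro: span_add span_scale span_zero)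
  next
    case (step x)
    then obtain i j where x: "x = word_op i j u" by auto
    have "C x \<in> ?G"
      by (rule range_eqI[of _ _ "(i, Suc j)"]) (use word_op_word_op[of 0 1 i j u] in \<open>simp add: x\<close>)
    then show ?case by (simp add: span_base)
  qed
  have B': "B x = C x *\<^sub>H \<iota>" if "x \<in> cyc u" for x
    using that unfolding cyc_def
  proof (induction rule: span_induct)
    case base
    show ?case by (auto simp: subspace_def B.add B.scaleR B.zero C.add C.scaleR C.zero qscale_add_left scaleR_qscale)
  next
    case (step x)
    then obtain i j where x: "x = word_op i j u" by auto
    have "B x = word_op i j (B u)"
      by (simp add: x funpow_commute[of B A, OF AB[symmetric]] funpow_commute[of B C, OF BC])
    also have "\<dots> = word_op i j (C u) *\<^sub>H \<iota>" by (simp add: u bounded_op_qscale[OF word_op_bop])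
    also have "word_op i j (C u) = C x" using word_op_word_op[of 0 1 i j u] word_op_word_op[of i j 0 1 u] by (simp add: x)
    finally show ?case .
  qed
  have re: "qreal (qinner x y)" if "x \<in> cyc u" "y \<in> cyc u" for x y
  proof -
    have sub: "subspace {y. qreal (qinner x y)}" for x
      by (auto simp: subspace_def qinner_add_right qinner_scaleR_right qreal_simps scaleR_conv_of_real)
        (metis qreal_def qreal_of_real of_real_mult)
    have sym: "qreal (qinner z w) \<Longrightarrow> qreal (qinner w z)" for z w :: 'h
      using qinner_commute[of w z] by (metis qreal_def qcnj_of_real)
    have "cyc u \<subseteq> {y. qreal (qinner (word_op i j u) y)}" for i j
      unfolding cyc_def by (rule span_minimal[OF _ sub]) (auto simp: qreal_word_op)
    then have "qreal (qinner y (word_op i j u))" for i j using that(2) sym by blast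
    then have "?G \<subseteq> {x. qreal (qinner y x)}" by auto
    then have "cyc u \<subseteq> {x. qreal (qinner y x)}" unfolding cyc_def by (rule span_minimal[OF _ sub])
    then show ?thesis using that(1) sym by blast
  qed
  show ?thesis using A' B' C' re by (simp add: real_form_def cyc_def subspace_span)
qed

lemma real_form_sum:
  assumes M: "real_form M" and M': "real_form M'" and o: "\<And>x y. x \<in> M \<Longrightarrow> y \<in> M' \<Longrightarrow> qinner x y = 0"
  shows "real_form {x + y |x y. x \<in> M \<and> y \<in> M'}"
proof -
  have o': "qinner y x = 0" if "x \<in> M" "y \<in> M'" for x y
    using o[OF that] qinner_commute[of y x] by simp
  have "subspace {x + y |x y. x \<in> M \<and> y \<in> M'}"
    using M M' by (intro subspace_sums) (auto simp: real_form_def)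
  moreover have "\<exists>x' y'. A (x + y) = x' + y' \<and> x' \<in> M \<and> y' \<in> M'" if "x \<in> M" "y \<in> M'" for x y
    using M M' that by (intro exI[of _ "A x"] exI[of _ "A y"]) (auto simp: real_form_def A.add)
  moreover have "\<exists>x' y'. C (x + y) = x' + y' \<and> x' \<in> M \<and> y' \<in> M'" if "x \<in> M" "y \<in> M'" for x y
    using M M' that by (intro exI[of _ "C x"] exI[of _ "C y"]) (auto simp: real_form_def C.add)
  moreover have "B (x + y) = C (x + y) *\<^sub>H \<iota>" if "x \<in> M" "y \<in> M'" for x y
    using M M' that by (auto simp: real_form_def B.add C.add qscale_add_left)
  moreover have "qreal (qinner (x + y) (x' + y'))" if "x \<in> M" "y \<in> M'" "x' \<in> M" "y' \<in> M'" for x y x' y'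
    using M M' that by (auto simp: real_form_def qinner_add_left qinner_add_right o o' intro: qreal_simps)
  ultimately show ?thesis unfolding real_form_def by blast
qed

text \<open>The quaternionic orthogonal complement \<open>W\<close> of a maximal real form is
  invariant under \<open>A\<close>, \<open>B\<close>, \<open>C\<close>. If it were nonzero, it would
  contain a solution \<open>u\<close> of \<open>B u = C u *\<^sub>H \<iota>\<close>, and
  \<open>cyc u\<close> could be added to the form.\<close>

lemma ex_total_real_form:
  obtains M where "real_form M" "closed M" "\<And>u. (\<And>x. x \<in> M \<Longrightarrow> qinner x u = 0) \<Longrightarrow> u = 0"
proof -
  obtain M where M: "real_form M" "\<And>M'. real_form M' \<Longrightarrow> M \<subseteq> M' \<Longrightarrow> M' = M"
    by (rule ex_maximal_real_form) blast
  \<comment> \<open>The closure is again a real form, so maximality makes \<open>M\<close>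
    closed.\<close>
  have "closure M = M" by (rule M(2)[OF real_form_closure[OF M(1)] closure_subset])
  then have cl: "closed M" by (metis closed_closure)
  define W where "W = {u. \<forall>x\<in>M. qinner x u = 0}"
  have MA: "A x \<in> M" and MC: "C x \<in> M" and MB: "B x = C x *\<^sub>H \<iota>" if "x \<in> M" for x
    using M(1) that by (auto simp: real_form_def)
  have W: "subspace W"
    by (auto simp: W_def subspace_def qinner_add_right qinner_scaleR_right)
  have Wq: "u *\<^sub>H q \<in> W" if "u \<in> W" for u q using that by (simp add: W_def qinner_qscale_right)
  have WA: "A u \<in> W" if "u \<in> W" for u
    using that MA qinner_adjointI[OF A(1) selfadj_inner[OF A(2)]] by (force simp: W_def)
  have WC: "C u \<in> W" if "u \<in> W" for u
    using that MC qinner_adjointI[OF C(1) selfadj_inner[OF C(2)]] by (force simp: W_def)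
  have WB: "B u \<in> W" if "u \<in> W" for u
  proof -
    have "qinner x (B u) = 0" if x: "x \<in> M" for x
    proof -
      have "qinner (- B x) u = qinner x (B u)" by (rule qinner_adjointI[OF B(1)]) (simp add: B(2))
      moreover have "- B x = C x *\<^sub>H (- \<iota>)" using MB[OF x] by (simp add: qscale_minus)
      moreover have "qinner (C x) u = 0" using \<open>u \<in> W\<close> MC[OF x] by (simp add: W_def)
      ultimately show ?thesis by (metis qinner_qscale_left mult_zero_right)
    qed
    then show ?thesis by (simp add: W_def)
  qed
  have "W \<subseteq> {0}"
  proof (rule ccontr)
    assume "\<not> W \<subseteq> {0}"
    then obtain v where v: "v \<in> W" "v \<noteq> 0" by blast
    obtain \<kappa> where "\<kappa> \<in> imag_units" "\<iota> * \<kappa> = - (\<kappa> * \<iota>)" by (rule ex_anticommuting_unit[OF iota])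
    then have k: "\<iota> * \<kappa> = - (\<kappa> * \<iota>)" "\<kappa> \<noteq> 0" by (auto simp: imag_units_iff)
    obtain u where u: "u \<in> W" "u \<noteq> 0" "B u = C u *\<^sub>H \<iota>"
      by (rule ex_eigen_vector[OF W WB WC Wq v k])
    have pow: "word_op i j u \<in> W" for i j
    proof -
      have "(C ^^ j) u \<in> W" by (induction j) (simp_all add: u(1) WC)
      then show ?thesis by (induction i) (simp_all add: WA)
    qed
    have "cyc u \<subseteq> W" unfolding cyc_def using pow by (intro span_minimal W) auto
    then have "real_form {x + y |x y. x \<in> M \<and> y \<in> cyc u}"
      by (intro real_form_sum M(1) real_form_cyc u(3)) (auto simp: W_def)
    moreover have "M \<subseteq> {x + y |x y. x \<in> M \<and> y \<in> cyc u}"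
    proof
      fix x assume "x \<in> M"
      moreover have "0 \<in> cyc u" by (simp add: cyc_def span_zero)
      ultimately show "x \<in> {x + y |x y. x \<in> M \<and> y \<in> cyc u}" by force
    qed
    ultimately have eq: "{x + y |x y. x \<in> M \<and> y \<in> cyc u} = M" by (rule M(2))
    have "u \<in> cyc u" unfolding cyc_def by (rule span_base) (rule range_eqI[of _ _ "(0, 0)"], simp)
    moreover have "0 \<in> M" using M(1) by (auto simp: real_form_def subspace_0)
    ultimately have "u \<in> {x + y |x y. x \<in> M \<and> y \<in> cyc u}" by force
    then have "u \<in> M" using eq by simp
    then have "qinner u u = 0" using u(1) by (simp add: W_def)
    then show False using u(2) inner_conv_qinner[of u u] by simp
  qed
  then have tot: "u = 0" if "\<And>x. x \<in> M \<Longrightarrow> qinner x u = 0" for u using that by (auto simp: W_def)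
  show ?thesis by (rule that[OF M(1) cl tot])
qed

end

text \<open>Orthonormality in the real sense; inside a real form it amounts to quaternionic
  orthonormality.\<close>

lemma ex_maximal_orthonormal:
  fixes M :: "'a::real_inner set"
  obtains N where "N \<subseteq> M" "\<And>z w. z \<in> N \<Longrightarrow> w \<in> N \<Longrightarrow> inner z w = (if z = w then 1 else 0)"
    "\<And>z. z \<in> M \<Longrightarrow> norm z = 1 \<Longrightarrow> (\<And>w. w \<in> N \<Longrightarrow> inner z w = 0) \<Longrightarrow> False"
proof -
  let ?S = "{N. N \<subseteq> M \<and> (\<forall>z\<in>N. \<forall>w\<in>N. inner z w = (if z = w then 1 else 0))}"
  have "\<Union>Ch \<in> ?S" if Ch: "subset.chain ?S Ch" for Ch
  proof -
    have sub: "X \<subseteq> M" and on: "\<And>z w. z \<in> X \<Longrightarrow> w \<in> X \<Longrightarrow> inner z w = (if z = w then 1 else 0)"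
      if "X \<in> Ch" for X using Ch that by (auto simp: subset_chain_def)
    have "inner z w = (if z = w then 1 else 0)" if zw: "z \<in> \<Union>Ch" "w \<in> \<Union>Ch" for z w
    proof -
      obtain X Y where XY: "X \<in> Ch" "Y \<in> Ch" "z \<in> X" "w \<in> Y" using zw by blast
      then have "X \<subseteq> Y \<or> Y \<subseteq> X" using Ch by (auto simp: subset_chain_def)
      then show ?thesis using XY on by (meson subsetD)
    qed
    then show ?thesis using sub by blast
  qed
  from subset_Zorn'[OF this] obtain N where N: "N \<in> ?S" "\<forall>X\<in>?S. N \<subseteq> X \<longrightarrow> X = N" by blast
  have "False" if z: "z \<in> M" "norm z = 1" "\<And>w. w \<in> N \<Longrightarrow> inner z w = 0" for z
  proof -
    have "inner z z = 1" using z(2) by (simp add: power2_norm_eq_inner[symmetric])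
    then have "insert z N \<in> ?S" using N(1) z(1,3) by (auto simp: inner_commute)
    then have "insert z N = N" using N(2) by blast
    then have "z \<in> N" by blast
    then show False using z(3) \<open>inner z z = 1\<close> by simp
  qed
  with N(1) show ?thesis by (intro that[of N]) auto
qed

context polar_triple
begin

text \<open>Because scalar products within \<open>M\<close> are real, a real orthonormal basis of
  \<open>M\<close> is a quaternionic Hilbert basis, its totality coming from that of
  \<open>M\<close>.\<close>

theorem ex_left_mult:
  obtains L where "left_scalar_mult L" "\<And>q u. L q (A u) = A (L q u)" "\<And>q u. L q (C u) = C (L q u)"
    "\<And>u. B u = L \<iota> (C u)"
proof -
  obtain M where M: "real_form M" "closed M" "\<And>u. (\<And>x. x \<in> M \<Longrightarrow> qinner x u = 0) \<Longrightarrow> u = 0"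
    by (rule ex_total_real_form) blast
  have sM: "subspace M" and inv: "\<And>x. x \<in> M \<Longrightarrow> A x \<in> M \<and> C x \<in> M \<and> B x = C x *\<^sub>H \<iota>"
    and re: "\<And>x y. x \<in> M \<Longrightarrow> y \<in> M \<Longrightarrow> qreal (qinner x y)"
    using M(1) by (auto simp: real_form_def)
  obtain N where N: "N \<subseteq> M" "\<And>z w. z \<in> N \<Longrightarrow> w \<in> N \<Longrightarrow> inner z w = (if z = w then 1 else 0)"
    "\<And>z. z \<in> M \<Longrightarrow> norm z = 1 \<Longrightarrow> (\<And>w. w \<in> N \<Longrightarrow> inner z w = 0) \<Longrightarrow> False"
    by (rule ex_maximal_orthonormal[of M]) blast
  let ?S = "closure (span N)"
  have "?S \<subseteq> M" by (intro closure_minimal span_minimal N(1) sM M(2))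
  \<comment> \<open>If \<open>m\<close> were outside the closed span of \<open>N\<close>, its
    normalized residual could be adjoined to \<open>N\<close>.\<close>
  have MS: "m \<in> ?S" if m: "m \<in> M" for m
  proof -
    obtain s where s: "s \<in> ?S" "\<And>x. x \<in> ?S \<Longrightarrow> inner (m - s) x = 0"
      by (rule orthogonal_projection[OF closure_subspace[OF subspace_span] closed_closure, of N m]) blast
    have "m - s = 0"
    proof (rule ccontr)
      assume nz: "m - s \<noteq> 0"
      let ?z = "(1 / norm (m - s)) *\<^sub>R (m - s)"
      have "?z \<in> M" using m s(1) \<open>?S \<subseteq> M\<close> by (intro subspace_scale[OF sM] subspace_diff[OF sM]) auto
      moreover have "norm ?z = 1" using nz by simp
      moreover have "inner ?z w = 0" if "w \<in> N" for w
        using s(2)[of w] that subsetD[OF closure_subset span_base[OF that]] by simp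
      ultimately show False by (rule N(3))
    qed
    then show ?thesis using s(1) by simp
  qed
  have basis: "hilbert_basis N"
    unfolding hilbert_basis_def
  proof (intro conjI ballI)
    fix z w assume zw: "z \<in> N" "w \<in> N"
    have "qinner z w = of_real (inner z w)"
      using re[of z w] zw N(1) by (auto simp: qreal_def inner_conv_qinner)
    then show "qinner z w = (if z = w then 1 else 0)" using N(2)[OF zw] by simp
  next
    let ?D = "{\<Sum>z\<in>F. z *\<^sub>H c z | F c. finite F \<and> F \<subseteq> N}"
    show "closure ?D = UNIV"
    proof (rule dense_subspaceI[OF subspace_fin_span])
      fix u assume u: "\<And>x. x \<in> ?D \<Longrightarrow> inner u x = 0"
      have zp: "inner u (z *\<^sub>H p) = 0" if z: "z \<in> N" for z p
        by (rule u, intro CollectI exI[of _ "{z}"] exI[of _ "\<lambda>_. p"]) (use z in simp)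
      have "inner u (x *\<^sub>H p) = 0" if x: "x \<in> M" for x p
      proof -
        interpret q: bounded_linear "\<lambda>u. u *\<^sub>H p" by (rule bounded_linear_qscale)
        have "closed {x. inner u (x *\<^sub>H p) = 0}"
          by (intro closed_Collect_eq continuous_on_inner continuous_on_const q.continuous_on continuous_on_id)
        moreover have "subspace {x. inner u (x *\<^sub>H p) = 0}"
          by (auto simp: subspace_def q.add q.scaleR q.zero inner_add_right)
        ultimately have "?S \<subseteq> {x. inner u (x *\<^sub>H p) = 0}"
          using zp by (intro closure_minimal span_minimal) auto
        then show ?thesis using MS[OF x] by blast
      qed
      then have "qinner u x = qinner 0 x" if "x \<in> M" for x
        using that by (intro qinner_eqI) simp
      then have "qinner x u = 0" if "x \<in> M" for x
        using that qinner_commute[of x u] by simp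
      then show "u = 0" by (rule M(3))
    qed
  qed
  interpret onb N by unfold_locales (rule basis)
  let ?L = "left_mult_of N"
  have L: "left_scalar_mult ?L" using basis by (auto simp: left_scalar_mult_def)
  note bl = bounded_op_bl[OF left_mult_bounded_op]
  \<comment> \<open>On \<open>M\<close>, left and right multiplication by \<open>q\<close> agree. As
    \<open>M\<close> contains the basis and is invariant under \<open>A\<close> and
    \<open>C\<close>, the commutation rules and \<open>B u = L \<iota> (C u)\<close> can be read off
    from right multiples of basis vectors.\<close>
  have LM: "?L q (x *\<^sub>H p) = x *\<^sub>H (q * p)" if "x \<in> M" for q x p
    using left_mult_real[of x q] re[OF _ that] N(1) by (simp add: left_mult_qscale subset_iff qscale_assoc)
  have NM: "z \<in> M" if "z \<in> N" for z using that N(1) by blast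
  show ?thesis
  proof (rule that[OF L])
    show "?L q (A u) = A (?L q u)" for q u
      by (rule bounded_linear_eqI[OF bounded_linear_compose[OF bl A.bounded_linear_axioms]
            bounded_linear_compose[OF A.bounded_linear_axioms bl]]) (simp add: Aq LM NM inv)
    show "?L q (C u) = C (?L q u)" for q u
      by (rule bounded_linear_eqI[OF bounded_linear_compose[OF bl C.bounded_linear_axioms]
            bounded_linear_compose[OF C.bounded_linear_axioms bl]]) (simp add: Cq LM NM inv)
    show "B u = ?L \<iota> (C u)" for u
      by (rule bounded_linear_eqI[OF B.bounded_linear_axioms bounded_linear_compose[OF bl C.bounded_linear_axioms]])
        (simp add: Bq Cq LM NM inv qscale_assoc)
  qed
qed

end

section \<open>Commuting sequences of projections\<close>

subsection \<open>Binary digits of a positive contraction\<close>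

text \<open>The operators between 0 and the identity in the order given by quadratic forms.\<close>

definition contraction_op :: "('a::real_inner \<Rightarrow> 'a) \<Rightarrow> bool" where
  "contraction_op A \<longleftrightarrow> selfadj A \<and> (\<forall>u. 0 \<le> inner u (A u) \<and> inner u (A u) \<le> (norm u)\<^sup>2)"

text \<open>The sign projection of \<open>A - 1/2\<close> separates the part of \<open>A\<close> at
  or above 1/2, where \<open>2 A - 1\<close> again lies between 0 and 1, from the part at or below
  1/2, where \<open>2 A\<close> does.\<close>

lemma ex_digit:
  fixes A :: "'a::{real_inner,banach} \<Rightarrow> 'a"
  assumes A: "contraction_op A"
  shows "\<exists>Q. is_proj Q \<and> bicomm {A} Q \<and> contraction_op (\<lambda>u. 2 *\<^sub>R A u - Q u)"
proof -
  have sA: "selfadj A" and ge: "\<And>u. 0 \<le> inner u (A u)" and le: "\<And>u. inner u (A u) \<le> (norm u)\<^sup>2"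
    using A by (auto simp: contraction_op_def)
  define X where "X = (\<lambda>u. A u - (1/2) *\<^sub>R u)"
  have X: "selfadj X" unfolding X_def by (intro selfadj_diff selfadj_scaleR selfadj_id sA)
  obtain Q where Q: "is_proj Q" "bicomm {X} Q"
    and pos: "\<And>u. inner (Q u) (X (Q u)) \<ge> 0" and neg: "\<And>u. inner (u - Q u) (X (u - Q u)) \<le> 0"
    by (rule sign_projection[OF X]) blast
  have "bicomm {A} X"
    unfolding X_def by (intro bicomm_diff bicomm_scaleR bicomm_id bicomm_base selfadj_bl[OF sA]) simp
  then have bQ: "bicomm {A} Q" using Q(2) bicomm_trans by blast
  then have AQ: "A (Q u) = Q (A u)" for u using bicommD[OF bQ selfadj_bl[OF sA]] by blast
  interpret A: bounded_linear A by (rule selfadj_bl[OF sA])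
  interpret Q: bounded_linear Q by (rule is_proj_bl[OF Q(1)])
  have o: "inner (Q v) (w - Q w) = 0" for v w
    using selfadj_inner[OF is_proj_selfadj[OF Q(1)], of v "w - Q w"] by (simp add: Q.diff is_proj_idem[OF Q(1)])
  \<comment> \<open>Used with \<open>x\<close>, \<open>z\<close> the forms of \<open>A\<close> at
    the components \<open>a = Q u\<close> and \<open>b = u - Q u\<close>, and \<open>y\<close>,
    \<open>w\<close> their squared norms.\<close>
  have arith: "0 \<le> 2 * (x + z) - y \<and> 2 * (x + z) - y \<le> y + w"
    if "0 \<le> x - (1/2) * y" "z - (1/2) * w \<le> 0" "0 \<le> z" "x \<le> y" for x y z w :: real
    using that by auto
  have "0 \<le> inner u (2 *\<^sub>R A u - Q u) \<and> inner u (2 *\<^sub>R A u - Q u) \<le> (norm u)\<^sup>2" for u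
  proof -
    define a where "a = Q u"
    define b where "b = u - Q u"
    have u: "u = a + b" by (simp add: a_def b_def)
    have ab: "inner a b = 0" by (simp add: a_def b_def o)
    have "inner a (A b) = 0" using o[of u "A u"] by (simp add: a_def b_def A.diff AQ)
    moreover have "inner b (A a) = 0" using calculation selfadj_inner[OF sA, of a b] by (simp add: inner_commute selfadj_inner[OF sA])
    ultimately have e: "inner u (A u) = inner a (A a) + inner b (A b)"
      by (simp add: u A.add inner_add_left inner_add_right)
    have q: "inner u (Q u) = inner a a"
      using is_proj_inner_self[OF Q(1), of u] by (simp add: a_def power2_norm_eq_inner)
    have n: "(norm u)\<^sup>2 = inner a a + inner b b"
      using ab by (simp add: u power2_norm_eq_inner inner_add_left inner_add_right inner_commute)
    have "inner a (A a) - (1/2) * inner a a \<ge> 0" using pos[of u] by (simp add: a_def X_def inner_diff_right)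
    moreover have "inner b (A b) - (1/2) * inner b b \<le> 0" using neg[of u] unfolding b_def X_def inner_diff_right[of _ "A _"] by simp
    moreover have "inner b (A b) \<ge> 0" "inner a (A a) \<le> inner a a" using ge[of b] le[of a] by (auto simp: power2_norm_eq_inner)
    ultimately show ?thesis unfolding inner_diff_right[of u] inner_scaleR_right e q n by (intro arith)
  qed
  then have "contraction_op (\<lambda>u. 2 *\<^sub>R A u - Q u)"
    unfolding contraction_op_def by (intro conjI selfadj_diff selfadj_scaleR sA is_proj_selfadj[OF Q(1)]) auto
  with Q(1) bQ show ?thesis by blast
qed

definition digit :: "('a::{real_inner,banach} \<Rightarrow> 'a) \<Rightarrow> 'a \<Rightarrow> 'a" where
  "digit A = (SOME Q. is_proj Q \<and> bicomm {A} Q \<and> contraction_op (\<lambda>u. 2 *\<^sub>R A u - Q u))"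

text \<open>The doubling map on operators: the remainder after each digit is rescaled to fill the
  interval from 0 to 1 again.\<close>

primrec digit_rest :: "('a::{real_inner,banach} \<Rightarrow> 'a) \<Rightarrow> nat \<Rightarrow> 'a \<Rightarrow> 'a" where
  "digit_rest A 0 = A"
| "digit_rest A (Suc n) = (\<lambda>u. 2 *\<^sub>R digit_rest A n u - digit (digit_rest A n) u)"

definition digits :: "('a::{real_inner,banach} \<Rightarrow> 'a) \<Rightarrow> nat \<Rightarrow> 'a \<Rightarrow> 'a" where
  "digits A n = digit (digit_rest A n)"

lemma digit_properties:
  assumes "contraction_op A"
  shows "is_proj (digit A)" "bicomm {A} (digit A)" "contraction_op (\<lambda>u. 2 *\<^sub>R A u - digit A u)"
  using someI_ex[OF ex_digit[OF assms]] unfolding digit_def by blast+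

lemma digit_rest_properties:
  assumes "contraction_op A"
  shows "contraction_op (digit_rest A n) \<and> bicomm {A} (digit_rest A n)"
proof (induction n)
  case 0
  show ?case using assms by (auto simp: contraction_op_def selfadj_def intro: bicomm_base)
next
  case (Suc n)
  then have 1: "contraction_op (digit_rest A n)" and 2: "bicomm {A} (digit_rest A n)" by auto
  have "bicomm {A} (digit (digit_rest A n))"
    by (rule bicomm_trans[OF digit_properties(2)[OF 1]]) (use 2 in auto)
  then have "bicomm {A} (digit_rest A (Suc n))"
    unfolding digit_rest.simps by (intro bicomm_diff bicomm_scaleR 2)
  then show ?case using digit_properties(3)[OF 1] by simp
qed

lemma digits_properties:
  assumes A: "contraction_op A"
  shows "is_proj (digits A n)" "bicomm {A} (digits A n)"
proof -
  have 1: "contraction_op (digit_rest A n)" and 2: "bicomm {A} (digit_rest A n)"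
    using digit_rest_properties[OF A] by auto
  show "is_proj (digits A n)" unfolding digits_def by (rule digit_properties(1)[OF 1])
  show "bicomm {A} (digits A n)"
    unfolding digits_def by (rule bicomm_trans[OF digit_properties(2)[OF 1]]) (use 2 in auto)
qed

text \<open>After \<open>n\<close> digits the error is \<open>(1/2) ^ n\<close> times the form of a
  remainder, which is at most \<open>(norm u)\<^sup>2\<close>.\<close>

lemma digits_sums:
  assumes A: "contraction_op A"
  shows "(\<lambda>k. (1/2) ^ Suc k * inner u (digits A k u)) sums inner u (A u)"
proof -
  have part: "(\<Sum>k<n. (1/2) ^ Suc k * inner u (digits A k u)) = inner u (A u) - (1/2) ^ n * inner u (digit_rest A n u)" for n
  proof (induction n)
    case (Suc n)
    have r: "inner u (digit_rest A (Suc n) u) = 2 * inner u (digit_rest A n u) - inner u (digits A n u)"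
      by (simp add: inner_diff_right digits_def)
    then show ?case using Suc unfolding r by (simp add: algebra_simps)
  qed simp
  have "(\<lambda>n. (1/2) ^ n * inner u (digit_rest A n u)) \<longlonglongrightarrow> 0"
  proof (rule tendsto_sandwich[OF _ _ tendsto_const])
    have b: "0 \<le> inner u (digit_rest A n u) \<and> inner u (digit_rest A n u) \<le> (norm u)\<^sup>2" for n
      using digit_rest_properties[OF A, of n] by (auto simp: contraction_op_def)
    show "\<forall>\<^sub>F n in sequentially. 0 \<le> (1/2) ^ n * inner u (digit_rest A n u)" using b by simp
    show "\<forall>\<^sub>F n in sequentially. (1/2) ^ n * inner u (digit_rest A n u) \<le> (1/2) ^ n * (norm u)\<^sup>2"
      using b by (intro always_eventually allI mult_left_mono) auto
    have "(\<lambda>n. (1/2::real) ^ n * (norm u)\<^sup>2) \<longlonglongrightarrow> 0 * (norm u)\<^sup>2"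
      by (intro tendsto_intros LIMSEQ_power_zero) simp
    then show "(\<lambda>n. (1/2::real) ^ n * (norm u)\<^sup>2) \<longlonglongrightarrow> 0" by simp
  qed
  then have "(\<lambda>n. inner u (A u) - (1/2) ^ n * inner u (digit_rest A n u)) \<longlonglongrightarrow> inner u (A u) - 0"
    by (intro tendsto_intros)
  then show ?thesis unfolding sums_def part by simp
qed

subsection \<open>Sums of orthogonal projections\<close>

text \<open>By Pythagoras the Cauchy condition for the vectors reduces to that for their squared
  norms, whose partial sums are bounded by Bessel's inequality.\<close>

lemma sum_orthogonal_projections:
  fixes R :: "nat \<Rightarrow> 'a::{real_inner,banach} \<Rightarrow> 'a"
  assumes R: "\<And>i. is_proj (R i)" and o: "\<And>i j u. i \<noteq> j \<Longrightarrow> R i (R j u) = 0"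
  obtains S where "is_proj S" "\<And>u. (\<lambda>i. R i u) sums S u"
proof -
  have bl: "bounded_linear (R i)" for i by (rule is_proj_bl[OF R])
  have io: "inner (R i u) (R j v) = 0" if "i \<noteq> j" for i j u v
    using selfadj_inner[OF is_proj_selfadj[OF R], of i u "R j v"] o[OF that] by simp
  have pyth: "(norm (\<Sum>i\<in>I. R i u))\<^sup>2 = (\<Sum>i\<in>I. (norm (R i u))\<^sup>2)" if I: "finite I" for I u
  proof -
    have "(norm (\<Sum>i\<in>I. R i u))\<^sup>2 = (\<Sum>i\<in>I. \<Sum>j\<in>I. inner (R j u) (R i u))"
      by (simp add: power2_norm_eq_inner inner_sum_left inner_sum_right)
    also have "\<dots> = (\<Sum>i\<in>I. \<Sum>j\<in>I. if j = i then inner (R j u) (R i u) else 0)"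
      by (intro sum.cong) (auto simp: io)
    finally show ?thesis using I by (simp add: power2_norm_eq_inner)
  qed
  have bessel: "norm (\<Sum>i\<in>I. R i u) \<le> norm u" if I: "finite I" for I u
  proof -
    let ?s = "\<Sum>i\<in>I. R i u"
    have "inner u ?s = (\<Sum>i\<in>I. (norm (R i u))\<^sup>2)" by (simp add: inner_sum_right is_proj_inner_self[OF R])
    then have "norm ?s * norm ?s \<le> norm u * norm ?s"
      using pyth[OF I, of u] norm_cauchy_schwarz[of u ?s] by (simp add: power2_eq_square)
    then show ?thesis by (cases "norm ?s = 0") auto
  qed
  have "summable (\<lambda>i. R i u)" for u
  proof -
    have "summable (\<lambda>i. (norm (R i u))\<^sup>2)"
    proof (rule summableI_nonneg_bounded)
      show "(\<Sum>i<n. (norm (R i u))\<^sup>2) \<le> (norm u)\<^sup>2" for n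
        using bessel[of "{..<n}" u] pyth[of "{..<n}" u] by (metis finite_lessThan norm_ge_zero power_mono)
    qed simp
    then have C: "\<forall>e>0. \<exists>N. \<forall>m\<ge>N. \<forall>n. norm (\<Sum>i=m..<n. (norm (R i u))\<^sup>2) < e" by (simp add: summable_Cauchy)
    show ?thesis
      unfolding summable_Cauchy
    proof (intro allI impI)
      fix e :: real assume e: "e > 0"
      then obtain N where N: "\<forall>m\<ge>N. \<forall>n. norm (\<Sum>i=m..<n. (norm (R i u))\<^sup>2) < e\<^sup>2"
        using C by (meson zero_less_power)
      have "norm (\<Sum>i=m..<n. R i u) < e" if "m \<ge> N" for m n
      proof (rule power_less_imp_less_base)
        show "(norm (\<Sum>i=m..<n. R i u))\<^sup>2 < e\<^sup>2"
          using N that by (auto simp: pyth sum_nonneg)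
      qed (use e in simp)
      then show "\<exists>N. \<forall>m\<ge>N. \<forall>n. norm (\<Sum>i=m..<n. R i u) < e" by blast
    qed
  qed
  then obtain S where S: "\<And>u. (\<lambda>i. R i u) sums S u" unfolding summable_def by metis
  have "bounded_linear S"
  proof (rule bounded_linear_of_norm_le[where c = 1])
    fix u v and r :: real
    show "S (u + v) = S u + S v"
      using sums_add[OF S[of u] S[of v]] S[of "u + v"] linear_add[OF bounded_linear.linear[OF bl]] sums_unique2 by simp
    show "S (r *\<^sub>R u) = r *\<^sub>R S u"
      using sums_scaleR_right[OF S[of u], of r] S[of "r *\<^sub>R u"] linear_scale[OF bounded_linear.linear[OF bl]] sums_unique2 by simp
    have "(\<lambda>n. norm (\<Sum>i<n. R i u)) \<longlonglongrightarrow> norm (S u)" using S[of u] unfolding sums_def by (rule tendsto_norm)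
    then show "norm (S u) \<le> 1 * norm u"
      by (rule LIMSEQ_le_const2) (use bessel in auto)
  qed
  moreover have "inner (S u) v = inner u (S v)" for u v
  proof (rule sums_unique2)
    show "(\<lambda>i. inner (R i u) v) sums inner (S u) v"
      by (rule bounded_linear.sums[OF bounded_linear_inner_left S])
    have "(\<lambda>i. inner u (R i v)) sums inner u (S v)"
      by (rule bounded_linear.sums[OF bounded_linear_inner_right S])
    then show "(\<lambda>i. inner (R i u) v) sums inner u (S v)"
      by (simp add: selfadj_inner[OF is_proj_selfadj[OF R]])
  qed
  moreover have "S (S u) = S u" for u
  proof -
    have "R j (S u) = R j u" for j
    proof (rule sums_unique2)
      show "(\<lambda>i. R j (R i u)) sums R j (S u)" by (rule bounded_linear.sums[OF bl S])
      have "(\<lambda>i. if i = j then R j u else 0) sums R j u" by (rule sums_single)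
      moreover have "(\<lambda>i. if i = j then R j u else 0) = (\<lambda>i. R j (R i u))"
        using o is_proj_idem[OF R] by (auto simp: fun_eq_iff)
      ultimately show "(\<lambda>i. R j (R i u)) sums R j u" by simp
    qed
    then show ?thesis using S[of "S u"] S[of u] sums_unique2 by simp
  qed
  ultimately have "is_proj S" by (simp add: is_proj_def selfadj_def)
  with S that show ?thesis by blast
qed

subsection \<open>Measures on binary sequences\<close>

text \<open>Finite prefixes of a binary sequence are stored with the latest digit first.\<close>

primrec prefix :: "(nat \<Rightarrow> bool) \<Rightarrow> nat \<Rightarrow> bool list" where
  "prefix \<omega> 0 = []"
| "prefix \<omega> (Suc n) = \<omega> n # prefix \<omega> n"

definition cylinder :: "bool list \<Rightarrow> (nat \<Rightarrow> bool) set" where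
  "cylinder w = {\<omega>. prefix \<omega> (length w) = w}"

text \<open>Two cylinders are nested or disjoint; including the empty set makes the family stable
  under intersection.\<close>

definition cantor_sets :: "(nat \<Rightarrow> bool) set set" where
  "cantor_sets = insert {} (range cylinder)"

definition cantor :: "(nat \<Rightarrow> bool) measure" where
  "cantor = sigma UNIV cantor_sets"

lemma length_prefix [simp]: "length (prefix \<omega> n) = n"
  by (induction n) auto

lemma drop_prefix: "drop k (prefix \<omega> (k + n)) = prefix \<omega> n"
  by (induction k) auto

lemma space_cantor [simp]: "space cantor = UNIV"
  by (simp add: cantor_def space_measure_of_conv)

lemma sets_cantor: "sets cantor = sigma_sets UNIV cantor_sets"
  by (simp add: cantor_def)

lemma cylinder_Nil [simp]: "cylinder [] = UNIV"
  by (simp add: cylinder_def)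

lemma cylinder_sets: "cylinder w \<in> sets cantor"
  unfolding sets_cantor cantor_sets_def by (rule sigma_sets.Basic) simp

text \<open>With the latest digit first, the initial part of a longer word is obtained by
  \<open>drop\<close>; the cylinders are nested or disjoint according to whether it equals the
  shorter word.\<close>

lemma cylinder_Int:
  assumes "length w \<le> length w'"
  shows "cylinder w \<inter> cylinder w' = cylinder w' \<or> cylinder w \<inter> cylinder w' = {}"
proof (cases "drop (length w' - length w) w' = w")
  case True
  then have "cylinder w' \<subseteq> cylinder w"
    unfolding cylinder_def
    using drop_prefix[of "length w' - length w" _ "length w"] assms by auto metis
  then show ?thesis by blast
next
  case False
  then have "cylinder w \<inter> cylinder w' = {}"
    unfolding cylinder_def
    using drop_prefix[of "length w' - length w" _ "length w"] assms by auto metis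
  then show ?thesis by blast
qed

lemma Int_stable_cantor: "Int_stable cantor_sets"
proof -
  have "cylinder w \<inter> cylinder w' \<in> cantor_sets" for w w'
    using cylinder_Int[of w w'] cylinder_Int[of w' w]
    by (cases "length w \<le> length w'") (auto simp: cantor_sets_def Int_commute)
  then show ?thesis by (auto simp: Int_stable_def cantor_sets_def)
qed

lemma coordinate_sets: "{\<omega>. \<omega> i} \<in> sets cantor"
  and coordinate_Union: "{\<omega>. \<omega> i} = (\<Union>w\<in>{w. length w = i}. cylinder (True # w))"
proof -
  show e: "{\<omega>. \<omega> i} = (\<Union>w\<in>{w. length w = i}. cylinder (True # w))"
  proof (intro equalityI subsetI)
    fix \<omega> assume "\<omega> \<in> {\<omega>. \<omega> i}"
    then have "\<omega> \<in> cylinder (True # prefix \<omega> i)" by (simp add: cylinder_def)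
    then show "\<omega> \<in> (\<Union>w\<in>{w. length w = i}. cylinder (True # w))" by force
  qed (auto simp: cylinder_def)
  show "{\<omega>. \<omega> i} \<in> sets cantor"
    unfolding e by (rule sets.countable_UN'') (auto simp: cylinder_sets)
qed

lemma finite_words: "finite {w :: bool list. length w = n}"
  using finite_lists_length_eq[of "UNIV :: bool set" n] by simp

text \<open>A consistent assignment of weights to finite words is realized by nested subintervals of
  \<open>{0..<p []}\<close>: the digits of a point tell in which subintervals it lies.\<close>

lemma tree_measure:
  fixes p :: "bool list \<Rightarrow> real"
  assumes p0: "\<And>w. p w \<ge> 0" and p: "\<And>w. p w = p (True # w) + p (False # w)"
  obtains \<nu> where "finite_measure \<nu>" "sets \<nu> = sets cantor" "\<And>w. measure \<nu> (cylinder w) = p w"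
proof -
  \<comment> \<open>\<open>l w\<close> is the left end of the interval of \<open>w\<close>. The half
    for the digit \<open>False\<close> comes first, so a digit \<open>True\<close> moves the left
    end by the length of that half.\<close>
  define l where "l = rec_list 0 (\<lambda>b w lw. lw + (if b then p (False # w) else 0))"
  have l: "l [] = 0" "l (b # w) = l w + (if b then p (False # w) else 0)" for b w by (simp_all add: l_def)
  \<comment> \<open>For \<open>t\<close> in the base interval, \<open>wd t n\<close> is the word of
    length \<open>n\<close> whose interval contains \<open>t\<close>.\<close>
  define wd where "wd t = rec_nat [] (\<lambda>n w. (l w + p (False # w) \<le> t) # w)" for t :: real
  have wd: "wd t 0 = []" "wd t (Suc n) = (l (wd t n) + p (False # wd t n) \<le> t) # wd t n" for t n
    by (simp_all add: wd_def)
  define om where "om t n = hd (wd t (Suc n))" for t n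
  have pre: "prefix (om t) n = wd t n" for t n by (induction n) (simp_all add: wd om_def)
  have len: "length (wd t n) = n" for t n by (induction n) (simp_all add: wd)
  have bounds: "0 \<le> l w \<and> l w + p w \<le> p []" for w
  proof (induction w)
    case (Cons b w)
    then show ?case using p0[of "True # w"] p0[of "False # w"] p[of w] by (cases b) (auto simp: l)
  qed (simp add: l)
  let ?I = "{0..<p []}"
  \<comment> \<open>Half-open intervals are split without overlap or gap, so the interval containing
    \<open>t\<close> determines the word, also when some weights are zero.\<close>
  have main: "wd t n = w \<longleftrightarrow> length w = n \<and> l w \<le> t \<and> t < l w + p w" if t: "t \<in> ?I" for t n w
  proof (induction n arbitrary: w)
    case 0
    show ?case using t by (auto simp: wd l)
  next
    case (Suc n)
    show ?case
    proof (cases w)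
      case Nil
      then show ?thesis by (simp add: wd)
    next
      case (Cons b w')
      have "wd t (Suc n) = w \<longleftrightarrow> wd t n = w' \<and> b = (l w' + p (False # w') \<le> t)"
        by (auto simp: wd Cons)
      also have "\<dots> \<longleftrightarrow> (length w' = n \<and> l w' \<le> t \<and> t < l w' + p w') \<and> b = (l w' + p (False # w') \<le> t)"
        by (simp only: Suc)
      also have "\<dots> \<longleftrightarrow> length w = Suc n \<and> l w \<le> t \<and> t < l w + p w"
        using p0[of "True # w'"] p0[of "False # w'"] p[of w'] by (cases b) (auto simp: Cons l)
      finally show ?thesis .
    qed
  qed
  let ?M = "restrict_space lborel ?I"
  have sp: "space ?M = ?I" by (simp add: space_restrict_space)
  have vim: "om -` cylinder w \<inter> ?I = {l w..<l w + p w}" for w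
    using main[of _ "length w" w] bounds[of w] by (auto simp: cylinder_def pre)
  have meas: "om \<in> measurable ?M cantor"
    unfolding cantor_def
  proof (rule measurable_measure_of)
    fix y assume "y \<in> cantor_sets"
    then consider "y = {}" | w where "y = cylinder w" by (auto simp: cantor_sets_def)
    then show "om -` y \<inter> space ?M \<in> sets ?M"
    proof cases
      case 2
      have "{l w..<l w + p w} \<in> sets ?M"
        using bounds[of w] by (subst sets_restrict_space_iff) auto
      then show ?thesis using vim[of w] by (simp add: 2 sp)
    qed simp
  qed auto
  have "emeasure ?M (space ?M) \<noteq> \<infinity>"
    using p0[of "[]"] by (simp add: sp emeasure_restrict_space)
  then interpret M: finite_measure ?M by (rule finite_measureI)
  show ?thesis
  proof (rule that)
    show "finite_measure (distr ?M cantor om)" by (rule M.finite_measure_distr[OF meas])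
    show "sets (distr ?M cantor om) = sets cantor" by simp
    fix w
    have "measure (distr ?M cantor om) (cylinder w) = measure ?M {l w..<l w + p w}"
      using vim[of w] by (simp add: measure_distr[OF meas cylinder_sets] sp)
    also have "\<dots> = measure lborel {l w..<l w + p w}"
      using bounds[of w] by (intro measure_restrict_space) auto
    also have "\<dots> = p w" using p0[of w] by simp
    finally show "measure (distr ?M cantor om) (cylinder w) = p w" .
  qed
qed

subsection \<open>The projection-valued measure of a commuting sequence\<close>

locale commuting_projections =
  fixes Q :: "nat \<Rightarrow> 'a::{real_inner,banach} \<Rightarrow> 'a"
  assumes proj: "\<And>n. is_proj (Q n)" and Q_commute: "\<And>m n u. Q m (Q n u) = Q n (Q m u)"
begin

text \<open>Since the latest digit comes first, \<open>length w\<close> is the index of the digit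
  \<open>b\<close> in \<open>b # w\<close>.\<close>

primrec word_proj :: "bool list \<Rightarrow> 'a \<Rightarrow> 'a" where
  "word_proj [] = (\<lambda>u. u)"
| "word_proj (b # w) = (\<lambda>u. if b then Q (length w) (word_proj w u) else word_proj w u - Q (length w) (word_proj w u))"

lemma Q_diff: "Q n (u - v) = Q n u - Q n v"
  by (rule linear_diff[OF bounded_linear.linear[OF is_proj_bl[OF proj]]])

lemma Q_word_proj: "Q n (word_proj w u) = word_proj w (Q n u)"
proof (induction w)
  case (Cons b w)
  then show ?case using Q_commute[of n "length w"] by (simp add: Q_diff)
qed simp

lemma word_proj_proj: "is_proj (word_proj w)"
proof (induction w)
  case Nil
  show ?case by (simp add: is_proj_def selfadj_id)
next
  case (Cons b w)
  show ?case
  proof (cases b)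
    case True
    then show ?thesis using is_proj_comp[OF proj Cons, of "length w"] Q_word_proj by simp
  next
    case False
    have c: "comm (\<lambda>u. u - Q (length w) u) (word_proj w)"
      using Q_word_proj linear_diff[OF bounded_linear.linear[OF is_proj_bl[OF Cons]]] by simp
    show ?thesis using is_proj_comp[OF is_proj_compl[OF proj] Cons c] False by simp
  qed
qed

lemma word_proj_bicomm: "bicomm (range Q) (word_proj w)"
proof (induction w)
  case Nil
  show ?case by (simp add: bicomm_id)
next
  case (Cons b w)
  have "bicomm (range Q) (Q n)" for n by (intro bicomm_base is_proj_bl[OF proj]) simp
  then have "bicomm (range Q) (\<lambda>u. Q (length w) (word_proj w u))" using Cons by (rule bicomm_comp)
  then show ?case using Cons bicomm_diff[OF Cons] by (cases b) simp_all
qed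

lemma ex_measure:
  "\<exists>\<nu>. finite_measure \<nu> \<and> sets \<nu> = sets cantor \<and> (\<forall>w. measure \<nu> (cylinder w) = inner u (word_proj w u))"
proof -
  have "inner u (word_proj w u) \<ge> 0" for w using is_proj_inner_self[OF word_proj_proj] by simp
  moreover have "inner u (word_proj w u) = inner u (word_proj (True # w) u) + inner u (word_proj (False # w) u)" for w
    by (simp add: inner_diff_right)
  ultimately obtain \<nu> where "finite_measure \<nu>" "sets \<nu> = sets cantor"
      "\<And>w. measure \<nu> (cylinder w) = inner u (word_proj w u)"
    by (rule tree_measure[where p = "\<lambda>w. inner u (word_proj w u)"]) blast
  then show ?thesis by blast
qed

definition \<nu> :: "'a \<Rightarrow> (nat \<Rightarrow> bool) measure" where
  "\<nu> u = (SOME \<nu>. finite_measure \<nu> \<and> sets \<nu> = sets cantor \<and>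
    (\<forall>w. measure \<nu> (cylinder w) = inner u (word_proj w u)))"

lemma \<nu>: "finite_measure (\<nu> u)" "sets (\<nu> u) = sets cantor" "measure (\<nu> u) (cylinder w) = inner u (word_proj w u)"
  using someI_ex[OF ex_measure[of u]] unfolding \<nu>_def by blast+

lemma space_\<nu> [simp]: "space (\<nu> u) = UNIV"
  using sets_eq_imp_space_eq[OF \<nu>(2)[of u]] by simp

lemma measure_\<nu>_UNIV: "measure (\<nu> u) UNIV = (norm u)\<^sup>2"
  using \<nu>(3)[of u "[]"] by (simp add: power2_norm_eq_inner)

text \<open>The form determines \<open>R\<close>. The double commutant clause is carried along so
  that the resulting projections commute with right and left multiplications.\<close>

definition represents :: "(nat \<Rightarrow> bool) set \<Rightarrow> ('a \<Rightarrow> 'a) \<Rightarrow> bool" where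
  "represents S R \<longleftrightarrow> is_proj R \<and> (\<forall>u. inner u (R u) = measure (\<nu> u) S) \<and> bicomm (range Q) R"

text \<open>Additivity of the measure at \<open>v = R' u\<close> gives \<open>(norm (R v))\<^sup>2 +
  (norm (R' v))\<^sup>2 \<le> (norm v)\<^sup>2\<close>, and the second term already equals the right
  side.\<close>

lemma represents_orthogonal:
  assumes S: "S \<in> sets cantor" "S' \<in> sets cantor" "S \<inter> S' = {}" and R: "represents S R" "represents S' R'"
  shows "R (R' u) = 0"
proof -
  interpret finite_measure "\<nu> (R' u)" by (rule \<nu>(1))
  let ?v = "R' u"
  have P: "is_proj R" "is_proj R'" using R by (auto simp: represents_def)
  have "inner ?v (R ?v) + inner ?v (R' ?v) = measure (\<nu> ?v) (S \<union> S')"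
    using R S by (simp add: represents_def finite_measure_Union \<nu>(2))
  also have "\<dots> \<le> (norm ?v)\<^sup>2"
    unfolding measure_\<nu>_UNIV[symmetric] by (rule finite_measure_mono) (use \<nu>(2) sets.top[of "\<nu> ?v"] in auto)
  also have "inner ?v (R' ?v) = (norm ?v)\<^sup>2"
    by (simp add: is_proj_idem[OF P(2)] power2_norm_eq_inner)
  finally have "(norm (R ?v))\<^sup>2 \<le> 0" by (simp add: is_proj_inner_self[OF P(1)])
  then show ?thesis by simp
qed

lemma represents_unique:
  assumes "represents S R" "represents S R'"
  shows "R = R'"
  using assms selfadj_form_eq[of R R'] by (auto simp: represents_def is_proj_def)

text \<open>The measures \<open>\<nu> u\<close> are chosen separately for each \<open>u\<close>.
  That their values on a fixed set form the quadratic form of a projection is built in for cylinders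
  and passes to complements and, through sums of orthogonal projections, to countable disjoint
  unions.\<close>

lemma ex_represents:
  assumes "S \<in> sets cantor"
  shows "\<exists>R. represents S R"
proof -
  have S: "S \<in> sigma_sets UNIV cantor_sets" using assms by (simp add: sets_cantor)
  have sub: "cantor_sets \<subseteq> Pow UNIV" by simp
  show ?thesis
    using Int_stable_cantor sub S
  proof (induction S rule: sigma_sets_induct_disjoint)
    case (basic S)
    then consider "S = {}" | w where "S = cylinder w" by (auto simp: cantor_sets_def)
    then show ?case
    proof cases
      case 1
      have "represents {} (\<lambda>u. 0)"
        by (simp add: represents_def is_proj_def selfadj_def bicomm_zero)
      then show ?thesis using 1 by blast
    next
      case 2
      have "represents (cylinder w) (word_proj w)"
        by (simp add: represents_def word_proj_proj \<nu>(3) word_proj_bicomm)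
      then show ?thesis using 2 by blast
    qed
  next
    case empty
    have "represents {} (\<lambda>u. 0)"
      by (simp add: represents_def is_proj_def selfadj_def bicomm_zero)
    then show ?case by blast
  next
    case (compl S)
    then obtain R where R: "represents S R" by blast
    have "inner u (u - R u) = measure (\<nu> u) (UNIV - S)" for u
      using R compl(1) finite_measure.finite_measure_compl[OF \<nu>(1), of S u] measure_\<nu>_UNIV[of u]
      by (simp add: represents_def inner_diff_right \<nu>(2) sets_cantor power2_norm_eq_inner)
    then have "represents (UNIV - S) (\<lambda>u. u - R u)"
      using R by (simp add: represents_def is_proj_compl bicomm_diff bicomm_id)
    then show ?case by blast
  next
    case (union S)
    then obtain R where R: "\<And>i. represents (S i) (R i)" by metis
    have S: "S i \<in> sets cantor" for i using union(2) by (auto simp: sets_cantor)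
    have "R i (R j u) = 0" if "i \<noteq> j" for i j u
      using that union(1) by (intro represents_orthogonal[OF S S _ R R]) (auto simp: disjoint_family_on_def)
    then obtain Z where Z: "is_proj Z" "\<And>u. (\<lambda>i. R i u) sums Z u"
      using sum_orthogonal_projections[of R] R by (metis represents_def)
    have "inner u (Z u) = measure (\<nu> u) (\<Union>i. S i)" for u
    proof (rule sums_unique2)
      show "(\<lambda>i. inner u (R i u)) sums inner u (Z u)"
        by (rule bounded_linear.sums[OF bounded_linear_inner_right Z(2)])
      have "(\<lambda>i. measure (\<nu> u) (S i)) sums measure (\<nu> u) (\<Union>i. S i)"
        using S union(1) by (intro finite_measure.finite_measure_UNION \<nu>(1)) (auto simp: \<nu>(2))
      then show "(\<lambda>i. inner u (R i u)) sums measure (\<nu> u) (\<Union>i. S i)"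
        using R by (simp add: represents_def)
    qed
    \<comment> \<open>Commutation survives strong limits because the test operator \<open>X\<close>
      is continuous.\<close>
    moreover have "bicomm (range Q) Z"
      unfolding bicomm_def
    proof (intro conjI allI impI)
      show "bounded_linear Z" by (rule is_proj_bl[OF Z(1)])
      fix X u assume X: "bounded_linear X \<and> (\<forall>A\<in>range Q. comm X A)"
      have "X (R i v) = R i (X v)" for i v
        using R[of i] X bicommD[of "range Q" "R i" X] by (auto simp: represents_def)
      then have "(\<lambda>i. R i (X u)) sums X (Z u)"
        using bounded_linear.sums[OF _ Z(2), of X u] X by simp
      then show "X (Z u) = Z (X u)" using Z(2)[of "X u"] sums_unique2 by blast
    qed
    ultimately have "represents (\<Union>i. S i) Z" using Z(1) by (simp add: represents_def)
    then show ?case by blast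
  qed
qed

definition E :: "(nat \<Rightarrow> bool) set \<Rightarrow> 'a \<Rightarrow> 'a" where
  "E S = (SOME R. represents S R)"

lemma represents_E: "S \<in> sets cantor \<Longrightarrow> represents S (E S)"
  unfolding E_def by (rule someI_ex[OF ex_represents])

lemma E_proj: "S \<in> sets cantor \<Longrightarrow> is_proj (E S)"
  and E_form: "S \<in> sets cantor \<Longrightarrow> inner u (E S u) = measure (\<nu> u) S"
  and E_bicomm: "S \<in> sets cantor \<Longrightarrow> bicomm (range Q) (E S)"
  using represents_E by (auto simp: represents_def)

lemma E_UNIV: "E UNIV = (\<lambda>u. u)"
proof (rule represents_unique)
  show "represents UNIV (E UNIV)" by (rule represents_E) (use sets.top[of cantor] in simp)
  show "represents UNIV (\<lambda>u. u)" using word_proj_proj[of "[]"]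
    by (simp add: represents_def bicomm_id measure_\<nu>_UNIV power2_norm_eq_inner)
qed

lemma E_orthogonal: "S \<in> sets cantor \<Longrightarrow> S' \<in> sets cantor \<Longrightarrow> S \<inter> S' = {} \<Longrightarrow> E S (E S' u) = 0"
  by (rule represents_orthogonal[OF _ _ _ represents_E represents_E])

lemma E_Un:
  assumes S: "S \<in> sets cantor" "S' \<in> sets cantor" "S \<inter> S' = {}"
  shows "E (S \<union> S') u = E S u + E S' u"
proof (rule selfadj_form_eq[of "E (S \<union> S')" "\<lambda>u. E S u + E S' u"])
  show "selfadj (E (S \<union> S'))" by (intro is_proj_selfadj E_proj sets.Un S)
  show "selfadj (\<lambda>u. E S u + E S' u)" by (intro selfadj_add is_proj_selfadj E_proj S)
  fix u
  interpret finite_measure "\<nu> u" by (rule \<nu>(1))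
  show "inner u (E (S \<union> S') u) = inner u (E S u + E S' u)"
    using S by (simp add: inner_add_right E_form finite_measure_Union \<nu>(2) sets.Un)
qed

text \<open>Multiplicativity from additivity: both sets are split along their intersection, and the
  mixed products vanish by orthogonality.\<close>

lemma E_Int:
  assumes S: "S \<in> sets cantor" "S' \<in> sets cantor"
  shows "E S (E S' u) = E (S \<inter> S') u"
proof -
  have m: "S \<inter> S' \<in> sets cantor" "S - S' \<in> sets cantor" "S' - S \<in> sets cantor" using S by auto
  have 1: "E S v = E (S \<inter> S') v + E (S - S') v" for v
    using E_Un[OF m(1,2), of v] by (simp add: Int_Diff_disjoint Int_Diff_Un)
  have 2: "E S' v = E (S \<inter> S') v + E (S' - S) v" for v
  proof -
    have "S \<inter> S' \<union> (S' - S) = S'" by blast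
    then show ?thesis using E_Un[OF m(1,3), of v] by auto
  qed
  interpret bounded_linear "E S" by (rule is_proj_bl[OF E_proj[OF S(1)]])
  have "E S (E (S' - S) u) = 0" by (rule E_orthogonal[OF S(1) m(3)]) blast
  moreover have "E (S - S') (E (S \<inter> S') u) = 0" by (rule E_orthogonal[OF m(2,1)]) blast
  ultimately show ?thesis
    by (simp add: 2[of u] add 1[of "E (S \<inter> S') u"] is_proj_idem[OF E_proj[OF m(1)]])
qed

lemma E_sums:
  assumes S: "range S \<subseteq> sets cantor" "disjoint_family S"
  shows "(\<lambda>i. E (S i) u) sums E (\<Union>i. S i) u"
proof -
  have Si: "S i \<in> sets cantor" for i using S(1) by auto
  have "E (S i) (E (S j) u) = 0" if "i \<noteq> j" for i j u
    using that S(2) by (intro E_orthogonal[OF Si Si]) (auto simp: disjoint_family_on_def)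
  then obtain Z where Z: "is_proj Z" "\<And>u. (\<lambda>i. E (S i) u) sums Z u"
    using sum_orthogonal_projections[of "\<lambda>i. E (S i)"] E_proj[OF Si] by metis
  have "Z u = E (\<Union>i. S i) u" for u
  proof (rule selfadj_form_eq[of Z "E (\<Union>i. S i)"])
    show "selfadj Z" by (rule is_proj_selfadj[OF Z(1)])
    show "selfadj (E (\<Union>i. S i))" using Si by (intro is_proj_selfadj E_proj) auto
    fix u
    show "inner u (Z u) = inner u (E (\<Union>i. S i) u)"
    proof (rule sums_unique2)
      show "(\<lambda>i. inner u (E (S i) u)) sums inner u (Z u)"
        by (rule bounded_linear.sums[OF bounded_linear_inner_right Z(2)])
      have "(\<lambda>i. measure (\<nu> u) (S i)) sums measure (\<nu> u) (\<Union>i. S i)"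
        using S by (intro finite_measure.finite_measure_UNION \<nu>(1)) (auto simp: \<nu>(2))
      moreover have "inner u (E (\<Union>i. S i) u) = measure (\<nu> u) (\<Union>i. S i)"
        using Si by (intro E_form) auto
      ultimately show "(\<lambda>i. inner u (E (S i) u)) sums inner u (E (\<Union>i. S i) u)"
        by (simp add: E_form[OF Si])
    qed
  qed
  with Z(2) show ?thesis by metis
qed

lemma sum_word_proj: "(\<Sum>w\<in>{w. length w = n}. word_proj w u) = u"
proof (induction n)
  case 0
  have "{w :: bool list. length w = 0} = {[]}" by auto
  then show ?case by simp
next
  case (Suc n)
  let ?W = "{w :: bool list. length w = n}"
  have e: "{w :: bool list. length w = Suc n} = (#) True ` ?W \<union> (#) False ` ?W"
    by (force simp: length_Suc_conv)
  have "(\<Sum>w\<in>{w. length w = Suc n}. word_proj w u)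
      = (\<Sum>w\<in>?W. word_proj (True # w) u) + (\<Sum>w\<in>?W. word_proj (False # w) u)"
    unfolding e by (subst sum.union_disjoint) (auto simp: finite_words sum.reindex)
  also have "\<dots> = (\<Sum>w\<in>?W. word_proj w u)" by (simp add: sum.distrib[symmetric])
  finally show ?case using Suc by simp
qed

text \<open>Splits by the first \<open>i\<close> digits; the projections of all words of length
  \<open>i\<close> add up to the identity.\<close>

lemma measure_coordinate: "measure (\<nu> u) {\<omega>. \<omega> i} = inner u (Q i u)"
proof -
  interpret finite_measure "\<nu> u" by (rule \<nu>(1))
  let ?W = "{w :: bool list. length w = i}"
  have "measure (\<nu> u) {\<omega>. \<omega> i} = (\<Sum>w\<in>?W. measure (\<nu> u) (cylinder (True # w)))"
    unfolding coordinate_Union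
  proof (rule finite_measure_finite_Union)
    show "disjoint_family_on (\<lambda>w. cylinder (True # w)) ?W" by (auto simp: disjoint_family_on_def cylinder_def)
  qed (auto simp: finite_words \<nu>(2) cylinder_sets)
  also have "\<dots> = (\<Sum>w\<in>?W. inner u (Q i (word_proj w u)))" by (simp add: \<nu>(3))
  also have "\<dots> = inner u (Q i (\<Sum>w\<in>?W. word_proj w u))"
    by (simp add: inner_sum_right linear_sum[OF bounded_linear.linear[OF is_proj_bl[OF proj]]])
  finally show ?thesis by (simp add: sum_word_proj)
qed

end

section \<open>The spectral theorem\<close>

text \<open>Both sides are approximated with the same rounding of \<open>f\<close>, for which they
  are the same finite sum.\<close>

lemma (in iqpvm) int_form:
  assumes F: "is_int (\<lambda>x. of_real (f x)) F" and f: "f \<in> borel_measurable (half_plane_borel \<iota>)"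
    and \<mu>: "finite_measure \<mu>" "sets \<mu> = HB" "\<And>E. E \<in> HB \<Longrightarrow> measure \<mu> E = inner u (P E u)"
  shows "inner u (F u) = (\<integral>x. f x \<partial>\<mu>)"
proof -
  interpret finite_measure \<mu> by (rule \<mu>)
  have sp: "space \<mu> = HP" using sets_eq_imp_space_eq[OF \<mu>(2)] by simp
  have f\<mu>: "f \<in> borel_measurable \<mu>" using f measurable_cong_sets[OF \<mu>(2) refl] by blast
  let ?\<phi> = "\<lambda>x. of_real (f x) :: quat"
  let ?c = "real DIM(quat)"
  obtain c where c: "c > 0" "\<And>x. x \<in> HP \<Longrightarrow> norm (?\<phi> x) \<le> c" by (rule int_bounded[OF F]) blast
  have m: "?\<phi> \<in> borel_measurable (half_plane_borel \<iota>)" using f by measurable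
  have b: "bounded (?\<phi> ` HP)" unfolding bounded_iff using c by blast
  have fi: "integrable \<mu> f"
    by (rule integrable_const_bound[of _ c]) (use c(2) f\<mu> sp in auto)
  have n: "\<bar>inner u (F u) - (\<integral>x. f x \<partial>\<mu>)\<bar> \<le> ?c / real (Suc n) * ((norm u)\<^sup>2 + measure \<mu> HP)" for n
  proof -
    let ?s = "\<lambda>x. qgrid (Suc n) (?\<phi> x)"
    let ?r = "\<lambda>x. qRe (?s x)"
    have s: "simple ?s" by (rule simple_qgrid[OF m b])
    have d: "norm (?s x - ?\<phi> x) \<le> ?c / real (Suc n)" for x by (rule qgrid_dist) simp
    have real: "y = of_real (qRe y)" if y: "y \<in> ?s ` HP" for y
    proof -
      obtain x where "y = ?s x" using y by blast
      then show ?thesis by (simp only: qgrid_of_real quat_sel_of_real)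
    qed
    have "inner u (L y (P (fib ?s y) u)) = qRe y * measure \<mu> (fib ?s y)" if "y \<in> ?s ` HP" for y
    proof -
      have "L y (P (fib ?s y) u) = qRe y *\<^sub>R P (fib ?s y) u" using real[OF that] L_of_real by metis
      then show ?thesis by (simp add: \<mu>(3)[OF fib_HB[OF s]])
    qed
    then have 1: "inner u (si ?s u) = (\<Sum>y\<in>?s ` HP. qRe y * measure \<mu> (fib ?s y))"
      by (simp add: simple_qint_def inner_sum_right)
    have ind: "integrable \<mu> (\<lambda>x. qRe y * indicator (fib ?s y) x)" for y
      using fib_HB[OF s] \<mu>(2)
      by (intro integrable_mult_right integrable_real_indicator) (auto simp: less_top[symmetric])
    have re: "?r x = (\<Sum>y\<in>?s ` HP. qRe y * indicator (fib ?s y) x)" if x: "x \<in> HP" for x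
    proof -
      have "(\<Sum>y\<in>?s ` HP. qRe y * indicator (fib ?s y) x) = (\<Sum>y\<in>?s ` HP. if y = ?s x then qRe y else 0)"
        using x by (intro sum.cong refl) (auto simp: indicator_def)
      also have "\<dots> = ?r x" using simple_finite[OF s] x by simp
      finally show ?thesis by simp
    qed
    have 2: "(\<integral>x. ?r x \<partial>\<mu>) = (\<Sum>y\<in>?s ` HP. qRe y * measure \<mu> (fib ?s y))"
    proof -
      have "(\<integral>x. ?r x \<partial>\<mu>) = (\<integral>x. (\<Sum>y\<in>?s ` HP. qRe y * indicator (fib ?s y) x) \<partial>\<mu>)"
        by (rule Bochner_Integration.integral_cong) (auto simp: sp re)
      also have "\<dots> = (\<Sum>y\<in>?s ` HP. \<integral>x. qRe y * indicator (fib ?s y) x \<partial>\<mu>)"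
        by (rule Bochner_Integration.integral_sum) (rule ind)
      also have "\<dots> = (\<Sum>y\<in>?s ` HP. qRe y * measure \<mu> (fib ?s y))"
        using fib_HB[OF s] \<mu>(2) sets.sets_into_space[of _ \<mu>] by (intro sum.cong refl) (simp add: Int_absorb2 sp Int_commute)
      finally show ?thesis .
    qed
    have ri: "integrable \<mu> ?r"
    proof -
      have "integrable \<mu> (\<lambda>x. \<Sum>y\<in>?s ` HP. qRe y * indicator (fib ?s y) x)"
        by (rule Bochner_Integration.integrable_sum) (rule ind)
      moreover have "integrable \<mu> ?r \<longleftrightarrow> integrable \<mu> (\<lambda>x. \<Sum>y\<in>?s ` HP. qRe y * indicator (fib ?s y) x)"
        by (rule Bochner_Integration.integrable_cong) (auto simp: sp re)
      ultimately show ?thesis by blast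
    qed
    have "\<bar>(\<integral>x. ?r x \<partial>\<mu>) - (\<integral>x. f x \<partial>\<mu>)\<bar> = \<bar>\<integral>x. ?r x - f x \<partial>\<mu>\<bar>"
      by (simp add: Bochner_Integration.integral_diff[OF ri fi])
    also have "\<dots> \<le> (\<integral>x. \<bar>?r x - f x\<bar> \<partial>\<mu>)" by (rule integral_abs_bound)
    also have "\<dots> \<le> (\<integral>x. ?c / real (Suc n) \<partial>\<mu>)"
    proof (rule integral_mono)
      show "integrable \<mu> (\<lambda>x. \<bar>?r x - f x\<bar>)" using ri fi by (intro integrable_abs Bochner_Integration.integrable_diff)
      show "\<bar>?r x - f x\<bar> \<le> ?c / real (Suc n)" for x
        using abs_qRe_le[of "?s x - ?\<phi> x"] d[of x] by simp
    qed simp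
    also have "\<dots> = ?c / real (Suc n) * measure \<mu> HP" by (simp add: sp)
    finally have 3: "\<bar>(\<integral>x. ?r x \<partial>\<mu>) - (\<integral>x. f x \<partial>\<mu>)\<bar> \<le> ?c / real (Suc n) * measure \<mu> HP" .
    have "\<bar>inner u (si ?s u - F u)\<bar> \<le> norm u * norm (si ?s u - F u)" by (rule Cauchy_Schwarz_ineq2)
    also have "\<dots> \<le> norm u * (?c / real (Suc n) * norm u)" by (intro mult_left_mono int_approx[OF F s d]) simp
    finally have 4: "\<bar>inner u (si ?s u) - inner u (F u)\<bar> \<le> ?c / real (Suc n) * (norm u)\<^sup>2"
      by (simp add: inner_diff_right power2_eq_square ac_simps)
    show ?thesis using 3 4 unfolding 1 2 distrib_left by linarith
  qed
  have "(\<lambda>n. (?c * (1 / real (Suc n))) * ((norm u)\<^sup>2 + measure \<mu> HP)) \<longlonglongrightarrow> (?c * 0) * ((norm u)\<^sup>2 + measure \<mu> HP)"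
    by (intro tendsto_intros LIMSEQ_Suc[OF lim_1_over_n])
  then have "\<bar>inner u (F u) - (\<integral>x. f x \<partial>\<mu>)\<bar> \<le> (?c * 0) * ((norm u)\<^sup>2 + measure \<mu> HP)"
    by (rule LIMSEQ_le[OF tendsto_const]) (use n in auto)
  then show ?thesis by simp
qed

subsection \<open>Reading off numbers from binary sequences\<close>

text \<open>The number whose binary digits stand at the positions \<open>g 0\<close>,
  \<open>g 1\<close> and so on; \<open>g\<close> makes it possible to interleave two numbers in one
  sequence.\<close>

definition dyadic :: "(nat \<Rightarrow> nat) \<Rightarrow> (nat \<Rightarrow> bool) \<Rightarrow> real" where
  "dyadic g \<omega> = (\<Sum>k. (1/2) ^ Suc k * of_bool (\<omega> (g k)))"

lemma dyadic_summable: "summable (\<lambda>k. (1/2) ^ Suc k * of_bool (\<omega> (g k)) :: real)"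
  by (rule summable_comparison_test'[OF sums_summable[OF power_half_series], of 0]) (auto simp: of_bool_def)

lemma dyadic_bounds: "0 \<le> dyadic g \<omega>" "dyadic g \<omega> \<le> 1"
proof -
  show "0 \<le> dyadic g \<omega>" unfolding dyadic_def by (intro suminf_nonneg dyadic_summable) auto
  have "dyadic g \<omega> \<le> (\<Sum>k. (1/2) ^ Suc k)"
    unfolding dyadic_def
    by (intro suminf_le dyadic_summable sums_summable[OF power_half_series]) (auto simp: of_bool_def)
  then show "dyadic g \<omega> \<le> 1" using sums_unique[OF power_half_series] by simp
qed

lemma coordinate_measurable: "(\<lambda>\<omega>. of_bool (\<omega> i) :: real) \<in> borel_measurable cantor"
proof -
  have "(\<lambda>\<omega>. of_bool (\<omega> i) :: real) = indicator {\<omega>. \<omega> i}" by (auto simp: fun_eq_iff indicator_def)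
  then show ?thesis using coordinate_sets[of i] by simp
qed

lemma dyadic_measurable: "dyadic g \<in> borel_measurable cantor"
  unfolding dyadic_def[abs_def]
  by (intro borel_measurable_suminf borel_measurable_times borel_measurable_const coordinate_measurable)

context commuting_projections
begin

text \<open>Termwise integration of the digit series; the integral of the digit at position
  \<open>i\<close> is the form of \<open>Q i\<close>.\<close>

lemma dyadic_integral:
  assumes "\<And>u. (\<lambda>k. (1/2) ^ Suc k * inner u (Q (g k) u)) sums inner u (A u)"
  shows "(\<integral>\<omega>. dyadic g \<omega> \<partial>\<nu> u) = inner u (A u)" "integrable (\<nu> u) (dyadic g)"
proof -
  interpret finite_measure "\<nu> u" by (rule \<nu>(1))
  let ?f = "\<lambda>k \<omega>. (1/2) ^ Suc k * of_bool (\<omega> (g k)) :: real"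
  have ind: "of_bool (\<omega> i) = (indicator {\<omega>. \<omega> i} \<omega> :: real)" for \<omega> i by (simp add: indicator_def)
  have s: "{\<omega>. \<omega> i} \<in> sets (\<nu> u)" for i using coordinate_sets \<nu>(2) by blast
  have int: "integrable (\<nu> u) (?f k)" for k
    unfolding ind by (intro integrable_mult_right integrable_real_indicator s) (simp add: less_top[symmetric])
  have val: "(\<integral>\<omega>. ?f k \<omega> \<partial>\<nu> u) = (1/2) ^ Suc k * inner u (Q (g k) u)" for k
    unfolding ind
    by (simp only: Bochner_Integration.integral_mult_right_zero Bochner_Integration.integral_indicator
        space_\<nu> Int_UNIV_right measure_coordinate)
  have nn: "norm (?f k \<omega>) = ?f k \<omega>" for k \<omega> by simp
  have "summable (\<lambda>k. \<integral>\<omega>. norm (?f k \<omega>) \<partial>\<nu> u)"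
    unfolding nn val by (rule sums_summable[OF assms])
  moreover have "AE \<omega> in \<nu> u. summable (\<lambda>k. norm (?f k \<omega>))"
    unfolding nn by (intro AE_I2 dyadic_summable)
  ultimately have "(\<lambda>k. \<integral>\<omega>. ?f k \<omega> \<partial>\<nu> u) sums (\<integral>\<omega>. (\<Sum>k. ?f k \<omega>) \<partial>\<nu> u)"
    by (intro sums_integral int)
  then show "(\<integral>\<omega>. dyadic g \<omega> \<partial>\<nu> u) = inner u (A u)"
    unfolding val dyadic_def[abs_def] using assms sums_unique2 by blast
  show "integrable (\<nu> u) (dyadic g)"
  proof (rule integrable_const_bound[of _ 1])
    show "dyadic g \<in> borel_measurable (\<nu> u)"
      unfolding measurable_cong_sets[OF \<nu>(2) refl] by (rule dyadic_measurable)
  qed (simp add: dyadic_bounds)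
qed

end

subsection \<open>Existence of the spectral measure\<close>

context polar_triple
begin

lemma ex_spectral_measure:
  assumes pos: "\<And>u. inner u (C u) \<ge> 0"
  shows "\<exists>P L. spectral_iqpvm \<iota> P L (\<lambda>u. A u + B u)"
proof -
  obtain L where L: "left_scalar_mult L" and LA: "\<And>q u. L q (A u) = A (L q u)"
    and LC: "\<And>q u. L q (C u) = C (L q u)" and BL: "\<And>u. B u = L \<iota> (C u)"
    by (rule ex_left_mult) blast
  obtain m1 where m1: "m1 > 0" "\<And>u. norm (A u) \<le> norm u * m1" using A.pos_bounded by blast
  obtain m2 where m2: "m2 > 0" "\<And>u. norm (C u) \<le> norm u * m2" using C.pos_bounded by blast
  define m where "m = max m1 m2"
  have m: "m > 0" using m1 by (simp add: m_def less_max_iff_disj)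
  have form: "\<bar>inner u (X u)\<bar> \<le> m * (norm u)\<^sup>2" if "norm (X u) \<le> norm u * k" "k \<le> m" for X and u :: 'h and k
  proof -
    have "\<bar>inner u (X u)\<bar> \<le> norm u * norm (X u)" by (rule Cauchy_Schwarz_ineq2)
    also have "\<dots> \<le> norm u * (norm u * m)"
      using order_trans[OF that(1) mult_left_mono[OF that(2) norm_ge_zero]] by (intro mult_left_mono) auto
    finally show ?thesis by (simp add: power2_eq_square ac_simps)
  qed
  have fA: "\<bar>inner u (A u)\<bar> \<le> m * (norm u)\<^sup>2" and fC: "\<bar>inner u (C u)\<bar> \<le> m * (norm u)\<^sup>2" for u
    using form[of A u m1, OF m1(2)] form[of C u m2, OF m2(2)] by (auto simp: m_def)
  \<comment> \<open>The form of \<open>A\<close> ranges over \<open>[-m, m]\<close> and that of the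
    positive \<open>C\<close> over \<open>[0, m]\<close>, relative to the squared norm; so
    \<open>A\<close> is shifted and scaled, \<open>C\<close> only scaled.\<close>
  define A' where "A' u = (1 / (2 * m)) *\<^sub>R (A u + m *\<^sub>R u)" for u
  define C' where "C' u = (1 / m) *\<^sub>R C u" for u
  have A': "contraction_op A'"
    unfolding contraction_op_def
  proof (intro conjI allI)
    show "selfadj A'" unfolding A'_def[abs_def] by (intro selfadj_scaleR selfadj_add A selfadj_id)
    fix u
    have e: "inner u (A' u) = (inner u (A u) + m * (norm u)\<^sup>2) / (2 * m)"
      by (simp add: A'_def inner_add_right power2_norm_eq_inner)
    show "0 \<le> inner u (A' u)" using fA[of u] m unfolding e by simp
    show "inner u (A' u) \<le> (norm u)\<^sup>2" using fA[of u] m unfolding e by (simp add: field_simps)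
  qed
  have C': "contraction_op C'"
    unfolding contraction_op_def
  proof (intro conjI allI)
    show "selfadj C'" unfolding C'_def[abs_def] by (intro selfadj_scaleR C)
    fix u
    show "0 \<le> inner u (C' u)" using pos[of u] m by (simp add: C'_def)
    show "inner u (C' u) \<le> (norm u)\<^sup>2" using fC[of u] m by (simp add: C'_def field_simps)
  qed
  have blA': "bounded_linear A'" and blC': "bounded_linear C'"
    using A' C' by (auto simp: contraction_op_def selfadj_def)
  have bopA': "bounded_op A'" unfolding A'_def[abs_def] by (intro bounded_op_scaleR bounded_op_add A bounded_op_id)
  have bopC': "bounded_op C'" unfolding C'_def[abs_def] by (intro bounded_op_scaleR C)
  have AC': "comm A' C'" by (simp add: A'_def C'_def AC A.add A.scaleR C.add C.scaleR scaleR_add_right ac_simps)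
  \<comment> \<open>Even positions hold the digits of \<open>A'\<close>, odd positions those of
    \<open>C'\<close>. All of them lie in the double commutant of two commuting operators and so
    commute with each other.\<close>
  define Q where "Q n = (if even n then digits A' (n div 2) else digits C' (n div 2))" for n
  have bQ: "bicomm {A', C'} (Q n)" for n
    unfolding Q_def using bicomm_mono[OF digits_properties(2)[OF A']] bicomm_mono[OF digits_properties(2)[OF C']]
    by simp
  interpret commuting_projections Q
  proof
    show "is_proj (Q n)" for n
      unfolding Q_def using digits_properties(1)[OF A'] digits_properties(1)[OF C'] by simp
    have cA: "comm A' (Q k)" for k by (rule bicommD[OF bQ blA']) (use AC' in auto)
    have cC: "comm C' (Q k)" for k by (rule bicommD[OF bQ blC']) (use AC' in auto)
    show "Q k (Q n u) = Q n (Q k u)" for k n u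
      by (rule bicommD[OF bQ[of n] bicomm_bl[OF bQ[of k]], THEN spec]) (use cA cC in auto)
  qed
  have E_comm: "X (E S u) = E S (X u)" if S: "S \<in> sets cantor" and X: "bounded_linear X" "comm X A'" "comm X C'" for X S u
  proof -
    have "bicomm {A', C'} (E S)" using E_bicomm[OF S] bicomm_trans bQ by blast
    then show ?thesis using bicommD[OF _ X(1)] X by auto
  qed
  have sumA: "(\<lambda>k. (1/2) ^ Suc k * inner u (Q (2 * k) u)) sums inner u (A' u)" for u
    using digits_sums[OF A', of u] by (simp add: Q_def)
  have sumC: "(\<lambda>k. (1/2) ^ Suc k * inner u (Q (2 * k + 1) u)) sums inner u (C' u)" for u
    using digits_sums[OF C', of u] by (simp add: Q_def)
  let ?a = "dyadic (\<lambda>k. 2 * k)" and ?c = "dyadic (\<lambda>k. 2 * k + 1)"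
  \<comment> \<open>Undoes the rescaling of \<open>A\<close> and \<open>C\<close>: a digit sequence
    becomes a point of the half plane.\<close>
  define z where "z \<omega> = of_real (m * (2 * ?a \<omega> - 1)) + \<iota> * of_real (m * ?c \<omega>)" for \<omega>
  have z1: "inner 1 (z \<omega>) = m * (2 * ?a \<omega> - 1)" for \<omega>
    by (simp add: z_def qRe_eq_inner[symmetric] qRe_imag_mult[OF iota] del: of_real_mult of_real_diff quat_sel_mult(5))
  have z2: "inner \<iota> (z \<omega>) = m * ?c \<omega>" for \<omega>
    unfolding z_def by (simp only: inner_add_right inner_of_real_imag[OF iota] inner_imag_imag[OF iota] add_0)
  have z_HP: "z \<omega> \<in> half_plane \<iota>" for \<omega>
  proof -
    have "m * ?c \<omega> \<ge> 0" using m dyadic_bounds(1)[of "\<lambda>k. 2 * k + 1" \<omega>] by simp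
    then show ?thesis unfolding half_plane_def z_def by blast
  qed
  have z_meas: "z \<in> measurable cantor (half_plane_borel \<iota>)"
  proof (rule measurable_restrict_space2)
    show "z \<in> borel_measurable cantor"
      unfolding z_def[abs_def] using dyadic_measurable by measurable
  qed (use z_HP in auto)
  define P where "P F = E (z -` F)" for F
  have vim: "z -` F \<in> sets cantor" if "F \<in> sets (half_plane_borel \<iota>)" for F
    using measurable_sets[OF z_meas that] by simp
  have P_comm: "X (P F u) = P F (X u)"
    if F: "F \<in> sets (half_plane_borel \<iota>)" and X: "bounded_linear X" "comm X A'" "comm X C'" for X F u
    unfolding P_def by (rule E_comm[OF vim[OF F] X])
  have P_bop: "bounded_op (P F)" if F: "F \<in> sets (half_plane_borel \<iota>)" for F
  proof (rule bounded_opI)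
    show "bounded_linear (P F)" unfolding P_def by (rule is_proj_bl[OF E_proj[OF vim[OF F]]])
    show "P F (u *\<^sub>H q) = P F u *\<^sub>H q" for u q
      by (rule P_comm[OF F bounded_linear_qscale, symmetric])
        (simp_all add: bounded_op_qscale[OF bopA'] bounded_op_qscale[OF bopC'])
  qed
  have "qPVM \<iota> P"
    unfolding qPVM_def
  proof (intro conjI ballI allI impI)
    fix F assume F: "F \<in> sets (half_plane_borel \<iota>)"
    show "bounded_op (P F)" by (rule P_bop[OF F])
    show "positive_op (P F)"
      unfolding positive_op_iff[OF P_bop[OF F]]
      using E_proj[OF vim[OF F]] is_proj_inner_self[OF E_proj[OF vim[OF F]]] by (simp add: P_def is_proj_def)
    fix F' assume F': "F' \<in> sets (half_plane_borel \<iota>)"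
    show "P F \<circ> P F' = P (F \<inter> F')"
      using E_Int[OF vim[OF F] vim[OF F']] by (simp add: P_def fun_eq_iff)
  next
    have "z -` half_plane \<iota> = UNIV" using z_HP by auto
    then show "P (half_plane \<iota>) = id" by (simp add: P_def E_UNIV fun_eq_iff)
  next
    fix F :: "nat \<Rightarrow> quat set" and u
    assume F: "range F \<subseteq> sets (half_plane_borel \<iota>) \<and> disjoint_family F"
    have "disjoint_family (\<lambda>n. z -` F n)" using F unfolding disjoint_family_on_def by blast
    then have "(\<lambda>n. E (z -` F n) u) sums E (\<Union>n. z -` F n) u"
      using F vim by (intro E_sums) auto
    then show "(\<lambda>n. P (F n) u) sums P (\<Union>n. F n) u" by (simp add: P_def vimage_UN)
  qed
  \<comment> \<open>\<open>L q\<close> commutes with \<open>A\<close> and \<open>C\<close>, hence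
    with their double commutant, which contains every value of \<open>P\<close> on a Borel
    set.\<close>
  moreover have "P F (L q u) = L q (P F u)" if F: "F \<in> sets (half_plane_borel \<iota>)" for F q u
  proof (rule P_comm[OF F, symmetric])
    show "bounded_linear (L q)" by (rule bounded_op_bl[OF lsm_bounded_op[OF L]])
    have lin: "L q (v + w) = L q v + L q w" "L q (r *\<^sub>R v) = r *\<^sub>R L q v" for v w r
      using bounded_linear.linear[OF bounded_op_bl[OF lsm_bounded_op[OF L]]] by (simp_all add: linear_add linear_scale)
    show "comm (L q) A'" "comm (L q) C'" by (simp_all add: A'_def C'_def lin LA LC)
  qed
  ultimately interpret I: iqpvm \<iota> P L
    using iota L by unfold_locales
  \<comment> \<open>A closed set containing all values of \<open>z\<close>; its complement in the
    half plane is null, so it contains the support, which is thereby bounded.\<close>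
  let ?K = "{x. \<bar>inner 1 x\<bar> \<le> m} \<inter> {x. inner \<iota> x \<le> m}"
  have cK: "closed ?K" by (intro closed_Int closed_Collect_le continuous_intros)
  have zK: "z \<omega> \<in> ?K" for \<omega>
  proof -
    have "\<bar>2 * ?a \<omega> - 1\<bar> \<le> 1" using dyadic_bounds[of "\<lambda>k. 2 * k" \<omega>] by linarith
    then have "\<bar>m * (2 * ?a \<omega> - 1)\<bar> \<le> m * 1" unfolding abs_mult using m by (intro mult_mono) auto
    moreover have "m * ?c \<omega> \<le> m * 1" using dyadic_bounds m by (intro mult_left_mono) auto
    ultimately show ?thesis using z1[of \<omega>] z2[of \<omega>] by simp
  qed
  have supp: "I.supp \<subseteq> ?K"
  proof
    fix x assume x: "x \<in> I.supp"
    show "x \<in> ?K"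
    proof (rule ccontr)
      assume nK: "x \<notin> ?K"
      have "openin (top_of_set I.HP) (I.HP \<inter> (- ?K))" using cK by (intro openin_open_Int open_Compl)
      moreover have "x \<in> I.HP \<inter> (- ?K)" using x I.supp_sub nK by blast
      ultimately have "P (I.HP \<inter> (- ?K)) \<noteq> (\<lambda>u. 0)" using x I.supp_iff by blast
      moreover have "z -` (I.HP \<inter> (- ?K)) = z -` {}" using zK by blast
      ultimately show False using I.P_empty by (simp add: P_def fun_eq_iff)
    qed
  qed
  define \<mu> where "\<mu> u = distr (\<nu> u) (half_plane_borel \<iota>) z" for u
  have z\<nu>: "z \<in> measurable (\<nu> u) (half_plane_borel \<iota>)" for u
    using z_meas measurable_cong_sets[OF \<nu>(2) refl] by blast
  have \<mu>: "finite_measure (\<mu> u)" "sets (\<mu> u) = I.HB" "F \<in> I.HB \<Longrightarrow> measure (\<mu> u) F = inner u (P F u)" for u F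
    unfolding \<mu>_def P_def
    by (simp_all add: finite_measure.finite_measure_distr[OF \<nu>(1) z\<nu>] measure_distr[OF z\<nu>] E_form[OF vim])
  \<comment> \<open>Clamped coordinates: bounded Borel functions on all quaternions that agree with
    the coordinates on the part of \<open>?K\<close> in the half plane.\<close>
  define f where "f x = max (- m) (min m (inner 1 x))" for x :: quat
  define g where "g x = max 0 (min m (inner \<iota> x))" for x
  have fm: "f \<in> borel_measurable borel" and gm: "g \<in> borel_measurable borel"
    unfolding f_def[abs_def] g_def[abs_def] by measurable
  have fm': "f \<in> borel_measurable (half_plane_borel \<iota>)" and gm': "g \<in> borel_measurable (half_plane_borel \<iota>)"
    using fm gm by (auto intro: measurable_restrict_space1)
  have fb: "\<bar>f x\<bar> \<le> m" and gb: "\<bar>g x\<bar> \<le> m" for x using m by (auto simp: f_def g_def)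
  have ex: "\<exists>F. I.is_int (\<lambda>x. of_real (h x)) F"
    if h: "h \<in> borel_measurable (half_plane_borel \<iota>)" "\<And>x. \<bar>h x\<bar> \<le> m" for h
  proof -
    have "(\<lambda>x. of_real (h x) :: quat) \<in> borel_measurable (half_plane_borel \<iota>)" using h(1) by measurable
    moreover have "bounded ((\<lambda>x. of_real (h x) :: quat) ` I.HP)"
      unfolding bounded_iff using h(2) by (intro exI[of _ m]) auto
    ultimately show ?thesis using I.int_exists by blast
  qed
  obtain F where F: "I.is_int (\<lambda>x. of_real (f x)) F" using ex[OF fm' fb] by blast
  obtain G where G: "I.is_int (\<lambda>x. of_real (g x)) G" using ex[OF gm' gb] by blast
  have fz: "f (z \<omega>) = m * (2 * ?a \<omega> - 1)" for \<omega>
    using zK[of \<omega>] z1[of \<omega>] by (auto simp: f_def)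
  have gz: "g (z \<omega>) = m * ?c \<omega>" for \<omega>
    using zK[of \<omega>] z2[of \<omega>] m dyadic_bounds(1)[of "\<lambda>k. 2 * k + 1" \<omega>] by (auto simp: g_def)
  \<comment> \<open>Self-adjoint operators are determined by their forms. The form of
    \<open>F\<close> is an integral over digit sequences, evaluated by the digit expansion of
    \<open>A'\<close>.\<close>
  have FA: "F u = A u" for u
  proof (rule selfadj_form_eq[OF I.int_real_selfadj[OF F] A(2)])
    fix u
    interpret finite_measure "\<nu> u" by (rule \<nu>(1))
    have "inner u (F u) = (\<integral>x. f x \<partial>\<mu> u)" by (rule I.int_form[OF F fm' \<mu>])
    also have "\<dots> = (\<integral>\<omega>. m * (2 * ?a \<omega> - 1) \<partial>\<nu> u)"
      unfolding \<mu>_def by (simp add: integral_distr[OF z\<nu> fm'] fz)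
    also have "\<dots> = m * (2 * inner u (A' u) - (norm u)\<^sup>2)"
      using dyadic_integral[OF sumA, of u] by (simp add: measure_\<nu>_UNIV)
    also have "\<dots> = inner u (A u)"
      using m by (simp add: A'_def inner_add_right power2_norm_eq_inner field_simps)
    finally show "inner u (F u) = inner u (A u)" .
  qed
  have GC: "G u = C u" for u
  proof (rule selfadj_form_eq[OF I.int_real_selfadj[OF G] C(2)])
    fix u
    have "inner u (G u) = (\<integral>x. g x \<partial>\<mu> u)" by (rule I.int_form[OF G gm' \<mu>])
    also have "\<dots> = (\<integral>\<omega>. m * ?c \<omega> \<partial>\<nu> u)"
      unfolding \<mu>_def by (simp add: integral_distr[OF z\<nu> gm'] gz)
    also have "\<dots> = m * inner u (C' u)" using dyadic_integral[OF sumC, of u] by simp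
    also have "\<dots> = inner u (C u)" using m by (simp add: C'_def)
    finally show "inner u (G u) = inner u (C u)" .
  qed
  have "I.is_int (\<lambda>x. of_real (f x) + \<iota> * of_real (g x)) (\<lambda>u. F u + L \<iota> (G u))"
    by (rule I.int_add[OF F I.int_mult[OF I.int_const G]])
  then have T: "I.is_int (\<lambda>x. of_real (f x) + \<iota> * of_real (g x)) (\<lambda>u. A u + B u)"
    by (simp only: FA GC BL)
  have xeq: "of_real (f x) + \<iota> * of_real (g x) = x" if "x \<in> I.supp" for x
  proof -
    have "x \<in> ?K" "x \<in> I.HP" using that supp I.supp_sub by auto
    then show ?thesis using half_plane_iff[OF iota, of x] by (auto simp: f_def g_def qRe_eq_inner)
  qed
  have bd: "norm (of_real (f x) + \<iota> * of_real (g x)) \<le> m + m" for x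
  proof -
    have "norm (of_real (f x) + \<iota> * of_real (g x)) \<le> norm (of_real (f x) :: quat) + norm (\<iota> * of_real (g x))"
      by (rule norm_triangle_ineq)
    also have "\<dots> = \<bar>f x\<bar> + \<bar>g x\<bar>" using iota by (simp add: norm_mult imag_units_iff)
    finally show ?thesis using fb[of x] gb[of x] by linarith
  qed
  have "bounded (I.on_supp ` I.HP)"
    unfolding bounded_iff
  proof (intro exI ballI)
    fix y assume "y \<in> I.on_supp ` I.HP"
    then show "norm y \<le> m + m" using bd m xeq by (auto split: if_splits) (metis)
  qed
  then obtain T' where T': "I.is_int I.on_supp T'"
    using I.int_exists[OF I.measurable_on_HP[OF I.supp_HB, of "\<lambda>x. x"]] by auto
  have "T' = (\<lambda>u. A u + B u)" by (rule I.int_supp_cong[OF T' T]) (simp add: xeq)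
  then have "spectral_iqpvm \<iota> P L (\<lambda>u. A u + B u)" using T' by unfold_locales simp
  then show ?thesis by blast
qed

end

theorem spectral_theorem:
  fixes T :: "'h::quat_hilbert \<Rightarrow> 'h"
  assumes i: "\<iota> \<in> imag_units" and T: "bounded_op T" "normal_op T"
  shows "\<exists>P L. spectral_iqpvm \<iota> P L T"
proof -
  note S = adj_properties[OF T(1)]
  interpret T: bounded_linear T by (rule bounded_op_bl[OF T(1)])
  interpret S: bounded_linear "adj T" by (rule bounded_op_bl[OF S(1)])
  have TS: "T (adj T u) = adj T (T u)" for u using T(2) unfolding normal_op_def by (metis comp_apply)
  have S': "inner (T u) v = inner u (adj T v)" for u v using S(2)[of v u] by (simp add: inner_commute)
  define A where "A u = (1/2) *\<^sub>R (T u + adj T u)" for u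
  define B where "B u = (1/2) *\<^sub>R (T u - adj T u)" for u
  have A: "bounded_op A" "selfadj A"
  proof -
    show b: "bounded_op A" unfolding A_def[abs_def] by (intro bounded_op_scaleR bounded_op_add T S)
    show "selfadj A" using bounded_op_bl[OF b]
      by (intro selfadjI) (simp_all add: A_def inner_add_left inner_add_right S(2) S' add.commute)
  qed
  have B: "bounded_op B" "inner (B u) v = - inner u (B v)" for u v
  proof -
    show "bounded_op B" unfolding B_def[abs_def] by (intro bounded_op_scaleR bounded_op_diff T S)
    show "inner (B u) v = - inner u (B v)"
      by (simp add: B_def inner_diff_left inner_diff_right S(2) S' field_simps)
  qed
  interpret A: bounded_linear A by (rule bounded_op_bl[OF A(1)])
  interpret B: bounded_linear B by (rule bounded_op_bl[OF B(1)])
  have AB: "A (B u) = B (A u)" for u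
    by (simp add: A_def B_def T.add T.diff T.scaleR S.add S.diff S.scaleR TS algebra_simps)
  let ?S = "\<lambda>u. - B (B u)"
  have bS: "bounded_op ?S"
  proof -
    have "bounded_op (\<lambda>u. (-1) *\<^sub>R B (B u))" by (intro bounded_op_scaleR bounded_op_comp[OF B(1) B(1)])
    then show ?thesis by simp
  qed
  have sS: "selfadj ?S" using bounded_op_bl[OF bS] by (intro selfadjI) (simp_all add: B(2))
  have "inner u (?S u) \<ge> 0" for u using B(2)[of u "B u"] by (metis inner_ge_zero inner_minus_right)
  then obtain C where C: "selfadj C" "\<And>u. inner u (C u) \<ge> 0" "\<And>u. C (C u) = ?S u" "bicomm {?S} C"
    using positive_sqrt[OF sS] by blast
  \<comment> \<open>The root is constructed in the real Hilbert space; lying in the double commutant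
    of a quaternionic operator, it is quaternionic linear.\<close>
  have bC: "bounded_op C" by (rule bounded_op_bicomm[OF C(4)]) (use bS in simp)
  have AC: "A (C u) = C (A u)" and BC: "B (C u) = C (B u)" for u
    using bicommD[OF C(4) A.bounded_linear_axioms] bicommD[OF C(4) B.bounded_linear_axioms]
    by (simp_all add: AB linear_neg[OF A.linear] linear_neg[OF B.linear])
  note C_nonneg = C(2)
  interpret polar_triple \<iota> A B C
    by unfold_locales (simp_all add: i A B(1) B(2) bC C(1) AB AC BC C(3))
  have "(\<lambda>u. A u + B u) = T" by (simp add: A_def B_def fun_eq_iff scaleR_right_distrib[symmetric] scaleR_2[symmetric])
  then show ?thesis using ex_spectral_measure[OF C_nonneg] by simp
qed

theorem theoremA:
  fixes \<iota> :: quat and T :: "'h::quat_hilbert \<Rightarrow> 'h"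
  assumes "\<iota> \<in> imag_units" and "bounded_op T" and "normal_op T"
  shows
    "(\<exists>P L. iqPVM \<iota> P L \<and> bounded (qsupp \<iota> P) \<and> T = qint \<iota> P L (\<lambda>x. x)) \<and>
     (\<forall>P P' L L'.
        iqPVM \<iota> P L \<and> bounded (qsupp \<iota> P) \<and> T = qint \<iota> P L (\<lambda>x. x) \<and>
        iqPVM \<iota> P' L' \<and> bounded (qsupp \<iota> P') \<and> T = qint \<iota> P' L' (\<lambda>x. x) \<longrightarrow>
        (\<forall>E\<in>sets (half_plane_borel \<iota>). P E = P' E) \<and>
        (\<forall>q\<in>cplane \<iota>. \<forall>u\<in>ortho_compl (ker (\<lambda>v. T v - adj T v)). L q u = L' q u)) \<and>
     (\<forall>P. (\<exists>L. iqPVM \<iota> P L \<and> bounded (qsupp \<iota> P) \<and> T = qint \<iota> P L (\<lambda>x. x)) \<longrightarrow>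
        (\<forall>L. left_scalar_mult L \<longrightarrow>
           (iqPVM \<iota> P L \<and> T = qint \<iota> P L (\<lambda>x. x) \<longleftrightarrow>
              L \<iota> \<circ> T = T \<circ> L \<iota> \<and>
              (\<exists>\<kappa>\<in>imag_units. \<iota> * \<kappa> = - (\<kappa> * \<iota>) \<and> L \<kappa> \<circ> T = adj T \<circ> L \<kappa>) \<and>
              positive_op (\<lambda>u. - L \<iota> (T u - adj T u)))) \<and>
        qsupp \<iota> P = spherical_spectrum T \<inter> half_plane \<iota> \<and>
        (\<forall>q\<in>half_plane \<iota>. q \<in> point_spectrum T \<longleftrightarrow> P {q} \<noteq> (\<lambda>u. 0)) \<and>
        (\<forall>q\<in>half_plane \<iota>. q \<in> continuous_spectrum T \<longleftrightarrow>
           P {q} = (\<lambda>u. 0) \<and>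
           (\<forall>U. openin (top_of_set (half_plane \<iota>)) U \<and> q \<in> U \<longrightarrow> P U \<noteq> (\<lambda>u. 0))) \<and>
        residual_spectrum T = {})"
proof (intro conjI allI impI)
  note spectral = spectral_iqpvm_iff[OF assms(1), of _ _ T]
  show "\<exists>P L. iqPVM \<iota> P L \<and> bounded (qsupp \<iota> P) \<and> T = qint \<iota> P L (\<lambda>x. x)"
    unfolding spectral by (rule spectral_theorem[OF assms])
  fix P P' :: "quat set \<Rightarrow> 'h \<Rightarrow> 'h" and L L'
  assume "iqPVM \<iota> P L \<and> bounded (qsupp \<iota> P) \<and> T = qint \<iota> P L (\<lambda>x. x) \<and>
    iqPVM \<iota> P' L' \<and> bounded (qsupp \<iota> P') \<and> T = qint \<iota> P' L' (\<lambda>x. x)"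
  then have 1: "spectral_iqpvm \<iota> P L T" and 2: "spectral_iqpvm \<iota> P' L' T"
    unfolding spectral[symmetric] by blast+
  show "\<forall>E\<in>sets (half_plane_borel \<iota>). P E = P' E" using spectral_measure_unique[OF 1 2] by blast
  show "\<forall>q\<in>cplane \<iota>. \<forall>u\<in>ortho_compl (ker (\<lambda>v. T v - adj T v)). L q u = L' q u"
    using left_mult_unique[OF 1 2] by blast
next
  note spectral = spectral_iqpvm_iff[OF assms(1), of _ _ T]
  fix P assume "\<exists>L. iqPVM \<iota> P L \<and> bounded (qsupp \<iota> P) \<and> T = qint \<iota> P L (\<lambda>x. x)"
  then obtain L0 where S: "spectral_iqpvm \<iota> P L0 T" unfolding spectral by blast
  then have b: "bounded (qsupp \<iota> P)" unfolding spectral[symmetric] by blast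
  interpret spectral_iqpvm \<iota> P L0 T by (rule S)
  show "iqPVM \<iota> P L \<and> T = qint \<iota> P L (\<lambda>x. x) \<longleftrightarrow>
      L \<iota> \<circ> T = T \<circ> L \<iota> \<and>
      (\<exists>\<kappa>\<in>imag_units. \<iota> * \<kappa> = - (\<kappa> * \<iota>) \<and> L \<kappa> \<circ> T = adj T \<circ> L \<kappa>) \<and>
      positive_op (\<lambda>u. - L \<iota> (T u - adj T u))" (is "?l \<longleftrightarrow> ?r") if L: "left_scalar_mult L" for L
  proof -
    \<comment> \<open>Boundedness of the support is a property of \<open>P\<close> and thus
      inherited from \<open>L0\<close>.\<close>
    have "?l \<longleftrightarrow> spectral_iqpvm \<iota> P L T" using b spectral[of P L] by blast
    also have "\<dots> \<longleftrightarrow> ?r"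
      using left_mult_conditions[of \<iota> P L T] left_mult_characterization[OF S L] by blast
    finally show ?thesis .
  qed
  show "qsupp \<iota> P = spherical_spectrum T \<inter> half_plane \<iota>" by (rule spectrum_eq[OF assms(3)])
  show "\<forall>q\<in>half_plane \<iota>. q \<in> point_spectrum T \<longleftrightarrow> P {q} \<noteq> (\<lambda>u. 0)"
    using point_spectrum_iff by blast
  show "\<forall>q\<in>half_plane \<iota>. q \<in> continuous_spectrum T \<longleftrightarrow>
      P {q} = (\<lambda>u. 0) \<and> (\<forall>U. openin (top_of_set (half_plane \<iota>)) U \<and> q \<in> U \<longrightarrow> P U \<noteq> (\<lambda>u. 0))"
    using continuous_spectrum_iff[OF assms(3)] by blast
  show "residual_spectrum T = {}" by (rule residual_spectrum_empty[OF assms(2,3)])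
qed

end
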